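(* (Part (ii).) Let $l\geq 5$ be an integer. Then \[ \sum_{\substack{l_1\geq 2,\ l_2,l_3,l_4\geq 1\\ l_1+l_2+l_3+l_4=l}}\big(3^{l_2}2^{l_1-1}-3^{l_2}-1\big)\,2^{l_1+l_3}\,\zeta(l_1,l_2,l_3,l_4)=\frac{(l+1)(l^2+5l-18)}{12}\,\zeta(l). \]
   Context: For positive integers $l_1,\dots,l_n$ with $l_1\geq 2$, $\zeta(l_1,\dots,l_n)=\sum_{m_1>m_2>\cdots>m_n>0}m_1^{-l_1}\cdots m_n^{-l_n}$, and $\zeta(l)$ is the Riemann zeta value. *)

theory Defs
  imports "HOL-Analysis.Analysis"
begin

text \<open>
  The multiple zeta value of the index list \<open>[l\<^sub>1, \<dots>, l\<^sub>n]\<close>, summed over all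
  \<open>m\<^sub>1 > m\<^sub>2 > \<dots> > m\<^sub>n > 0\<close>, which are encoded as strictly decreasing lists. All terms
  are nonnegative, so the unordered sum has the classical value; it converges for positive
  entries with \<open>l\<^sub>1 \<ge> 2\<close>, and otherwise the value has no meaning.
\<close>

definition mzv :: "nat list \<Rightarrow> real" where
  "mzv ls =
     (\<Sum>\<^sub>\<infinity>ms\<in>{ms :: nat list. length ms = length ls \<and> sorted_wrt (>) ms \<and> (\<forall>m\<in>set ms. 0 < m)}.
        \<Prod>i<length ls. 1 / real (ms ! i) ^ (ls ! i))"

definition riemann_zeta :: "nat \<Rightarrow> real" where
  "riemann_zeta l = (\<Sum>n. 1 / real (Suc n) ^ l)"

end

theory Submission
  imports Defs "HOL-Library.Function_Algebras" "HOL-Real_Asymp.Real_Asymp"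
begin

text \<open>
  Multiplying by \<open>t ^ l\<close> and summing over \<open>l\<close> turns the left-hand side into
  \<open>12 (F(4,3,2,1) - F(2,3,2,1)) - 4 (F(2,1,2,1) - F(0,1,2,1))\<close>, where
  \<open>F(a\<^sub>1,\<dots>,a\<^sub>n)\<close> is the sum over \<open>m\<^sub>1 > \<dots> > m\<^sub>n > 0\<close> of the product of the
  \<open>t / (m\<^sub>i - a\<^sub>i t)\<close>. Truncated at \<open>m\<^sub>1 \<le> N\<close>, two such sums can be multiplied in two ways:
  by interleaving the indices (stuffle; equal indices are resolved by partial fractions), or by
  forming the Cauchy product of their term sequences (shuffle), which misses exactly the
  pairs of outer indices \<open>i, j \<le> N\<close> with \<open>i + j > N\<close>. A suitable linear combination of
  such double shuffle relations expresses the combination above through the sums of the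
  \<open>(t / (m - t)) ^ r\<close> with \<open>r \<le> 4\<close>, whose coefficients are multiples of \<open>\<zeta>(l)\<close>, and the
  missed corner contributions. Up to terms tending to \<open>0\<close>, the latter
  are polynomials in \<open>t\<close> of degree at most \<open>4\<close> with coefficients depending on \<open>N\<close> only, so
  they do not affect the coefficient of \<open>t ^ l\<close> for \<open>l \<ge> 5\<close>.
\<close>

section \<open>Nested sums and the stuffle product\<close>

text \<open>Truncation is forced: words with leading letter \<open>(a, 1)\<close> have divergent
  sums, growing like powers of log N, so double shuffle holds only with corner terms. The leading
  letters enter a corner term only through an error O(log^k N / N); what survives is governed by the
  inner words. Inner sums with letter 1 are compared with letter 0: \<open>P = L + \<Delta>\<close>,
  where \<open>L\<close> diverges but is a multiple of t, while \<open>\<Delta>\<close> depends on t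
  in a complicated way but converges fast enough to be pulled out of a corner sum. The multipliers
  are such that every product of \<open>\<Delta>\<close> with a divergent corner sum cancels. What
  is left has letter 0 only and is homogeneous in t, term by term. Its coefficients depend on N and
  are not shown to converge one by one; they are eliminated at finite N, by combining the values at
  t, 2t, 4t and 8t, before the limit is taken. The differences of leading letters (4 against 2, 2
  against 0) make the quadruple sums converge and at the same time delete the terms with l_1 =
  1.\<close>

type_synonym letter = "nat \<times> nat"

text \<open>
  The letter \<open>(a, r)\<close> stands for \<open>(t / (m - a t)) ^ r\<close> with \<open>\<tau> = 1 / t\<close>. In this scaling the
  coefficients of partial fraction decompositions are free of \<open>\<tau>\<close>.
\<close>

definition letter_val :: "real \<Rightarrow> letter \<Rightarrow> nat \<Rightarrow> real" where
  "letter_val \<tau> x m = 1 / (\<tau> * real m - real (fst x)) ^ snd x"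

definition nest :: "(nat \<Rightarrow> real) \<Rightarrow> (nat \<Rightarrow> real) \<Rightarrow>
    nat \<Rightarrow> real" where
  "nest x f N = (\<Sum>m=1..N. x m * f (m - 1))"

fun W :: "real \<Rightarrow> letter list \<Rightarrow> nat \<Rightarrow> real" where
  "W \<tau> [] = 1"
| "W \<tau> (x # u) = nest (letter_val \<tau> x) (W \<tau> u)"

lemma nest_0 [simp]: "nest x f 0 = 0"
  by (simp add: nest_def)

lemma nest_Suc: "nest x f (Suc N) = nest x f N + x (Suc N) * f N"
  by (simp add: nest_def)

text \<open>The two outermost indices are compared: either one is larger and the other factor moves
  inside, or they agree and their summands merge.\<close>

lemma nest_mult:
  "nest x f * nest y g = nest x (f * nest y g) + nest y (nest x f * g) + nest (x * y) (f * g)"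
proof
  fix N
  show "(nest x f * nest y g) N =
      (nest x (f * nest y g) + nest y (nest x f * g) + nest (x * y) (f * g)) N"
    by (induction N) (simp_all add: nest_Suc algebra_simps)
qed

lemma nest_add: "nest x (f + g) = nest x f + nest x g"
  and nest_diff: "nest x (f - g) = nest x f - nest x g"
  by (auto simp: nest_def fun_eq_iff algebra_simps sum.distrib sum_subtractf)

text \<open>An operator for the coefficients \<open>1 / (b - a)\<close> of partial fractions: the
  pointwise ring of functions offers only numerals as literal constants.\<close>

definition scale :: "real \<Rightarrow> (nat \<Rightarrow> real) \<Rightarrow> nat \<Rightarrow> real" where
  "scale c f N = c * f N"

lemma nest_scale: "nest x (scale c f) = scale c (nest x f)"
  by (auto simp: nest_def scale_def fun_eq_iff sum_distrib_left algebra_simps)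

lemma W_mult:
  "W \<tau> (x # u) * W \<tau> (y # v) = nest (letter_val \<tau> x) (W \<tau> u * W \<tau> (y # v))
     + nest (letter_val \<tau> y) (W \<tau> (x # u) * W \<tau> v)
         + nest (letter_val \<tau> x * letter_val \<tau> y) (W \<tau> u * W \<tau> v)"
  by (simp add: nest_mult)

lemma nest_cong: "(\<And>m. m > 0 \<Longrightarrow> x m = y m) \<Longrightarrow> nest x f = nest y f"
  by (auto simp: nest_def fun_eq_iff intro!: sum.cong)

lemma nest_letter_val_same: "nest (letter_val \<tau> (a, r) * letter_val \<tau> (a, s)) f
    = nest (letter_val \<tau> (a, r + s)) f"
  by (rule nest_cong) (simp add: letter_val_def power_add)

text \<open>Simp collects equal words into numeral multiples in the ring of functions; this lemma
  and the next ones let such multiples pass through the operators.\<close>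

lemma numeral_fun_apply [simp]: "(numeral k :: nat \<Rightarrow> real) n = numeral k"
  by (induction k) (simp_all add: numeral.simps)

lemma nest_numeral: "nest x (numeral k * f) = numeral k * nest x f"
  by (auto simp: nest_def fun_eq_iff sum_distrib_left algebra_simps)

lemma scale_numeral: "scale c (numeral k * f) = numeral k * scale c f"
  by (auto simp: scale_def fun_eq_iff)

lemma numeral_mult_at: "(numeral k * f) n = numeral k * (f n :: real)"
  by simp

lemma nest_minus: "nest x (- f) = - nest x f"
  by (auto simp: nest_def fun_eq_iff sum_negf)

lemma scale_minus: "scale c (- f) = - scale c f"
  by (auto simp: scale_def fun_eq_iff)

lemma nest_one: "nest (letter_val \<tau> x) 1 = W \<tau> [x]"
  by simp

section \<open>Merged letters and partial fractions\<close>

locale large_parameter =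
  fixes \<tau> :: real
  assumes tau: "\<tau> > 8"
begin

text \<open>The largest letter needed is 4 = 2 + 2, so the bound 8 on \<open>\<tau>\<close> keeps
  all denominators of size at least 4 m.\<close>

lemma letter_val_denom: "m > 0 \<Longrightarrow> a \<le> 4
    \<Longrightarrow> \<tau> * real m - real a \<ge> 4 * real m"
proof -
  assume "m > 0" "a \<le> 4"
  then have "8 * real m \<le> \<tau> * real m" "real a \<le> 4 * real m"
    using tau by (auto intro: mult_right_mono)
  then show ?thesis by linarith
qed

lemma letter_val_denom_nz: "m > 0 \<Longrightarrow> a \<le> 4
    \<Longrightarrow> \<tau> * real m - real a \<noteq> 0"
  using letter_val_denom[of m a] by linarith

text \<open>One step of partial fractions, from (X - a) - (X - b) = b - a with X =
  \<open>\<tau> * m\<close>. It is iterated until a power reaches 0 and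
  \<open>letter_val_pow_0\<close> removes that letter.\<close>

lemma nest_letter_val_letter_val:
  assumes "a \<le> 4" "b \<le> 4" "a \<noteq> b" "r > 0" "s > 0"
  shows "nest (letter_val \<tau> (a, r) * letter_val \<tau> (b, s)) f = scale (1 / (real b - real a))
    (nest (letter_val \<tau> (a, r - 1) * letter_val \<tau> (b, s)) f
        - nest (letter_val \<tau> (a, r) * letter_val \<tau> (b, s - 1)) f)"
proof -
  have *: "letter_val \<tau> (a, r) m * letter_val \<tau> (b, s) m
      = (letter_val \<tau> (a, r - 1) m * letter_val \<tau> (b, s) m
      - letter_val \<tau> (a, r) m * letter_val \<tau> (b, s - 1) m) / (real b - real a)" if "m > 0" for m
  proof -
    have split: "letter_val \<tau> (c, k) m
        = letter_val \<tau> (c, k - 1) m * (1 / (\<tau> * real m - real c))" if "k > 0" for c k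
      using that by (cases k) (auto simp: letter_val_def)
    show ?thesis
      using letter_val_denom_nz[OF that assms(1)] letter_val_denom_nz[OF that assms(2)] assms(3)
      unfolding split[OF assms(4)] split[OF assms(5)]
      by (simp add: divide_simps) (simp add: algebra_simps)
  qed
  show ?thesis
    by (auto simp: * fun_eq_iff nest_def scale_def sum_divide_distrib sum_subtractf algebra_simps
        diff_divide_distrib sum_distrib_left intro!: sum.cong)
qed

lemma letter_val_pow_0 [simp]: "letter_val \<tau> (a, 0) = 1"
  by (auto simp: letter_val_def)

text \<open>Multiplies out two words and folds the result back into words. As
  \<open>W.simps(2)\<close> serves from right to left here, it has to leave the simp set
  below.\<close>

lemmas stuffle = W_mult W.simps(2)[symmetric] nest_add nest_diff nest_scale nest_letter_val_same nest_letter_val_letter_val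
  nest_one nest_numeral nest_minus
  scale_numeral scale_minus numeral_mult_at One_nat_def[symmetric]

lemma scale_distrib: "scale c (f + g) = scale c f + scale c g" "scale c (f - g) = scale c f - scale c g"
  "scale c (scale d f) = scale (c * d) f"
  by (auto simp: scale_def fun_eq_iff algebra_simps)

declare W.simps(2) [simp del]

lemma W_mult_at: "W \<tau> u N * W \<tau> v N = (W \<tau> u * W \<tau> v) N"
  by simp

end

section \<open>The shuffle product\<close>

definition cauchy_prod :: "(nat \<Rightarrow> real) \<Rightarrow> (nat \<Rightarrow> real)
    \<Rightarrow> nat \<Rightarrow> real" where
  "cauchy_prod f g n = (\<Sum>i\<le>n. f i * g (n - i))"

definition partial_sum :: "(nat \<Rightarrow> real) \<Rightarrow> nat \<Rightarrow> real" where
  "partial_sum f n = (\<Sum>i\<le>n. f i)"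

text \<open>
  \<open>Kop \<tau> a\<close> inverts multiplication by \<open>\<tau> n - a\<close>. As multiplication by \<open>n\<close> is a derivation of the
  Cauchy product, the numbers \<open>a\<close> add up under products; this is the shuffle product.
\<close>

definition Kop :: "real \<Rightarrow> nat \<Rightarrow> (nat \<Rightarrow> real) \<Rightarrow> nat
    \<Rightarrow> real" where
  "Kop \<tau> a f n = f n / (\<tau> * real n - real a)"

text \<open>In terms of power series, \<open>Jop\<close> solves (\<open>\<tau>\<close> z d/dz - a) F
  = z / (1 - z) * f. It prepends a letter of power 1, whereas \<open>Kop\<close> raises the power of
  the leading letter.\<close>

definition Jop :: "real \<Rightarrow> nat \<Rightarrow> (nat \<Rightarrow> real) \<Rightarrow> nat
    \<Rightarrow> real" where
  "Jop \<tau> a f n = (\<Sum>i<n. f i) / (\<tau> * real n - real a)"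

fun dW :: "real \<Rightarrow> letter list \<Rightarrow> nat \<Rightarrow> real" where
  "dW \<tau> [] n = (if n = 0 then 1 else 0)"
| "dW \<tau> (x # u) n = (if n = 0 then 0 else letter_val \<tau> x n * W \<tau> u (n - 1))"

lemma partial_sum_dW: "partial_sum (dW \<tau> u) = W \<tau> u"
proof (cases u)
  case Nil
  then show ?thesis by (auto simp: partial_sum_def fun_eq_iff sum.delta)
next
  case (Cons x v)
  show ?thesis
  proof
    fix n show "partial_sum (dW \<tau> u) n = W \<tau> u n"
      by (induction n) (simp_all add: Cons partial_sum_def W.simps nest_Suc)
  qed
qed

lemma dW_J: "dW \<tau> ((a, 1) # u) = Jop \<tau> a (dW \<tau> u)"
proof
  fix n
  have "n > 0 \<Longrightarrow> W \<tau> u (n - 1) = (\<Sum>i<n. dW \<tau> u i)"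
    using partial_sum_dW[of \<tau> u, THEN fun_cong, of "n - 1"]
    by (simp add: partial_sum_def lessThan_Suc_atMost[symmetric])
  then show "dW \<tau> ((a, 1) # u) n = Jop \<tau> a (dW \<tau> u) n"
    by (simp add: Jop_def letter_val_def)
qed

lemma dW_K: "r > 0 \<Longrightarrow> dW \<tau> ((a, Suc r) # u) = Kop \<tau> a (dW \<tau> ((a, r) # u))"
  by (auto simp: Kop_def letter_val_def fun_eq_iff)

lemma cauchy_prod_commute: "cauchy_prod f g = cauchy_prod g f"
proof
  fix n
  show "cauchy_prod f g n = cauchy_prod g f n"
    unfolding cauchy_prod_def
    by (rule sum.reindex_bij_witness[of _ "\<lambda>i. n - i" "\<lambda>i. n - i"]) auto
qed

lemma cauchy_prod_add: "cauchy_prod (f + g) h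
    = cauchy_prod f h + cauchy_prod g h" "cauchy_prod h (f + g) = cauchy_prod h f + cauchy_prod h g"
  by (auto simp: cauchy_prod_def fun_eq_iff sum.distrib algebra_simps)

lemma cauchy_prod_delta: "cauchy_prod (dW \<tau> []) f = f" "cauchy_prod f (dW \<tau> []) = f"
proof -
  show *: "cauchy_prod (dW \<tau> []) f = f" for f
    by (auto simp: cauchy_prod_def fun_eq_iff if_distrib[where f="\<lambda>x. x *
        _"] sum.delta cong: if_cong)
  show "cauchy_prod f (dW \<tau> []) = f"
    by (subst cauchy_prod_commute) (rule *)
qed

text \<open>Defined as a difference, so that the truncated shuffle relations are exact;
  \<open>defect_corner_sum\<close> identifies it with the sum over the corner.\<close>

definition defect :: "real \<Rightarrow> letter list \<Rightarrow> letter list \<Rightarrow> nat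
    \<Rightarrow> real" where
  "defect \<tau> u v N = W \<tau> u N * W \<tau> v N
      - partial_sum (cauchy_prod (dW \<tau> u) (dW \<tau> v)) N"

lemma Jop_add: "Jop \<tau> a (f + g) = Jop \<tau> a f + Jop \<tau> a g"
  and Kop_add: "Kop \<tau> a (f + g) = Kop \<tau> a f + Kop \<tau> a g"
  and partial_sum_add: "partial_sum (f + g) = partial_sum f + partial_sum g"
  by (auto simp: Jop_def Kop_def partial_sum_def fun_eq_iff sum.distrib add_divide_distrib)

lemma Jop_numeral: "Jop \<tau> a (numeral k * f) = numeral k * Jop \<tau> a f"
  and Kop_numeral: "Kop \<tau> a (numeral k * f) = numeral k * Kop \<tau> a f"
  and partial_sum_numeral: "partial_sum (numeral k * f) = numeral k * partial_sum f"
  by (auto simp: Jop_def Kop_def partial_sum_def fun_eq_iff sum_distrib_left)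

text \<open>Both sides are the coefficient of z^n in z / (1 - z) * f * g.\<close>

lemma cauchy_prod_psum: "cauchy_prod (\<lambda>n. \<Sum>i<n. f i) g n = (\<Sum>i<n. cauchy_prod f g i)"
proof -
  have "cauchy_prod (\<lambda>n. \<Sum>i<n. f i) g n = (\<Sum>i\<le>n. \<Sum>k<i. f k * g (n - i))"
    by (simp add: cauchy_prod_def sum_distrib_right)
  also have "\<dots> = (\<Sum>(i, k)\<in>Sigma {..n} (\<lambda>i. {..<i}). f k * g (n - i))"
    by (simp add: sum.Sigma)
  also have "\<dots> = (\<Sum>(m, k)\<in>Sigma {..<n} (\<lambda>m. {..m}). f k * g (m - k))"
    by (rule sum.reindex_bij_witness[of _ "\<lambda>(m, k). (n - m + k, k)" "\<lambda>(i, k).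
        (n - i + k, k)"]) auto
  also have "\<dots> = (\<Sum>i<n. cauchy_prod f g i)"
    by (simp add: cauchy_prod_def sum.Sigma)
  finally show ?thesis .
qed

context large_parameter
begin

text \<open>For i + j = n the factor \<open>\<tau> * n - (a + b)\<close> is the sum of
  \<open>\<tau> * i - a\<close> and \<open>\<tau> * j - b\<close>. At n = 0 it may vanish, which is
  why that case is separate.\<close>

lemma cauchy_prod_divide:
  assumes "f' 0 = 0" "g' 0 = 0" "a + b \<le> 4"
    and f: "\<And>n. (\<tau> * real n - real a) * f' n = f n"
    and g: "\<And>n. (\<tau> * real n - real b) * g' n = g n"
  shows "cauchy_prod f' g' n = (cauchy_prod f g' n + cauchy_prod f' g n) / (\<tau> * real n - real (a + b))"
proof (cases "n = 0")
  case True
  then show ?thesis using assms by (simp add: cauchy_prod_def)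
next
  case False
  have "(\<tau> * real n - real (a + b)) * cauchy_prod f' g' n
      = (\<Sum>i\<le>n. ((\<tau> * real i - real a) * f' i) * g' (n - i)
          + f' i * ((\<tau> * real (n - i) - real b) * g' (n - i)))"
    unfolding cauchy_prod_def sum_distrib_left
    by (intro sum.cong) (auto simp: of_nat_diff algebra_simps)
  also have "\<dots> = cauchy_prod f g' n + cauchy_prod f' g n"
    by (simp only: f g cauchy_prod_def sum.distrib)
  finally show ?thesis
    using letter_val_denom_nz[ of n "a + b"] False assms(3) by (simp add: field_simps)
qed

lemma J_inverse:
  assumes "a \<le> 4"
  shows "(\<tau> * real n - real a) * Jop \<tau> a f n = (\<Sum>i<n. f i)"
  using letter_val_denom_nz[ of n a] assms by (cases "n = 0") (auto simp: Jop_def)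

text \<open>\<open>f 0 = 0\<close> covers n = 0 with a = 0, where the division by zero in
  \<open>Kop\<close> returns 0.\<close>

lemma K_inverse:
  assumes "a \<le> 4" "f 0 = 0"
  shows "(\<tau> * real n - real a) * Kop \<tau> a f n = f n"
  using letter_val_denom_nz[ of n a] assms by (cases "n = 0") (auto simp: Kop_def)

lemma Jop_0 [simp]: "Jop \<tau> a f 0 = 0"
  by (simp add: Jop_def)

lemma Kop_0: "f 0 = 0 \<Longrightarrow> Kop \<tau> a f 0 = 0"
  by (simp add: Kop_def)

lemma cauchy_prod_J_J:
  assumes "a + b \<le> 4"
  shows "cauchy_prod (Jop \<tau> a f) (Jop \<tau> b g)
    = Jop \<tau> (a + b) (cauchy_prod f (Jop \<tau> b g) + cauchy_prod (Jop \<tau> a f) g)"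
proof
  fix n
  have "cauchy_prod (Jop \<tau> a f) (Jop \<tau> b g) n
      = (cauchy_prod (\<lambda>n. \<Sum>i<n. f i) (Jop \<tau> b g) n
      + cauchy_prod (Jop \<tau> a f) (\<lambda>n. \<Sum>i<n. g i) n) / (\<tau> * real n - real (a + b))"
    by (rule cauchy_prod_divide) (use assms in \<open>auto simp: J_inverse\<close>)
  also have "cauchy_prod (Jop \<tau> a f) (\<lambda>n. \<Sum>i<n. g i) n
      = (\<Sum>i<n. cauchy_prod (Jop \<tau> a f) g i)"
    by (subst cauchy_prod_commute, subst cauchy_prod_psum, subst cauchy_prod_commute) (rule refl)
  finally show "cauchy_prod (Jop \<tau> a f) (Jop \<tau> b g) n
      = Jop \<tau> (a + b) (cauchy_prod f (Jop \<tau> b g) + cauchy_prod (Jop \<tau> a f) g) n"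
    by (simp add: Jop_def[of \<tau> "a + b"] cauchy_prod_psum sum.distrib)
qed

lemma cauchy_prod_K_J:
  assumes "a + b \<le> 4" "f 0 = 0"
  shows "cauchy_prod (Kop \<tau> a f) (Jop \<tau> b g)
    = Kop \<tau> (a + b) (cauchy_prod f (Jop \<tau> b g))
        + Jop \<tau> (a + b) (cauchy_prod (Kop \<tau> a f) g)"
proof
  fix n
  have "cauchy_prod (Kop \<tau> a f) (Jop \<tau> b g) n = (cauchy_prod f (Jop \<tau> b g) n
      + cauchy_prod (Kop \<tau> a f) (\<lambda>n. \<Sum>i<n. g i) n) / (\<tau> * real n - real (a + b))"
    by (rule cauchy_prod_divide) (use assms in \<open>auto simp: J_inverse K_inverse Kop_0\<close>)
  also have "cauchy_prod (Kop \<tau> a f) (\<lambda>n. \<Sum>i<n. g i) n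
      = (\<Sum>i<n. cauchy_prod (Kop \<tau> a f) g i)"
    by (subst cauchy_prod_commute, subst cauchy_prod_psum, subst cauchy_prod_commute) (rule refl)
  finally show "cauchy_prod (Kop \<tau> a f) (Jop \<tau> b g) n
      = (Kop \<tau> (a + b) (cauchy_prod f (Jop \<tau> b g))
          + Jop \<tau> (a + b) (cauchy_prod (Kop \<tau> a f) g)) n"
    by (simp add: Jop_def[of \<tau> "a + b"] Kop_def[of \<tau> "a + b"] add_divide_distrib)
qed

lemma cauchy_prod_K_K:
  assumes "a + b \<le> 4" "f 0 = 0" "g 0 = 0"
  shows "cauchy_prod (Kop \<tau> a f) (Kop \<tau> b g)
    = Kop \<tau> (a + b) (cauchy_prod f (Kop \<tau> b g) + cauchy_prod (Kop \<tau> a f) g)"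
proof
  fix n
  have "cauchy_prod (Kop \<tau> a f) (Kop \<tau> b g) n = (cauchy_prod f (Kop \<tau> b g) n
      + cauchy_prod (Kop \<tau> a f) g n) / (\<tau> * real n - real (a + b))"
    by (rule cauchy_prod_divide) (use assms in \<open>auto simp: K_inverse Kop_0\<close>)
  then show "cauchy_prod (Kop \<tau> a f) (Kop \<tau> b g) n
    = Kop \<tau> (a + b) (cauchy_prod f (Kop \<tau> b g) + cauchy_prod (Kop \<tau> a f) g) n"
    by (simp add: Kop_def[of \<tau> "a + b"])
qed

lemma cauchy_prod_dW_1_1:
  "a + b \<le> 4 \<Longrightarrow> cauchy_prod (dW \<tau> ((a, 1) # u)) (dW \<tau> ((b, 1) # v))
    = Jop \<tau> (a + b) (cauchy_prod (dW \<tau> u) (dW \<tau> ((b, 1) # v))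
        + cauchy_prod (dW \<tau> ((a, 1) # u)) (dW \<tau> v))"
  unfolding dW_J by (rule cauchy_prod_J_J)

lemma cauchy_prod_dW_Suc_1:
  assumes "a + b \<le> 4" "r > 1"
  shows "cauchy_prod (dW \<tau> ((a, r) # u)) (dW \<tau> ((b, 1) # v))
    = Kop \<tau> (a + b) (cauchy_prod (dW \<tau> ((a, r - 1) # u)) (dW \<tau> ((b, 1) # v)))
      + Jop \<tau> (a + b) (cauchy_prod (dW \<tau> ((a, r) # u)) (dW \<tau> v))"
proof -
  obtain k where r: "r = Suc k" "k > 0" using assms by (cases r) auto
  show ?thesis
    unfolding r diff_Suc_1 dW_K[OF r(2)] dW_J by (rule cauchy_prod_K_J) (use assms in auto)
qed

text \<open>The right-hand side is literally that of \<open>cauchy_prod_dW_Suc_1\<close>, so both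
  orders of the factors reach the same normal form.\<close>

lemma cauchy_prod_dW_1_Suc:
  assumes "a + b \<le> 4" "r > 1"
  shows "cauchy_prod (dW \<tau> ((b, 1) # v)) (dW \<tau> ((a, r) # u))
    = Kop \<tau> (a + b) (cauchy_prod (dW \<tau> ((a, r - 1) # u)) (dW \<tau> ((b, 1) # v)))
      + Jop \<tau> (a + b) (cauchy_prod (dW \<tau> ((a, r) # u)) (dW \<tau> v))"
  using cauchy_prod_dW_Suc_1[OF assms] by (simp add: cauchy_prod_commute)

lemma cauchy_prod_dW_Suc_Suc:
  assumes "a + b \<le> 4" "r > 1" "s > 1"
  shows "cauchy_prod (dW \<tau> ((a, r) # u)) (dW \<tau> ((b, s) # v))
    = Kop \<tau> (a + b) (cauchy_prod (dW \<tau> ((a, r - 1) # u)) (dW \<tau> ((b, s) # v))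
        + cauchy_prod (dW \<tau> ((a, r) # u)) (dW \<tau> ((b, s - 1) # v)))"
proof -
  obtain k l where r: "r = Suc k" "k > 0" "s = Suc l" "l > 0" using assms by (cases r; cases s) auto
  show ?thesis
    unfolding r diff_Suc_1 dW_K[OF r(2)] dW_K[OF r(4)] by (rule cauchy_prod_K_K) (use assms in auto)
qed

lemma Kop_dW: "r > 0 \<Longrightarrow> Kop \<tau> a (dW \<tau> ((a, r) # u)) = dW \<tau> ((a, r + 1) # u)"
  using dW_K by simp

text \<open>Each product rule lowers a power or shortens a word in the remaining products, so that
  rewriting ends in single words.\<close>

lemmas shuffle = cauchy_prod_dW_1_1 cauchy_prod_dW_Suc_1 cauchy_prod_dW_1_Suc cauchy_prod_dW_Suc_Suc cauchy_prod_delta cauchy_prod_add Jop_add Kop_add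
  partial_sum_add partial_sum_dW Kop_dW dW_J[symmetric] Jop_numeral Kop_numeral partial_sum_numeral
  numeral_mult_at One_nat_def[symmetric]

lemma product_defect: "W \<tau> u N * W \<tau> v N - defect \<tau> u v N
    = partial_sum (cauchy_prod (dW \<tau> u) (dW \<tau> v)) N"
  by (simp add: defect_def)

section \<open>Double shuffle relations\<close>

text \<open>
  In the names of the instances, a digit \<open>a\<close> followed by \<open>k\<close> primes is the letter \<open>(a, k + 1)\<close>.
\<close>

lemma stuffle_21_21:
  "W \<tau> [(2, 1), (1, 1)] N * W \<tau> [(2, 1), (1, 1)] N
      = 2 * W \<tau> [(2, 1), (1, 1), (2, 1), (1, 1)] N
      + 4 * W \<tau> [(2, 1), (2, 1), (1, 1), (1, 1)] N - 2 * W \<tau> [(2, 1), (1, 1), (1, 1)] N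
      + 2 * W \<tau> [(2, 1), (2, 1), (1, 1)] N + 2 * W \<tau> [(2, 1), (2, 1), (1, 2)] N
      + 2 * W \<tau> [(2, 2), (1, 1), (1, 1)] N + W \<tau> [(2, 2), (1, 2)] N"
  by (simp add: W_mult_at stuffle scale_distrib scale_def del: times_fun_apply One_nat_def)

lemma stuffle_01_21:
  "W \<tau> [(0, 1), (1, 1)] N * W \<tau> [(2, 1), (1, 1)] N
      = W \<tau> [(0, 1), (1, 1), (2, 1), (1, 1)] N
      + 2 * W \<tau> [(0, 1), (2, 1), (1, 1), (1, 1)] N
      + 2 * W \<tau> [(2, 1), (0, 1), (1, 1), (1, 1)] N
      + W \<tau> [(2, 1), (1, 1), (0, 1), (1, 1)] N - 2 * W \<tau> [(0, 1), (1, 1), (1, 1)] N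
      + W \<tau> [(0, 1), (2, 1), (1, 1)] N + W \<tau> [(0, 1), (2, 1), (1, 2)] N
      - W \<tau> [(2, 1), (0, 1), (1, 1)] N + W \<tau> [(2, 1), (0, 1), (1, 2)] N
      + 2 * W \<tau> [(2, 1), (1, 1), (1, 1)] N - 1 / 2 * W \<tau> [(0, 1), (1, 2)] N
      + 1 / 2 * W \<tau> [(2, 1), (1, 2)] N"
  by (simp add: W_mult_at stuffle scale_distrib scale_def del: times_fun_apply One_nat_def)

lemma stuffle_0_211:
  "W \<tau> [(0, 1)] N * W \<tau> [(2, 1), (1, 1), (1, 1)] N
      = W \<tau> [(0, 1), (2, 1), (1, 1), (1, 1)] N + W \<tau> [(2, 1), (0, 1), (1, 1), (1, 1)] N
      + W \<tau> [(2, 1), (1, 1), (0, 1), (1, 1)] N + W \<tau> [(2, 1), (1, 1), (1, 1), (0, 1)] N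
      - 1 / 2 * W \<tau> [(0, 1), (1, 1), (1, 1)] N - W \<tau> [(2, 1), (0, 1), (1, 1)] N
      - W \<tau> [(2, 1), (1, 1), (0, 1)] N + 5 / 2 * W \<tau> [(2, 1), (1, 1), (1, 1)] N"
  by (simp add: W_mult_at stuffle scale_distrib scale_def del: times_fun_apply One_nat_def)

lemma stuffle_1_101:
  "W \<tau> [(1, 1)] N * W \<tau> [(1, 1), (0, 1), (1, 1)] N
      = 2 * W \<tau> [(1, 1), (0, 1), (1, 1), (1, 1)] N
      + 2 * W \<tau> [(1, 1), (1, 1), (0, 1), (1, 1)] N - W \<tau> [(1, 1), (0, 1), (1, 1)] N
      + W \<tau> [(1, 1), (0, 1), (1, 2)] N + W \<tau> [(1, 1), (1, 1), (1, 1)] N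
      + W \<tau> [(1, 2), (0, 1), (1, 1)] N"
  by (simp add: W_mult_at stuffle scale_distrib scale_def del: times_fun_apply One_nat_def)

lemma stuffle_10_11:
  "W \<tau> [(1, 1), (0, 1)] N * W \<tau> [(1, 1), (1, 1)] N
      = W \<tau> [(1, 1), (0, 1), (1, 1), (1, 1)] N
      + 2 * W \<tau> [(1, 1), (1, 1), (0, 1), (1, 1)] N
      + 3 * W \<tau> [(1, 1), (1, 1), (1, 1), (0, 1)] N - W \<tau> [(1, 1), (0, 1), (1, 1)] N
      - 2 * W \<tau> [(1, 1), (1, 1), (0, 1)] N + 3 * W \<tau> [(1, 1), (1, 1), (1, 1)] N
      + W \<tau> [(1, 1), (1, 2), (0, 1)] N + W \<tau> [(1, 2), (0, 1), (1, 1)] N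
      + W \<tau> [(1, 2), (1, 1), (0, 1)] N - W \<tau> [(1, 2), (0, 1)] N + W \<tau> [(1, 2), (1, 1)] N"
  by (simp add: W_mult_at stuffle scale_distrib scale_def del: times_fun_apply One_nat_def)

lemma stuffle_1_110:
  "W \<tau> [(1, 1)] N * W \<tau> [(1, 1), (1, 1), (0, 1)] N
      = W \<tau> [(1, 1), (1, 1), (0, 1), (1, 1)] N
      + 3 * W \<tau> [(1, 1), (1, 1), (1, 1), (0, 1)] N - W \<tau> [(1, 1), (1, 1), (0, 1)] N
      + W \<tau> [(1, 1), (1, 1), (1, 1)] N + W \<tau> [(1, 1), (1, 2), (0, 1)] N
      + W \<tau> [(1, 2), (1, 1), (0, 1)] N"
  by (simp add: W_mult_at stuffle scale_distrib scale_def del: times_fun_apply One_nat_def)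

lemma stuffle_1_2'1:
  "W \<tau> [(1, 1)] N * W \<tau> [(2, 2), (1, 1)] N
      = W \<tau> [(1, 1), (2, 2), (1, 1)] N + 2 * W \<tau> [(2, 2), (1, 1), (1, 1)] N
      + W \<tau> [(1, 1), (1, 1)] N - W \<tau> [(2, 1), (1, 1)] N + W \<tau> [(2, 2), (1, 1)] N
      + W \<tau> [(2, 2), (1, 2)] N"
  by (simp add: W_mult_at stuffle scale_distrib scale_def del: times_fun_apply One_nat_def)

lemma stuffle_0_21':
  "W \<tau> [(0, 1)] N * W \<tau> [(2, 1), (1, 2)] N
      = W \<tau> [(0, 1), (2, 1), (1, 2)] N + W \<tau> [(2, 1), (0, 1), (1, 2)] N
      + W \<tau> [(2, 1), (1, 2), (0, 1)] N - 1 / 2 * W \<tau> [(0, 1), (1, 2)] N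
      + W \<tau> [(2, 1), (0, 1)] N - W \<tau> [(2, 1), (1, 1)] N + 3 / 2 * W \<tau> [(2, 1), (1, 2)] N"
  by (simp add: W_mult_at stuffle scale_distrib scale_def del: times_fun_apply One_nat_def)

lemma stuffle_1'_01:
  "W \<tau> [(1, 2)] N * W \<tau> [(0, 1), (1, 1)] N
      = W \<tau> [(0, 1), (1, 1), (1, 2)] N + W \<tau> [(0, 1), (1, 2), (1, 1)] N
      + W \<tau> [(1, 2), (0, 1), (1, 1)] N + W \<tau> [(0, 1), (1, 1)] N
      + W \<tau> [(0, 1), (1, 3)] N - W \<tau> [(1, 1), (1, 1)] N + W \<tau> [(1, 2), (1, 1)] N"
  by (simp add: W_mult_at stuffle scale_distrib scale_def del: times_fun_apply One_nat_def)

lemma stuffle_1_1'2: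
  "W \<tau> [(1, 1)] N * W \<tau> [(1, 2), (2, 1)] N
      = W \<tau> [(1, 1), (1, 2), (2, 1)] N + W \<tau> [(1, 2), (1, 1), (2, 1)] N
      + W \<tau> [(1, 2), (2, 1), (1, 1)] N - W \<tau> [(1, 2), (1, 1)] N
      + W \<tau> [(1, 2), (2, 1)] N + W \<tau> [(1, 3), (2, 1)] N"
  by (simp add: W_mult_at stuffle scale_distrib scale_def del: times_fun_apply One_nat_def)

lemma stuffle_1'_12:
  "W \<tau> [(1, 2)] N * W \<tau> [(1, 1), (2, 1)] N
      = W \<tau> [(1, 1), (1, 2), (2, 1)] N + W \<tau> [(1, 1), (2, 1), (1, 2)] N
      + W \<tau> [(1, 2), (1, 1), (2, 1)] N - W \<tau> [(1, 1), (1, 1)] N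
      - W \<tau> [(1, 1), (1, 2)] N + W \<tau> [(1, 1), (2, 1)] N + W \<tau> [(1, 3), (2, 1)] N"
  by (simp add: W_mult_at stuffle scale_distrib scale_def del: times_fun_apply One_nat_def)

lemma stuffle_1_01':
  "W \<tau> [(1, 1)] N * W \<tau> [(0, 1), (1, 2)] N
      = W \<tau> [(0, 1), (1, 1), (1, 2)] N + W \<tau> [(0, 1), (1, 2), (1, 1)] N
      + W \<tau> [(1, 1), (0, 1), (1, 2)] N - W \<tau> [(0, 1), (1, 2)] N
      + W \<tau> [(0, 1), (1, 3)] N + W \<tau> [(1, 1), (1, 2)] N"
  by (simp add: W_mult_at stuffle scale_distrib scale_def del: times_fun_apply One_nat_def)

lemma stuffle_1_11':
  "W \<tau> [(1, 1)] N * W \<tau> [(1, 1), (1, 2)] N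
      = 2 * W \<tau> [(1, 1), (1, 1), (1, 2)] N + W \<tau> [(1, 1), (1, 2), (1, 1)] N
      + W \<tau> [(1, 1), (1, 3)] N + W \<tau> [(1, 2), (1, 2)] N"
  by (simp add: W_mult_at stuffle scale_distrib scale_def del: times_fun_apply One_nat_def)

lemma stuffle_0_11':
  "W \<tau> [(0, 1)] N * W \<tau> [(1, 1), (1, 2)] N
      = W \<tau> [(0, 1), (1, 1), (1, 2)] N + W \<tau> [(1, 1), (0, 1), (1, 2)] N
      + W \<tau> [(1, 1), (1, 2), (0, 1)] N - W \<tau> [(0, 1), (1, 2)] N
      + W \<tau> [(1, 1), (0, 1)] N - W \<tau> [(1, 1), (1, 1)] N + 2 * W \<tau> [(1, 1), (1, 2)] N"
  by (simp add: W_mult_at stuffle scale_distrib scale_def del: times_fun_apply One_nat_def)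

lemma stuffle_1_1'1:
  "W \<tau> [(1, 1)] N * W \<tau> [(1, 2), (1, 1)] N
      = W \<tau> [(1, 1), (1, 2), (1, 1)] N + 2 * W \<tau> [(1, 2), (1, 1), (1, 1)] N
      + W \<tau> [(1, 2), (1, 2)] N + W \<tau> [(1, 3), (1, 1)] N"
  by (simp add: W_mult_at stuffle scale_distrib scale_def del: times_fun_apply One_nat_def)

lemma stuffle_0_1'1:
  "W \<tau> [(0, 1)] N * W \<tau> [(1, 2), (1, 1)] N
      = W \<tau> [(0, 1), (1, 2), (1, 1)] N + W \<tau> [(1, 2), (0, 1), (1, 1)] N
      + W \<tau> [(1, 2), (1, 1), (0, 1)] N + W \<tau> [(0, 1), (1, 1)] N
      - W \<tau> [(1, 1), (1, 1)] N - W \<tau> [(1, 2), (0, 1)] N + 2 * W \<tau> [(1, 2), (1, 1)] N"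
  by (simp add: W_mult_at stuffle scale_distrib scale_def del: times_fun_apply One_nat_def)

lemma stuffle_1_21:
  "W \<tau> [(1, 1)] N * W \<tau> [(2, 1), (1, 1)] N
      = W \<tau> [(1, 1), (2, 1), (1, 1)] N + 2 * W \<tau> [(2, 1), (1, 1), (1, 1)] N
      - W \<tau> [(1, 1), (1, 1)] N + W \<tau> [(2, 1), (1, 1)] N + W \<tau> [(2, 1), (1, 2)] N"
  by (simp add: W_mult_at stuffle scale_distrib scale_def del: times_fun_apply One_nat_def)

lemma stuffle_0_21:
  "W \<tau> [(0, 1)] N * W \<tau> [(2, 1), (1, 1)] N
      = W \<tau> [(0, 1), (2, 1), (1, 1)] N + W \<tau> [(2, 1), (0, 1), (1, 1)] N
      + W \<tau> [(2, 1), (1, 1), (0, 1)] N - 1 / 2 * W \<tau> [(0, 1), (1, 1)] N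
      - W \<tau> [(2, 1), (0, 1)] N + 3 / 2 * W \<tau> [(2, 1), (1, 1)] N"
  by (simp add: W_mult_at stuffle scale_distrib scale_def del: times_fun_apply One_nat_def)

lemma stuffle_1_11:
  "W \<tau> [(1, 1)] N * W \<tau> [(1, 1), (1, 1)] N
      = 3 * W \<tau> [(1, 1), (1, 1), (1, 1)] N + W \<tau> [(1, 1), (1, 2)] N + W \<tau> [(1, 2), (1, 1)] N"
  by (simp add: W_mult_at stuffle scale_distrib scale_def del: times_fun_apply One_nat_def)

lemma stuffle_0_11:
  "W \<tau> [(0, 1)] N * W \<tau> [(1, 1), (1, 1)] N
      = W \<tau> [(0, 1), (1, 1), (1, 1)] N + W \<tau> [(1, 1), (0, 1), (1, 1)] N
      + W \<tau> [(1, 1), (1, 1), (0, 1)] N - W \<tau> [(0, 1), (1, 1)] N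
      - W \<tau> [(1, 1), (0, 1)] N + 2 * W \<tau> [(1, 1), (1, 1)] N"
  by (simp add: W_mult_at stuffle scale_distrib scale_def del: times_fun_apply One_nat_def)

lemma stuffle_1_01:
  "W \<tau> [(1, 1)] N * W \<tau> [(0, 1), (1, 1)] N
      = 2 * W \<tau> [(0, 1), (1, 1), (1, 1)] N + W \<tau> [(1, 1), (0, 1), (1, 1)] N
      - W \<tau> [(0, 1), (1, 1)] N + W \<tau> [(0, 1), (1, 2)] N + W \<tau> [(1, 1), (1, 1)] N"
  by (simp add: W_mult_at stuffle scale_distrib scale_def del: times_fun_apply One_nat_def)

lemma stuffle_0_1:
  "W \<tau> [(0, 1)] N * W \<tau> [(1, 1)] N
      = W \<tau> [(0, 1), (1, 1)] N + W \<tau> [(1, 1), (0, 1)] N - W \<tau> [(0, 1)] N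
      + W \<tau> [(1, 1)] N"
  by (simp add: W_mult_at stuffle scale_distrib scale_def del: times_fun_apply One_nat_def)

lemma stuffle_1_1:
  "W \<tau> [(1, 1)] N * W \<tau> [(1, 1)] N = 2 * W \<tau> [(1, 1), (1, 1)] N + W \<tau> [(1, 2)] N"
  by (simp add: W_mult_at stuffle scale_distrib scale_def del: times_fun_apply One_nat_def)

lemma stuffle_2_11:
  "W \<tau> [(2, 1)] N * W \<tau> [(1, 1), (1, 1)] N
      = W \<tau> [(1, 1), (1, 1), (2, 1)] N + W \<tau> [(1, 1), (2, 1), (1, 1)] N
      + W \<tau> [(2, 1), (1, 1), (1, 1)] N - 2 * W \<tau> [(1, 1), (1, 1)] N
      + W \<tau> [(1, 1), (2, 1)] N + W \<tau> [(2, 1), (1, 1)] N"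
  by (simp add: W_mult_at stuffle scale_distrib scale_def del: times_fun_apply One_nat_def)

lemma stuffle_1_12:
  "W \<tau> [(1, 1)] N * W \<tau> [(1, 1), (2, 1)] N
      = 2 * W \<tau> [(1, 1), (1, 1), (2, 1)] N + W \<tau> [(1, 1), (2, 1), (1, 1)] N
      - W \<tau> [(1, 1), (1, 1)] N + W \<tau> [(1, 1), (2, 1)] N + W \<tau> [(1, 2), (2, 1)] N"
  by (simp add: W_mult_at stuffle scale_distrib scale_def del: times_fun_apply One_nat_def)

lemma stuffle_1_2:
  "W \<tau> [(1, 1)] N * W \<tau> [(2, 1)] N
      = W \<tau> [(1, 1), (2, 1)] N + W \<tau> [(2, 1), (1, 1)] N - W \<tau> [(1, 1)] N
      + W \<tau> [(2, 1)] N"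
  by (simp add: W_mult_at stuffle scale_distrib scale_def del: times_fun_apply One_nat_def)

lemma stuffle_0_1':
  "W \<tau> [(0, 1)] N * W \<tau> [(1, 2)] N
      = W \<tau> [(0, 1), (1, 2)] N + W \<tau> [(1, 2), (0, 1)] N + W \<tau> [(0, 1)] N
      - W \<tau> [(1, 1)] N + W \<tau> [(1, 2)] N"
  by (simp add: W_mult_at stuffle scale_distrib scale_def del: times_fun_apply One_nat_def)

lemma stuffle_0_1'':
  "W \<tau> [(0, 1)] N * W \<tau> [(1, 3)] N
      = W \<tau> [(0, 1), (1, 3)] N + W \<tau> [(1, 3), (0, 1)] N - W \<tau> [(0, 1)] N
      + W \<tau> [(1, 1)] N - W \<tau> [(1, 2)] N + W \<tau> [(1, 3)] N"
  by (simp add: W_mult_at stuffle scale_distrib scale_def del: times_fun_apply One_nat_def)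

lemma stuffle_1'_1':
  "W \<tau> [(1, 2)] N * W \<tau> [(1, 2)] N = 2 * W \<tau> [(1, 2), (1, 2)] N + W \<tau> [(1, 4)] N"
  by (simp add: W_mult_at stuffle scale_distrib scale_def del: times_fun_apply One_nat_def)

lemma stuffle_1_1':
  "W \<tau> [(1, 1)] N * W \<tau> [(1, 2)] N
      = W \<tau> [(1, 1), (1, 2)] N + W \<tau> [(1, 2), (1, 1)] N + W \<tau> [(1, 3)] N"
  by (simp add: W_mult_at stuffle scale_distrib scale_def del: times_fun_apply One_nat_def)

text \<open>At every stage the current leading letters of the two words add up. Hence each of the 6
  interleavings of 2, 1 with itself yields the word 4, 3, 2, 1.\<close>

lemma shuffle_21_21:
  "W \<tau> [(2, 1), (1, 1)] N * W \<tau> [(2, 1), (1, 1)] N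
      - defect \<tau> [(2, 1), (1, 1)] [(2, 1), (1, 1)] N = 6 * W \<tau> [(4, 1), (3, 1), (2, 1), (1, 1)] N"
  by (simp add: product_defect shuffle del: One_nat_def dW.simps times_fun_apply)

text \<open>Supplies the word 2, 3, 2, 1 of the target combination; the stuffle expansion of the
  same product supplies 0, 1, 2, 1.\<close>

lemma shuffle_01_21:
  "W \<tau> [(0, 1), (1, 1)] N * W \<tau> [(2, 1), (1, 1)] N
      - defect \<tau> [(0, 1), (1, 1)] [(2, 1), (1, 1)] N
      = W \<tau> [(2, 1), (1, 1), (0, 1), (1, 1)] N
      + 2 * W \<tau> [(2, 1), (1, 1), (2, 1), (1, 1)] N + 3 * W \<tau> [(2, 1), (3, 1), (2, 1), (1, 1)] N"
  by (simp add: product_defect shuffle del: One_nat_def dW.simps times_fun_apply)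

lemma shuffle_0_211:
  "W \<tau> [(0, 1)] N * W \<tau> [(2, 1), (1, 1), (1, 1)] N
      - defect \<tau> [(0, 1)] [(2, 1), (1, 1), (1, 1)] N
      = W \<tau> [(2, 1), (1, 1), (1, 1), (0, 1)] N
      + 2 * W \<tau> [(2, 1), (1, 1), (1, 1), (1, 1)] N + W \<tau> [(2, 1), (2, 1), (1, 1), (1, 1)] N"
  by (simp add: product_defect shuffle del: One_nat_def dW.simps times_fun_apply)

lemma shuffle_1_101:
  "W \<tau> [(1, 1)] N * W \<tau> [(1, 1), (0, 1), (1, 1)] N
      - defect \<tau> [(1, 1)] [(1, 1), (0, 1), (1, 1)] N
      = 2 * W \<tau> [(2, 1), (1, 1), (0, 1), (1, 1)] N + 2 * W \<tau> [(2, 1), (1, 1), (2, 1), (1, 1)] N"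
  by (simp add: product_defect shuffle del: One_nat_def dW.simps times_fun_apply)

lemma shuffle_10_11:
  "W \<tau> [(1, 1), (0, 1)] N * W \<tau> [(1, 1), (1, 1)] N
      - defect \<tau> [(1, 1), (0, 1)] [(1, 1), (1, 1)] N
      = W \<tau> [(2, 1), (1, 1), (1, 1), (0, 1)] N
      + 2 * W \<tau> [(2, 1), (1, 1), (1, 1), (1, 1)] N
      + 2 * W \<tau> [(2, 1), (2, 1), (1, 1), (0, 1)] N + W \<tau> [(2, 1), (2, 1), (1, 1), (1, 1)] N"
  by (simp add: product_defect shuffle del: One_nat_def dW.simps times_fun_apply)

lemma shuffle_1_110:
  "W \<tau> [(1, 1)] N * W \<tau> [(1, 1), (1, 1), (0, 1)] N
      - defect \<tau> [(1, 1)] [(1, 1), (1, 1), (0, 1)] N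
      = W \<tau> [(2, 1), (1, 1), (1, 1), (0, 1)] N
      + 2 * W \<tau> [(2, 1), (2, 1), (1, 1), (0, 1)] N + W \<tau> [(2, 1), (2, 1), (1, 1), (1, 1)] N"
  by (simp add: product_defect shuffle del: One_nat_def dW.simps times_fun_apply)

lemma shuffle_0_21':
  "W \<tau> [(0, 1)] N * W \<tau> [(2, 1), (1, 2)] N - defect \<tau> [(0, 1)] [(2, 1), (1, 2)] N
      = W \<tau> [(2, 1), (1, 1), (1, 2)] N + W \<tau> [(2, 1), (1, 2), (0, 1)] N
      + W \<tau> [(2, 1), (1, 2), (1, 1)] N + W \<tau> [(2, 1), (2, 1), (1, 2)] N"
  by (simp add: product_defect shuffle del: One_nat_def dW.simps times_fun_apply)

lemma shuffle_1_1'0: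
  "W \<tau> [(1, 1)] N * W \<tau> [(1, 2), (0, 1)] N - defect \<tau> [(1, 1)] [(1, 2), (0, 1)] N
      = W \<tau> [(2, 1), (1, 2), (0, 1)] N + 2 * W \<tau> [(2, 2), (1, 1), (0, 1)] N
      + W \<tau> [(2, 2), (1, 1), (1, 1)] N"
  by (simp add: product_defect shuffle del: One_nat_def dW.simps times_fun_apply)

lemma shuffle_1'_10:
  "W \<tau> [(1, 2)] N * W \<tau> [(1, 1), (0, 1)] N - defect \<tau> [(1, 2)] [(1, 1), (0, 1)] N
      = W \<tau> [(2, 1), (1, 1), (1, 2)] N + W \<tau> [(2, 1), (1, 2), (0, 1)] N
      + W \<tau> [(2, 1), (1, 2), (1, 1)] N + 2 * W \<tau> [(2, 2), (1, 1), (0, 1)] N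
      + W \<tau> [(2, 2), (1, 1), (1, 1)] N"
  by (simp add: product_defect shuffle del: One_nat_def dW.simps times_fun_apply)

lemma shuffle_1_01':
  "W \<tau> [(1, 1)] N * W \<tau> [(0, 1), (1, 2)] N - defect \<tau> [(1, 1)] [(0, 1), (1, 2)] N
      = W \<tau> [(1, 1), (0, 1), (1, 2)] N + W \<tau> [(1, 1), (2, 1), (1, 2)] N
      + 2 * W \<tau> [(1, 1), (2, 2), (1, 1)] N"
  by (simp add: product_defect shuffle del: One_nat_def dW.simps times_fun_apply)

lemma shuffle_1'_01:
  "W \<tau> [(1, 2)] N * W \<tau> [(0, 1), (1, 1)] N - defect \<tau> [(1, 2)] [(0, 1), (1, 1)] N
      = W \<tau> [(1, 1), (2, 1), (1, 2)] N + 2 * W \<tau> [(1, 1), (2, 2), (1, 1)] N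
      + W \<tau> [(1, 2), (0, 1), (1, 1)] N + 2 * W \<tau> [(1, 2), (2, 1), (1, 1)] N"
  by (simp add: product_defect shuffle del: One_nat_def dW.simps times_fun_apply)

lemma shuffle_0_11':
  "W \<tau> [(0, 1)] N * W \<tau> [(1, 1), (1, 2)] N - defect \<tau> [(0, 1)] [(1, 1), (1, 2)] N
      = 2 * W \<tau> [(1, 1), (1, 1), (1, 2)] N + W \<tau> [(1, 1), (1, 2), (0, 1)] N
      + W \<tau> [(1, 1), (1, 2), (1, 1)] N"
  by (simp add: product_defect shuffle del: One_nat_def dW.simps times_fun_apply)

lemma shuffle_0_1'1:
  "W \<tau> [(0, 1)] N * W \<tau> [(1, 2), (1, 1)] N - defect \<tau> [(0, 1)] [(1, 2), (1, 1)] N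
      = W \<tau> [(1, 1), (1, 2), (1, 1)] N + W \<tau> [(1, 2), (1, 1), (0, 1)] N
      + 2 * W \<tau> [(1, 2), (1, 1), (1, 1)] N"
  by (simp add: product_defect shuffle del: One_nat_def dW.simps times_fun_apply)

lemma shuffle_1_11:
  "W \<tau> [(1, 1)] N * W \<tau> [(1, 1), (1, 1)] N - defect \<tau> [(1, 1)] [(1, 1), (1, 1)] N
      = W \<tau> [(2, 1), (1, 1), (1, 1)] N + 2 * W \<tau> [(2, 1), (2, 1), (1, 1)] N"
  by (simp add: product_defect shuffle del: One_nat_def dW.simps times_fun_apply)

lemma shuffle_1_10:
  "W \<tau> [(1, 1)] N * W \<tau> [(1, 1), (0, 1)] N - defect \<tau> [(1, 1)] [(1, 1), (0, 1)] N
      = 2 * W \<tau> [(2, 1), (1, 1), (0, 1)] N + W \<tau> [(2, 1), (1, 1), (1, 1)] N"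
  by (simp add: product_defect shuffle del: One_nat_def dW.simps times_fun_apply)

lemma shuffle_1_01:
  "W \<tau> [(1, 1)] N * W \<tau> [(0, 1), (1, 1)] N - defect \<tau> [(1, 1)] [(0, 1), (1, 1)] N
      = W \<tau> [(1, 1), (0, 1), (1, 1)] N + 2 * W \<tau> [(1, 1), (2, 1), (1, 1)] N"
  by (simp add: product_defect shuffle del: One_nat_def dW.simps times_fun_apply)

lemma shuffle_1_1:
  "W \<tau> [(1, 1)] N * W \<tau> [(1, 1)] N - defect \<tau> [(1, 1)] [(1, 1)] N
      = 2 * W \<tau> [(2, 1), (1, 1)] N"
  by (simp add: product_defect shuffle del: One_nat_def dW.simps times_fun_apply)

lemma shuffle_0_1:
  "W \<tau> [(0, 1)] N * W \<tau> [(1, 1)] N - defect \<tau> [(0, 1)] [(1, 1)] N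
      = W \<tau> [(1, 1), (0, 1)] N + W \<tau> [(1, 1), (1, 1)] N"
  by (simp add: product_defect shuffle del: One_nat_def dW.simps times_fun_apply)

lemma shuffle_1_1':
  "W \<tau> [(1, 1)] N * W \<tau> [(1, 2)] N - defect \<tau> [(1, 1)] [(1, 2)] N
      = W \<tau> [(2, 1), (1, 2)] N + 2 * W \<tau> [(2, 2), (1, 1)] N"
  by (simp add: product_defect shuffle del: One_nat_def dW.simps times_fun_apply)

lemma shuffle_0_1':
  "W \<tau> [(0, 1)] N * W \<tau> [(1, 2)] N - defect \<tau> [(0, 1)] [(1, 2)] N
      = W \<tau> [(1, 1), (1, 2)] N + W \<tau> [(1, 2), (0, 1)] N + W \<tau> [(1, 2), (1, 1)] N"
  by (simp add: product_defect shuffle del: One_nat_def dW.simps times_fun_apply)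

lemma shuffle_0_1'':
  "W \<tau> [(0, 1)] N * W \<tau> [(1, 3)] N - defect \<tau> [(0, 1)] [(1, 3)] N
      = W \<tau> [(1, 1), (1, 3)] N + W \<tau> [(1, 2), (1, 2)] N + W \<tau> [(1, 3), (0, 1)] N
      + W \<tau> [(1, 3), (1, 1)] N"
  by (simp add: product_defect shuffle del: One_nat_def dW.simps times_fun_apply)

end

lemma lincomb: "a = b \<Longrightarrow> c = d \<Longrightarrow> a + k * c = b + k * (d :: real)" by simp

context large_parameter
begin
text \<open>
  The multipliers were found by linear algebra over the rationals. The first six pairs of
  relations produce all words of length \<open>4\<close>; the others evaluate the contraction terms.
\<close>

lemma key_identity:
  "12 * (W \<tau> [(4, 1), (3, 1), (2, 1), (1, 1)] N - W \<tau> [(2, 1), (3, 1), (2, 1), (1, 1)] N)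
   - 4 * (W \<tau> [(2, 1), (1, 1), (2, 1), (1, 1)] N - W \<tau> [(0, 1), (1, 1), (2, 1), (1, 1)] N)
 = W \<tau> [(1, 4)] N / 2 + 2 * W \<tau> [(1, 3)] N + W \<tau> [(1, 2)] N
     - 2 * (W \<tau> [(1, 1)] N - W \<tau> [(0, 1)] N)
   - 2 * W \<tau> [(0, 2)] N * W \<tau> [(1, 2)] N
       - 4 * W \<tau> [(0, 2)] N * (W \<tau> [(1, 1)] N - W \<tau> [(0, 1)] N)
   - (2 * W \<tau> [(0, 1)] N * W \<tau> [(0, 2)] N - W \<tau> [(0, 2)] N
       - 2 * defect \<tau> [(0, 1)] [(0, 1), (0, 1)] N)
   - 2 * defect \<tau> [(2, 1), (1, 1)] [(2, 1), (1, 1)] N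
   + 4 * defect \<tau> [(0, 1), (1, 1)] [(2, 1), (1, 1)] N
   - 8 * defect \<tau> [(0, 1)] [(2, 1), (1, 1), (1, 1)] N
   - 4 * defect \<tau> [(1, 1)] [(1, 1), (0, 1), (1, 1)] N
   + 8 * defect \<tau> [(1, 1), (0, 1)] [(1, 1), (1, 1)] N
   - 8 * defect \<tau> [(1, 1)] [(1, 1), (1, 1), (0, 1)] N
   - 4 * (defect \<tau> [(0, 1)] [(2, 1), (1, 2)] N - (W \<tau> [(0, 2)] N * W \<tau> [(1, 2)] N))
   - 4 * defect \<tau> [(1, 1)] [(1, 2), (0, 1)] N
   + 4 * defect \<tau> [(1, 2)] [(1, 1), (0, 1)] N
   + 3 / 2 * (defect \<tau> [(1, 1)] [(0, 1), (1, 2)] N - (W \<tau> [(0, 2)] N * W \<tau> [(1, 2)] N))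
   - 1 / 2 * defect \<tau> [(1, 2)] [(0, 1), (1, 1)] N
   + (defect \<tau> [(0, 1)] [(1, 1), (1, 2)] N - (W \<tau> [(0, 2)] N * W \<tau> [(1, 2)] N))
   + defect \<tau> [(0, 1)] [(1, 2), (1, 1)] N
   - 2 * (defect \<tau> [(1, 1)] [(1, 1), (1, 1)] N
       - (- W \<tau> [(0, 1)] N * W \<tau> [(0, 2)] N + W \<tau> [(0, 2)] N * W \<tau> [(1, 1)] N
       + defect \<tau> [(0, 1)] [(0, 1), (0, 1)] N))
   + 2 * (defect \<tau> [(1, 1)] [(1, 1), (0, 1)] N - (defect \<tau> [(0, 1)] [(0, 1), (0, 1)] N))
   + 2 * (defect \<tau> [(1, 1)] [(0, 1), (1, 1)] N
       - (- W \<tau> [(0, 1)] N * W \<tau> [(0, 2)] N + W \<tau> [(0, 2)] N * W \<tau> [(1, 1)] N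
       + defect \<tau> [(0, 1)] [(0, 1), (0, 1)] N))
   + (1 / 2 * W \<tau> [(1, 2)] N - 2 * W \<tau> [(1, 1)] N + 2 * W \<tau> [(0, 1)] N - 1 / 2) *
       (defect \<tau> [(1, 1)] [(1, 1)] N - (W \<tau> [(0, 2)] N))
   + (- W \<tau> [(1, 2)] N - 2 * W \<tau> [(1, 1)] N + 3 / 2) *
       (defect \<tau> [(0, 1)] [(1, 1)] N - (W \<tau> [(0, 2)] N))
   + (- W \<tau> [(1, 1)] N + 1) * defect \<tau> [(1, 1)] [(1, 2)] N
   + (- W \<tau> [(1, 1)] N - 3 / 2) * defect \<tau> [(0, 1)] [(1, 2)] N
   + defect \<tau> [(0, 1)] [(1, 3)] N"
proof -
  have E: "0 = (0 :: real)" by simp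
  \<comment> \<open>In the six pairs the multipliers are opposite, so the product of the two sums
    cancels and words and defects remain.\<close>
  note E = lincomb[OF E shuffle_21_21[of N], of "-2"]
  note E = lincomb[OF E stuffle_21_21[of N], of "2"]
  note E = lincomb[OF E shuffle_01_21[of N], of "4"]
  note E = lincomb[OF E stuffle_01_21[of N], of "-4"]
  note E = lincomb[OF E shuffle_0_211[of N], of "-8"]
  note E = lincomb[OF E stuffle_0_211[of N], of "8"]
  note E = lincomb[OF E shuffle_1_101[of N], of "-4"]
  note E = lincomb[OF E stuffle_1_101[of N], of "4"]
  note E = lincomb[OF E shuffle_10_11[of N], of "8"]
  note E = lincomb[OF E stuffle_10_11[of N], of "-8"]
  note E = lincomb[OF E shuffle_1_110[of N], of "-8"]
  note E = lincomb[OF E stuffle_1_110[of N], of "8"]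
  note E = lincomb[OF E stuffle_1_2'1[of N], of "-2"]
  note E = lincomb[OF E shuffle_0_21'[of N], of "-4"]
  note E = lincomb[OF E shuffle_1_1'0[of N], of "-4"]
  note E = lincomb[OF E shuffle_1'_10[of N], of "4"]
  note E = lincomb[OF E stuffle_0_21'[of N], of "4"]
  note E = lincomb[OF E stuffle_1'_01[of N], of "11 / 2"]
  note E = lincomb[OF E shuffle_1_01'[of N], of "3 / 2"]
  note E = lincomb[OF E shuffle_1'_01[of N], of "-1 / 2"]
  note E = lincomb[OF E stuffle_1_1'2[of N], of "1"]
  note E = lincomb[OF E stuffle_1'_12[of N], of "-1"]
  note E = lincomb[OF E stuffle_1_01'[of N], of "-9 / 2"]
  note E = lincomb[OF E shuffle_0_11'[of N], of "1"]
  note E = lincomb[OF E stuffle_1_11'[of N], of "-1"]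
  note E = lincomb[OF E stuffle_0_11'[of N], of "-1"]
  note E = lincomb[OF E shuffle_0_1'1[of N], of "1"]
  note E = lincomb[OF E stuffle_1_1'1[of N], of "-1"]
  note E = lincomb[OF E stuffle_0_1'1[of N], of "-1"]
  note E = lincomb[OF E shuffle_1_11[of N], of "-2"]
  note E = lincomb[OF E stuffle_1_21[of N], of "-5"]
  note E = lincomb[OF E stuffle_0_21[of N], of "4"]
  note E = lincomb[OF E shuffle_1_10[of N], of "2"]
  note E = lincomb[OF E shuffle_1_01[of N], of "2"]
  note E = lincomb[OF E stuffle_1_11[of N], of "4"]
  note E = lincomb[OF E stuffle_0_11[of N], of "-8"]
  note E = lincomb[OF E stuffle_1_01[of N], of "2"]
  \<comment> \<open>Multipliers may now be sums as well: they match products of two words left over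
    so far, such as \<open>W \<tau> [(1, 2)]\<close> times \<open>W \<tau> [(0, 1), (1, 1)]\<close>.
    The products of three that arise cancel among these lines.\<close>
  note E = lincomb[OF E shuffle_1_1[of N], of "1 / 2 * W \<tau> [(1, 2)] N"]
  note E = lincomb[OF E stuffle_0_1[of N], of "5 * W \<tau> [(1, 2)] N"]
  note E = lincomb[OF E shuffle_0_1[of N], of "-1 * W \<tau> [(1, 2)] N"]
  note E = lincomb[OF E stuffle_1_1[of N], of "1 / 2 * W \<tau> [(1, 2)] N"]
  note E = lincomb[OF E shuffle_1_1'[of N], of "-1 * W \<tau> [(1, 1)] N"]
  \<comment> \<open>Six relations expressing associativity of the stuffle product of the letters 2,
    1, 1: products of three cancel on the left, multiples of words of length 3 on the right.\<close>
  note E = lincomb[OF E stuffle_2_11[of N], of "-2 * W \<tau> [(1, 1)] N"]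
  note E = lincomb[OF E stuffle_1_21[of N], of "1 * W \<tau> [(1, 1)] N"]
  note E = lincomb[OF E stuffle_1_12[of N], of "1 * W \<tau> [(1, 1)] N"]
  note E = lincomb[OF E stuffle_1_2[of N], of "2 * W \<tau> [(1, 1), (1, 1)] N"]
  note E = lincomb[OF E stuffle_1_1[of N], of "-1 * W \<tau> [(2, 1), (1, 1)] N"]
  note E = lincomb[OF E stuffle_1_1[of N], of "-1 * W \<tau> [(1, 1), (2, 1)] N"]
  note E = lincomb[OF E stuffle_0_1'[of N], of "-3 * W \<tau> [(1, 1)] N"]
  note E = lincomb[OF E shuffle_0_1'[of N], of "-1 * W \<tau> [(1, 1)] N"]
  note E = lincomb[OF E shuffle_1_1[of N], of "-2 * W \<tau> [(1, 1)] N"]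
  note E = lincomb[OF E stuffle_1_1[of N], of "2 * W \<tau> [(1, 1)] N"]
  note E = lincomb[OF E stuffle_0_1[of N], of "4 * W \<tau> [(1, 1)] N"]
  note E = lincomb[OF E shuffle_0_1[of N], of "-2 * W \<tau> [(1, 1)] N"]
  note E = lincomb[OF E shuffle_1_1[of N], of "2 * W \<tau> [(0, 1)] N"]
  note E = lincomb[OF E stuffle_1_1[of N], of "-4 * W \<tau> [(0, 1)] N"]
  note E = lincomb[OF E shuffle_0_1''[of N], of "1"]
  note E = lincomb[OF E stuffle_0_1''[of N], of "-1"]
  note E = lincomb[OF E stuffle_1'_1'[of N], of "1 / 2"]
  note E = lincomb[OF E shuffle_1_1'[of N], of "1"]
  note E = lincomb[OF E stuffle_2_11[of N], of "2"]
  note E = lincomb[OF E stuffle_1_12[of N], of "-1"]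
  note E = lincomb[OF E stuffle_1_1'[of N], of "3"]
  note E = lincomb[OF E stuffle_0_1'[of N], of "-15 / 2"]
  note E = lincomb[OF E shuffle_0_1'[of N], of "-3 / 2"]
  note E = lincomb[OF E shuffle_1_1[of N], of "-1 / 2"]
  note E = lincomb[OF E stuffle_1_1[of N], of "15 / 2"]
  note E = lincomb[OF E stuffle_0_1[of N], of "-17 / 2"]
  note E = lincomb[OF E shuffle_0_1[of N], of "3 / 2"]
  show ?thesis using E by (simp add: field_simps)
qed
end

section \<open>Sequences bounded up to powers of the logarithm\<close>

text \<open>Harmonic numbers replace logarithms: \<open>1 + harm n\<close> is monotone and at least
  1 already from n = 0 on, so bounds with different exponents combine easily.\<close>

definition log_bounded :: "(nat \<Rightarrow> real) \<Rightarrow> bool" where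
  "log_bounded X \<longleftrightarrow>
      (\<exists>C k. \<forall>n. \<bar>X n\<bar> \<le> C * (1 + harm n) ^ k)"

text \<open>The value at 0 is left free, since the bound there would be a division by zero and hence
  0.\<close>

definition log_small :: "(nat \<Rightarrow> real) \<Rightarrow> bool" where
  "log_small X \<longleftrightarrow>
      (\<exists>C k. \<forall>n>0. \<bar>X n\<bar> \<le> C * (1 + harm n) ^ k / real n)"

lemma one_plus_harm_ge_1: "1 + harm n \<ge> (1 :: real)"
  using harm_nonneg[of n, where 'a = real] by simp

lemma harm_pow_le: "k \<le> l \<Longrightarrow> (1 + harm n :: real) ^ k \<le> (1 + harm n) ^ l"
  using one_plus_harm_ge_1 by (intro power_increasing) auto

lemma log_boundedE:
  assumes "log_bounded X"
  obtains C k where "C \<ge> 0" "\<And>n. \<bar>X n\<bar> \<le> C * (1 + harm n) ^ k"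
proof -
  obtain C k where *: "\<And>n. \<bar>X n\<bar> \<le> C * (1 + harm n) ^ k"
    using assms by (auto simp: log_bounded_def)
  have "C \<ge> 0" using *[of 0] by (simp add: harm_def)
  then show ?thesis using * that by blast
qed

lemma log_smallE:
  assumes "log_small X"
  obtains C k where "C \<ge> 0" "\<And>n. n > 0
      \<Longrightarrow> \<bar>X n\<bar> \<le> C * (1 + harm n) ^ k / real n"
proof -
  obtain C k where *: "\<And>n. n > 0 \<Longrightarrow> \<bar>X n\<bar> \<le> C * (1 + harm n) ^ k / real n"
    using assms by (auto simp: log_small_def)
  have "0 \<le> C * 2 ^ k" using *[of 1] by (simp add: harm_def)
  then have "C \<ge> 0" by (rule contrapos_pp) (simp add: not_le mult_neg_pos)
  then show ?thesis using * that by blast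
qed

lemma log_bounded_const: "log_bounded (\<lambda>n. c)"
  unfolding log_bounded_def by (rule exI[of _ "\<bar>c\<bar>"], rule exI[of _ 0]) simp

lemma log_bounded_bound: "(\<And>n. \<bar>X n\<bar> \<le> \<bar>Y n\<bar>)
    \<Longrightarrow> log_bounded Y \<Longrightarrow> log_bounded X"
  unfolding log_bounded_def by (meson order_trans)

lemma log_bounded_add: "log_bounded X \<Longrightarrow> log_bounded Y
    \<Longrightarrow> log_bounded (\<lambda>n. X n + Y n)"
proof -
  assume "log_bounded X" "log_bounded Y"
  then obtain C k D l where X: "C \<ge> 0" "\<And>n. \<bar>X n\<bar> \<le> C * (1 + harm n) ^ k"
    and Y: "D \<ge> 0" "\<And>n. \<bar>Y n\<bar> \<le> D * (1 + harm n) ^ l"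
    by (metis log_boundedE)
  have "\<bar>X n + Y n\<bar> \<le> (C + D) * (1 + harm n) ^ (k + l)" for n
  proof -
    have "\<bar>X n + Y n\<bar> \<le> C * (1 + harm n) ^ k + D * (1 + harm n) ^ l"
      using X(2)[of n] Y(2)[of n] by linarith
    also have "\<dots> \<le> C * (1 + harm n) ^ (k + l) + D * (1 + harm n) ^ (k + l)"
      using X(1) Y(1) by (intro add_mono mult_left_mono harm_pow_le) auto
    finally show ?thesis by (simp add: algebra_simps)
  qed
  then show ?thesis unfolding log_bounded_def by blast
qed

lemma log_bounded_mult: "log_bounded X \<Longrightarrow> log_bounded Y
    \<Longrightarrow> log_bounded (\<lambda>n. X n * Y n)"
proof -
  assume "log_bounded X" "log_bounded Y"
  then obtain C k D l where X: "C \<ge> 0" "\<And>n. \<bar>X n\<bar> \<le> C * (1 + harm n) ^ k"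
    and Y: "D \<ge> 0" "\<And>n. \<bar>Y n\<bar> \<le> D * (1 + harm n) ^ l"
    by (metis log_boundedE)
  have "\<bar>X n * Y n\<bar> \<le> (C * D) * (1 + harm n) ^ (k + l)" for n
  proof -
    have "\<bar>X n\<bar> * \<bar>Y n\<bar> \<le> (C * (1 + harm n) ^ k) * (D * (1 + harm n) ^ l)"
      using X Y one_plus_harm_ge_1[of n] by (intro mult_mono) auto
    then show ?thesis by (simp add: abs_mult power_add algebra_simps)
  qed
  then show ?thesis unfolding log_bounded_def by blast
qed

lemma log_bounded_uminus: "log_bounded X \<Longrightarrow> log_bounded (\<lambda>n. - X n)"
  by (simp add: log_bounded_def)

lemma log_bounded_diff: "log_bounded X \<Longrightarrow> log_bounded Y
    \<Longrightarrow> log_bounded (\<lambda>n. X n - Y n)"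
  using log_bounded_add[OF _ log_bounded_uminus, of X Y] by simp

lemma log_small_log_bounded: "log_small X \<Longrightarrow> log_bounded X"
proof -
  assume "log_small X"
  then obtain C k where X: "C \<ge> 0" "\<And>n. n > 0
      \<Longrightarrow> \<bar>X n\<bar> \<le> C * (1 + harm n) ^ k / real n"
    by (metis log_smallE)
  have "\<bar>X n\<bar> \<le> (C + \<bar>X 0\<bar>) * (1 + harm n) ^ k" for n
  proof (cases "n = 0")
    case True
    then show ?thesis using X(1) by (simp add: harm_def)
  next
    case False
    then have "\<bar>X n\<bar> \<le> C * (1 + harm n) ^ k / real n" using X by simp
    also have "\<dots> \<le> C * (1 + harm n) ^ k / 1"
      using X(1) one_plus_harm_ge_1[of n] False by (intro divide_left_mono) auto
    also have "\<dots> \<le> (C + \<bar>X 0\<bar>) * (1 + harm n) ^ k"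
      using one_plus_harm_ge_1[of n] by (simp add: algebra_simps)
    finally show ?thesis .
  qed
  then show ?thesis unfolding log_bounded_def by blast
qed

lemma log_small_iff_log_bounded: "log_small X \<longleftrightarrow> log_bounded (\<lambda>n. real n * X n)"
proof
  assume "log_small X"
  then obtain C k where X: "C \<ge> 0" "\<And>n. n > 0
      \<Longrightarrow> \<bar>X n\<bar> \<le> C * (1 + harm n) ^ k / real n"
    by (metis log_smallE)
  have "\<bar>real n * X n\<bar> \<le> C * (1 + harm n) ^ k" for n
    using X one_plus_harm_ge_1[of n] by (cases "n = 0") (auto simp: abs_mult field_simps)
  then show "log_bounded (\<lambda>n. real n * X n)" unfolding log_bounded_def by blast
next
  assume "log_bounded (\<lambda>n. real n * X n)"
  from log_boundedE[OF this] obtain C k where X: "C \<ge> 0" "\<And>n. \<bar>real n * X n\<bar>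
      \<le> C * (1 + harm n) ^ k"
    by blast
  have "\<bar>X n\<bar> \<le> C * (1 + harm n) ^ k / real n" if "n > 0" for n
    using X(2)[of n] that by (simp add: abs_mult field_simps)
  then show "log_small X" unfolding log_small_def by blast
qed

lemma log_small_add: "log_small X \<Longrightarrow> log_small Y
    \<Longrightarrow> log_small (\<lambda>n. X n + Y n)"
  and log_small_diff: "log_small X \<Longrightarrow> log_small Y
      \<Longrightarrow> log_small (\<lambda>n. X n - Y n)"
  unfolding log_small_iff_log_bounded distrib_left right_diff_distrib by (fact log_bounded_add, fact log_bounded_diff)

lemma log_small_mult: "log_bounded X \<Longrightarrow> log_small Y
    \<Longrightarrow> log_small (\<lambda>n. X n * Y n)"
  unfolding log_small_iff_log_bounded by (drule (1) log_bounded_mult) (simp add: algebra_simps)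

lemma log_small_mult': "log_small X \<Longrightarrow> log_bounded Y
    \<Longrightarrow> log_small (\<lambda>n. X n * Y n)"
  using log_small_mult[of Y X] by (simp add: mult.commute)

lemma log_small_cmult: "log_small X \<Longrightarrow> log_small (\<lambda>n. c * X n)"
  by (rule log_small_mult[OF log_bounded_const])

lemma log_small_uminus: "log_small X \<Longrightarrow> log_small (\<lambda>n. - X n)"
  by (simp add: log_small_def)

lemma log_small_0: "log_small (\<lambda>n. 0)"
  unfolding log_small_def by (rule exI[of _ 0]) simp

lemma log_small_inverse: "log_small (\<lambda>n. c / real n)"
proof -
  have "log_bounded (\<lambda>n. real n * (c / real n))"
    by (rule log_bounded_bound[OF _ log_bounded_const[of c]]) auto
  then show ?thesis by (simp only: log_small_iff_log_bounded)
qed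

lemma log_small_bound: "(\<And>n. n > 0 \<Longrightarrow> \<bar>X n\<bar> \<le> \<bar>Y n\<bar>)
    \<Longrightarrow> log_small Y \<Longrightarrow> log_small X"
  unfolding log_small_def by (meson order_trans)

lemma log_power_over_n_tendsto_0: "(\<lambda>n. C * (2 + ln (real n)) ^ k / real n)
    \<longlonglongrightarrow> 0"
proof -
  have "((\<lambda>x. (2 + ln x) powr real k / x) \<longlongrightarrow> 0) at_top"
    by real_asymp
  then have "(\<lambda>n. C * ((2 + ln (real n)) powr real k / real n)) \<longlonglongrightarrow> C * 0"
    by (intro tendsto_mult_left filterlim_compose[OF _ filterlim_real_sequentially])
  moreover have "\<forall>\<^sub>F n in sequentially.
      C * ((2 + ln (real n)) powr real k / real n) = C * (2 + ln (real n)) ^ k / real n"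
    using eventually_gt_at_top[of 0]
  proof eventually_elim
    case (elim n)
    then have "2 + ln (real n) > 0" by (intro add_pos_nonneg) auto
    then show ?case by (simp add: powr_realpow)
  qed
  ultimately have "(\<lambda>n. C * (2 + ln (real n)) ^ k / real n) \<longlonglongrightarrow> C * 0"
    by (rule Lim_transform_eventually)
  then show ?thesis by simp
qed

lemma log_small_tendsto: "log_small X \<Longrightarrow> X \<longlonglongrightarrow> 0"
proof -
  assume "log_small X"
  then obtain C k where X: "C \<ge> 0" "\<And>n. n > 0
      \<Longrightarrow> \<bar>X n\<bar> \<le> C * (1 + harm n) ^ k / real n"
    by (metis log_smallE)
  have ev: "\<forall>\<^sub>F n in sequentially. norm (X n) \<le> C * (2 + ln (real n)) ^ k / real n"
    using eventually_gt_at_top[of 0]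
  proof eventually_elim
    case (elim n)
    \<comment> \<open>\<open>harm n - ln n\<close> decreases from its value 1 at n = 1.\<close>
    have "harm n \<le> 1 + ln (real n)"
      using elim euler_mascheroni_sequence_decreasing[of 1 n] by (simp add: harm_def)
    then have "(1 + harm n) ^ k \<le> (2 + ln (real n)) ^ k"
      using one_plus_harm_ge_1[of n] by (intro power_mono) auto
    then have "C * (1 + harm n) ^ k / real n \<le> C * (2 + ln (real n)) ^ k / real n"
      using X(1) by (intro divide_right_mono mult_left_mono) auto
    then show ?case using X(2)[OF elim] by simp
  qed
  have "(\<lambda>n. C * (2 + ln (real n)) ^ k / real n) \<longlonglongrightarrow> 0"
    using log_power_over_n_tendsto_0[of C k] .
  then show ?thesis
    by (rule Lim_null_comparison[OF ev])
qed

section \<open>Sums over the corner i + j > N\<close>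

text \<open>The weights 1 / i and 1 / j, coming from the leading letters, are split off so that X
  and Y grow at most like powers of the logarithm.\<close>

definition corner_sum :: "(nat \<Rightarrow> real) \<Rightarrow> (nat \<Rightarrow> real)
    \<Rightarrow> nat \<Rightarrow> real" where
  "corner_sum X Y N = (\<Sum>i=1..N. \<Sum>j=N+1-i..N. X i * Y j / (real i * real j))"

lemma corner_sum_swap_sum:
  fixes f :: "nat \<Rightarrow> nat \<Rightarrow> real"
  shows "(\<Sum>i=1..N. \<Sum>j=N+1-i..N. f i j) = (\<Sum>j=1..N. \<Sum>i=N+1-j..N. f i j)"
proof -
  have "(\<Sum>i=1..N. \<Sum>j=N+1-i..N. f i j)
      = (\<Sum>(i, j)\<in>Sigma {1..N} (\<lambda>i. {N+1-i..N}). f i j)"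
    by (simp add: sum.Sigma)
  also have "\<dots> = (\<Sum>(j, i)\<in>Sigma {1..N} (\<lambda>j. {N+1-j..N}). f i j)"
    by (rule sum.reindex_bij_witness[of _ "\<lambda>(i, j). (j, i)" "\<lambda>(i, j). (j, i)"]) auto
  also have "\<dots> = (\<Sum>j=1..N. \<Sum>i=N+1-j..N. f i j)"
    by (simp add: sum.Sigma)
  finally show ?thesis .
qed

lemma corner_sum_commute: "corner_sum X Y N = corner_sum Y X N"
  unfolding corner_sum_def by (subst corner_sum_swap_sum) (simp add: mult.commute)

lemma corner_sum_add: "corner_sum X (\<lambda>j. Y j + Z j) N = corner_sum X Y N + corner_sum X Z N"
  and corner_sum_diff: "corner_sum X (\<lambda>j. Y j - Z j) N = corner_sum X Y N - corner_sum X Z N"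
  and corner_sum_cmult: "corner_sum X (\<lambda>j. c * Y j) N = c * corner_sum X Y N"
  by (simp_all only: corner_sum_def sum.distrib sum_subtractf sum_distrib_left distrib_left
      right_diff_distrib add_divide_distrib diff_divide_distrib mult.left_commute[of _ c]
      times_divide_eq_right)

lemma harm_real: "harm N = (\<Sum>i=1..N. 1 / real i)"
  by (simp add: harm_def divide_inverse)

lemma corner_region_inverse: "(\<Sum>i=1..N. \<Sum>j=N+1-i..N. 1 / (real i * real j))
    \<le> (harm N)\<^sup>2"
proof -
  have "(\<Sum>i=1..N. \<Sum>j=N+1-i..N. 1 / (real i * real j))
      \<le> (\<Sum>i=1..N. \<Sum>j=1..N. 1 / (real i * real j))"
    by (intro sum_mono sum_mono2) auto
  also have "\<dots> = harm N * harm N"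
    by (simp add: harm_real sum_product)
  finally show ?thesis by (simp add: power2_eq_square)
qed

text \<open>On the region \<open>i + j > N\<close> one has \<open>1 \<le> (i + j) / N\<close>, which supplies the decay.\<close>

lemma corner_region_decay:
  assumes "N > 0"
  shows "(\<Sum>i=1..N. \<Sum>j=N+1-i..N. 1 / (real i * real j * real j))
      \<le> (harm N + (harm N)\<^sup>2) / real N"
proof -
  have "(\<Sum>i=1..N. \<Sum>j=N+1-i..N. 1 / (real i * real j * real j))
      \<le> (\<Sum>i=1..N. \<Sum>j=N+1-i..N. (1 / (real j * real j) + 1 / (real i * real j)) / real N)"
  proof (intro sum_mono)
    fix i j assume ij: "i \<in> {1..N}" "j \<in> {N+1-i..N}"
    then have pos: "real i > 0" "real j > 0" and le: "real N \<le> real i + real j" by auto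
    have "1 / (real i * real j * real j) = real N / (real i * real j * real j) / real N"
      using assms by simp
    also have "\<dots> \<le> (real i + real j) / (real i * real j * real j) / real N"
      using le pos by (intro divide_right_mono) auto
    also have "(real i + real j) / (real i * real j * real j)
        = 1 / (real j * real j) + 1 / (real i * real j)"
      using pos by (simp add: field_simps)
    finally show "1 / (real i * real j * real j)
        \<le> (1 / (real j * real j) + 1 / (real i * real j)) / real N" .
  qed
  also have "\<dots> = ((\<Sum>i=1..N. \<Sum>j=N+1-i..N. 1 / (real j * real j))
      + (\<Sum>i=1..N. \<Sum>j=N+1-i..N. 1 / (real i * real j))) / real N"
    by (simp add: sum.distrib sum_divide_distrib add_divide_distrib)
  \<comment> \<open>For fixed j exactly j values of i lie in the corner, which leaves 1 / j.\<close>
  also have "(\<Sum>i=1..N. \<Sum>j=N+1-i..N. 1 / (real j * real j)) = harm N"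
    unfolding corner_sum_swap_sum[of "\<lambda>i j. 1 / (real j * real j)"] harm_real
  proof (rule sum.cong[OF refl])
    fix j assume "j \<in> {1..N}"
    then show "(\<Sum>i=N+1-j..N. 1 / (real j * real j)) = 1 / real j" by simp
  qed
  also have "(harm N + (\<Sum>i=1..N. \<Sum>j=N+1-i..N. 1 / (real i * real j))) / real N
      \<le> (harm N + (harm N)\<^sup>2) / real N"
    using corner_region_inverse[of N] by (intro divide_right_mono) auto
  finally show ?thesis .
qed

lemma log_bounded_upto:
  fixes C x :: real
  assumes "C \<ge> 0" "\<bar>x\<bar> \<le> C * (1 + harm i) ^ k" "i \<le> N"
  shows "\<bar>x\<bar> \<le> C * (1 + harm N) ^ k"
proof -
  have "(1 + harm i :: real) ^ k \<le> (1 + harm N) ^ k"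
    using harm_mono[OF assms(3), where 'a = real] one_plus_harm_ge_1[of i] by (intro power_mono) auto
  from mult_left_mono[OF this assms(1)] show ?thesis using assms(2) by linarith
qed

text \<open>Y contributes a further factor 1 / j, for which \<open>corner_region_decay\<close> gains
  1 / N; all logarithmic factors are bounded by their values at N.\<close>

lemma log_small_corner_sum: "log_bounded X \<Longrightarrow> log_small Y
    \<Longrightarrow> log_small (corner_sum X Y)"
proof -
  assume "log_bounded X" "log_small Y"
  then obtain C k D l where X: "C \<ge> 0" "\<And>n. \<bar>X n\<bar> \<le> C * (1 + harm n) ^ k"
    and Y: "D \<ge> 0" "\<And>n. n > 0
        \<Longrightarrow> \<bar>Y n\<bar> \<le> D * (1 + harm n) ^ l / real n"
    by (metis log_boundedE log_smallE)
  have "\<bar>corner_sum X Y N\<bar>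
      \<le> (2 * C * D) * (1 + harm N) ^ (k + l + 2) / real N" if "N > 0" for N
  proof -
    define h :: real where "h = 1 + harm N"
    have h: "h \<ge> 1" using one_plus_harm_ge_1 by (simp add: h_def)
    have "\<bar>corner_sum X Y N\<bar>
        \<le> (\<Sum>i=1..N. \<Sum>j=N+1-i..N. \<bar>X i * Y j / (real i * real j)\<bar>)"
      unfolding corner_sum_def by (rule order_trans[OF sum_abs], rule sum_mono, rule sum_abs)
    also have "\<dots> \<le> (\<Sum>i=1..N. \<Sum>j=N+1-i..N. (C * h ^ k * (D * h ^ l)) *
        (1 / (real i * real j * real j)))"
    proof (intro sum_mono)
      fix i j assume ij: "i \<in> {1..N}" "j \<in> {N+1-i..N}"
      then have pos: "real i > 0" "real j > 0" by auto
      have "\<bar>X i\<bar> \<le> C * h ^ k"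
        unfolding h_def using ij by (intro log_bounded_upto[OF X(1) X(2)]) simp
      moreover have "\<bar>real j * Y j\<bar> \<le> D * h ^ l"
        unfolding h_def
      proof (rule log_bounded_upto[OF Y(1)])
        show "\<bar>real j * Y j\<bar> \<le> D * (1 + harm j) ^ l"
          using Y(2)[of j] pos by (simp add: abs_mult field_simps)
      qed (use ij in simp)
      ultimately have "\<bar>X i\<bar> * \<bar>real j * Y j\<bar> \<le> (C * h ^ k) * (D * h ^ l)"
        using X(1) h by (intro mult_mono) auto
      then show "\<bar>X i * Y j / (real i * real j)\<bar>
          \<le> (C * h ^ k * (D * h ^ l)) * (1 / (real i * real j * real j))"
        using pos by (simp add: abs_mult field_simps)
    qed
    also have "\<dots> = (C * h ^ k * (D * h ^ l)) *
        (\<Sum>i=1..N. \<Sum>j=N+1-i..N. 1 / (real i * real j * real j))"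
      by (simp add: sum_distrib_left)
    also have "\<dots> \<le> (C * h ^ k * (D * h ^ l)) * ((harm N + (harm N)\<^sup>2) / real N)"
      using X(1) Y(1) h that by (intro mult_left_mono corner_region_decay) auto
    also have "\<dots> \<le> (C * h ^ k * (D * h ^ l)) * (2 * h\<^sup>2 / real N)"
    proof (intro mult_left_mono divide_right_mono)
      have "0 \<le> (harm N :: real)" "harm N \<le> h" by (auto simp: h_def harm_nonneg)
      moreover have "h \<le> h\<^sup>2" using h by (simp add: power2_eq_square)
      moreover have "(harm N)\<^sup>2 \<le> h\<^sup>2" using calculation by (intro power_mono) auto
      ultimately show "harm N + (harm N)\<^sup>2 \<le> 2 * h\<^sup>2" by linarith
    qed (use X Y h in auto)
    finally show ?thesis by (simp add: h_def power_add power2_eq_square mult_ac)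
  qed
  then show ?thesis unfolding log_small_def by blast
qed

lemma log_bounded_corner_sum: "log_bounded X \<Longrightarrow> log_bounded Y
    \<Longrightarrow> log_bounded (corner_sum X Y)"
proof -
  assume "log_bounded X" "log_bounded Y"
  then obtain C k D l where X: "C \<ge> 0" "\<And>n. \<bar>X n\<bar> \<le> C * (1 + harm n) ^ k"
    and Y: "D \<ge> 0" "\<And>n. \<bar>Y n\<bar> \<le> D * (1 + harm n) ^ l"
    by (metis log_boundedE)
  have "\<bar>corner_sum X Y N\<bar> \<le> (C * D) * (1 + harm N) ^ (k + l + 2)" for N
  proof -
    define h :: real where "h = 1 + harm N"
    have h: "h \<ge> 1" using one_plus_harm_ge_1 by (simp add: h_def)
    have "\<bar>corner_sum X Y N\<bar>
        \<le> (\<Sum>i=1..N. \<Sum>j=N+1-i..N. \<bar>X i * Y j / (real i * real j)\<bar>)"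
      unfolding corner_sum_def by (rule order_trans[OF sum_abs], rule sum_mono, rule sum_abs)
    also have "\<dots> \<le> (\<Sum>i=1..N. \<Sum>j=N+1-i..N. (C * h ^ k * (D * h ^ l)) *
        (1 / (real i * real j)))"
    proof (intro sum_mono)
      fix i j assume ij: "i \<in> {1..N}" "j \<in> {N+1-i..N}"
      then have pos: "real i > 0" "real j > 0" by auto
      have "\<bar>X i\<bar> \<le> C * h ^ k" "\<bar>Y j\<bar> \<le> D * h ^ l"
        unfolding h_def using ij by (simp_all add: log_bounded_upto[OF X(1) X(2)] log_bounded_upto[OF Y(1) Y(2)])
      then have "\<bar>X i\<bar> * \<bar>Y j\<bar> \<le> (C * h ^ k) * (D * h ^ l)"
        using X(1) h by (intro mult_mono) auto
      then show "\<bar>X i * Y j / (real i * real j)\<bar>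
          \<le> (C * h ^ k * (D * h ^ l)) * (1 / (real i * real j))"
        using pos by (simp add: abs_mult divide_right_mono)
    qed
    also have "\<dots> = (C * h ^ k * (D * h ^ l)) *
        (\<Sum>i=1..N. \<Sum>j=N+1-i..N. 1 / (real i * real j))"
      by (simp add: sum_distrib_left)
    also have "\<dots> \<le> (C * h ^ k * (D * h ^ l)) * h\<^sup>2"
    proof (intro mult_left_mono)
      have "(harm N)\<^sup>2 \<le> h\<^sup>2"
        by (intro power_mono) (auto simp: h_def harm_nonneg)
      then show "(\<Sum>i=1..N. \<Sum>j=N+1-i..N. 1 / (real i * real j)) \<le> h\<^sup>2"
        using corner_region_inverse[of N] by linarith
    qed (use X Y h in auto)
    finally show ?thesis by (simp add: h_def power_add power2_eq_square mult_ac)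
  qed
  then show ?thesis unfolding log_bounded_def by blast
qed

text \<open>A rate is required, not mere convergence, because the error gets multiplied by sequences
  that grow like powers of log n.\<close>

definition fast_convergent :: "(nat \<Rightarrow> real) \<Rightarrow> bool" where
  "fast_convergent X \<longleftrightarrow> (\<exists>c. log_small (\<lambda>n. X n - c))"

lemma fast_convergent_log_bounded: "fast_convergent X \<Longrightarrow> log_bounded X"
proof -
  assume "fast_convergent X"
  then obtain c where "log_small (\<lambda>n. X n - c)" by (auto simp: fast_convergent_def)
  from log_bounded_add[OF log_small_log_bounded[OF this] log_bounded_const[of c]] show ?thesis by simp
qed

text \<open>With c the limit of C, the difference equals the corner sum of X and
  \<open>(C - c) * Y\<close> minus \<open>C N - c\<close> times the corner sum of X and Y. Both are
  small.\<close>

lemma corner_sum_pull: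
  assumes "fast_convergent C" "log_bounded X" "log_bounded Y"
  shows "log_small (\<lambda>N. corner_sum X (\<lambda>j. C j * Y j) N - C N * corner_sum X Y N)"
proof -
  obtain c where c: "log_small (\<lambda>n. C n - c)" using assms(1) by (auto simp: fast_convergent_def)
  have "log_small (\<lambda>N. corner_sum X (\<lambda>j. (C j - c) * Y j) N - (C N - c) * corner_sum X Y N)"
    by (intro log_small_diff log_small_corner_sum assms log_small_mult'[OF c] log_bounded_corner_sum)
  then show ?thesis
    by (simp add: left_diff_distrib corner_sum_diff corner_sum_cmult)
qed

section \<open>Asymptotics of the defect\<close>

lemma log_small_cong: "log_small Y \<Longrightarrow> (\<And>n. n > 0 \<Longrightarrow> X n = Y n)
    \<Longrightarrow> log_small X"
  by (simp add: log_small_def)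

lemma nest_fast_convergent:
  assumes "\<And>m. m > 0 \<Longrightarrow> \<bar>x m\<bar> \<le> C / (real m)\<^sup>2"
  shows "fast_convergent (nest x 1)"
proof -
  have C: "C \<ge> 0" using assms[of 1] by simp
  have sq: "summable (\<lambda>m. C / (real m)\<^sup>2)"
    using summable_mult[OF inverse_power_summable[of 2, where 'a = real], of C] by (simp add: divide_inverse)
  define y where "y m = (if m = 0 then 0 else x m)" for m
  have bd: "norm (y m) \<le> C / (real m)\<^sup>2" for m
    using assms[of m] by (simp add: y_def)
  have sy: "summable y"
    by (rule summable_comparison_test[OF _ sq]) (use bd in auto)
  have nest: "nest x 1 N = (\<Sum>m<Suc N. y m)" for N
    unfolding nest_def lessThan_Suc_atMost atLeast0AtMost[symmetric]
    by (subst (2) sum.atLeast_Suc_atMost) (auto simp: y_def intro!: sum.cong)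
  have "\<bar>nest x 1 N - suminf y\<bar> \<le> \<bar>C / real N\<bar>" if "N > 0" for N
  proof -
    \<comment> \<open>The tail beyond N is dominated by the telescoping series of C / (n - 1) - C /
      n.\<close>
    have tel: "(\<lambda>m. C / real (m + N) - C / real (Suc m + N)) sums (C / real (0 + N) - 0)"
    proof (rule telescope_sums')
      show "(\<lambda>m. C / real (m + N)) \<longlonglongrightarrow> 0"
        by real_asymp
    qed
    have le: "norm (y (m + Suc N)) \<le> C / real (m + N) - C / real (Suc m + N)" for m
    proof -
      have "norm (y (m + Suc N)) \<le> C / (real (m + Suc N))\<^sup>2" by (rule bd)
      also have "\<dots> \<le> C / (real (m + N) * real (Suc m + N))"
        using C that by (intro divide_left_mono) (auto simp: power2_eq_square intro!: mult_right_mono)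
      also have "\<dots> = C / real (m + N) - C / real (Suc m + N)"
        using that by (simp add: field_simps)
      finally show ?thesis .
    qed
    have "suminf y = (\<Sum>m. y (m + Suc N)) + nest x 1 N"
      unfolding nest by (rule suminf_split_initial_segment[OF sy])
    moreover have "norm (\<Sum>m. y (m + Suc N)) \<le> (\<Sum>m. C / real (m + N) - C / real (Suc m + N))"
      using le sums_summable[OF tel] by (rule norm_suminf_le)
    ultimately show ?thesis using tel C by (simp add: sums_iff)
  qed
  then have "log_small (\<lambda>N. nest x 1 N - suminf y)"
    by (rule log_small_bound[OF _ log_small_inverse])
  then show ?thesis by (auto simp: fast_convergent_def)
qed

lemma defect_corner_sum: "defect \<tau> u v N
    = corner_sum (\<lambda>i. real i * dW \<tau> u i) (\<lambda>j. real j * dW \<tau> v j) N"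
proof -
  let ?f = "dW \<tau> u" and ?g = "dW \<tau> v"
  have "partial_sum (cauchy_prod ?f ?g) N = (\<Sum>n\<le>N. \<Sum>i\<le>n. ?f i * ?g (n - i))"
    by (simp add: partial_sum_def cauchy_prod_def)
  also have "\<dots> = (\<Sum>(n, i)\<in>Sigma {..N} (\<lambda>n. {..n}). ?f i * ?g (n - i))"
    by (simp add: sum.Sigma)
  also have "\<dots> = (\<Sum>(i, j)\<in>Sigma {..N} (\<lambda>i. {..N - i}). ?f i * ?g j)"
    by (rule sum.reindex_bij_witness[of _ "\<lambda>(i, j). (i + j, i)" "\<lambda>(n, i). (i, n - i)"]) auto
  also have "\<dots> = (\<Sum>i\<le>N. \<Sum>j\<le>N - i. ?f i * ?g j)"
    by (simp add: sum.Sigma)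
  finally have "defect \<tau> u v N =
      (\<Sum>i\<le>N. (\<Sum>j\<le>N. ?f i * ?g j) - (\<Sum>j\<le>N - i. ?f i * ?g j))"
    by (simp add: defect_def partial_sum_dW[symmetric] partial_sum_def[of ?f] partial_sum_def[of ?g] sum_product sum_subtractf)
  also have "\<dots> = (\<Sum>i\<le>N. \<Sum>j=N+1-i..N. ?f i * ?g j)"
  proof (rule sum.cong[OF refl])
    fix i assume i: "i \<in> {..N}"
    have "{..N} = {..N - i} \<union> {N+1-i..N}" "{..N - i} \<inter> {N+1-i..N} = {}" using i by auto
    then have "(\<Sum>j\<le>N. ?f i * ?g j)
        = (\<Sum>j\<le>N - i. ?f i * ?g j) + (\<Sum>j=N+1-i..N. ?f i * ?g j)"
      by (metis finite_atLeastAtMost finite_atMost sum.union_disjoint)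
    then show "(\<Sum>j\<le>N. ?f i * ?g j) - (\<Sum>j\<le>N - i. ?f i * ?g j)
        = (\<Sum>j=N+1-i..N. ?f i * ?g j)"
      by simp
  qed
  \<comment> \<open>For i = 0 the inner range from N + 1 to N is empty.\<close>
  also have "\<dots> = (\<Sum>i=1..N. \<Sum>j=N+1-i..N. ?f i * ?g j)"
    by (rule sum.mono_neutral_right) (auto simp: not_le)
  also have "\<dots> = corner_sum (\<lambda>i. real i * ?f i) (\<lambda>j. real j * ?g j) N"
    unfolding corner_sum_def by (intro sum.cong refl) auto
  finally show ?thesis .
qed

lemma defect_commute: "defect \<tau> u v = defect \<tau> v u"
  by (auto simp: defect_def cauchy_prod_commute mult.commute)

text \<open>Each of the two leading letters leaves a factor \<open>1 / \<tau>\<close>.\<close>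

definition scaled_corner_sum :: "real \<Rightarrow> (nat \<Rightarrow> real) \<Rightarrow>
    (nat \<Rightarrow> real) \<Rightarrow> nat \<Rightarrow> real" where
  "scaled_corner_sum \<tau> X Y N = corner_sum X Y N / \<tau>\<^sup>2"

definition admissible :: "letter list \<Rightarrow> bool" where
  "admissible u \<longleftrightarrow> (\<forall>(a, r)\<in>set u. a \<le> 4 \<and> r > 0)"

context large_parameter
begin

section \<open>Growth of words and of their summands\<close>

lemma letter_val_bound:
  assumes "m > 0" "a \<le> 4" "k \<le> r"
  shows "\<bar>letter_val \<tau> (a, r) m\<bar> \<le> 1 / real m ^ k"
proof -
  have d: "\<tau> * real m - real a \<ge> real m" "real m \<ge>
      1" using letter_val_denom[OF assms(1,2)] assms(1) by auto
  have "real m ^ k \<le> real m ^ r" using d assms(3) by (intro power_increasing) auto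
  also have "\<dots> \<le> (\<tau> * real m - real a) ^ r" using d by (intro power_mono) auto
  finally have "real m ^ k \<le> (\<tau> * real m - real a) ^ r" .
  moreover have "(\<tau> * real m - real a) ^ r > 0" "real m ^ k > 0" using d by auto
  ultimately show ?thesis by (simp add: letter_val_def frac_le)
qed

lemma log_bounded_W: "admissible u \<Longrightarrow> log_bounded (W \<tau> u)"
proof (induction u)
  case Nil
  then show ?case using log_bounded_const[of 1] by simp
next
  case (Cons x u)
  obtain a r where x: "x = (a, r)" by force
  have a: "a \<le> 4" "1 \<le> r" and u: "admissible u" using Cons.prems by (auto simp: x admissible_def)
  obtain C k where C: "C \<ge> 0" "\<And>n. \<bar>W \<tau> u n\<bar> \<le> C * (1 + harm n) ^ k"
    using Cons.IH[OF u] by (metis log_boundedE)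
  have "\<bar>W \<tau> (x # u) N\<bar> \<le> C * (1 + harm N) ^ Suc k" for N
  proof -
    have "\<bar>W \<tau> (x # u) N\<bar>
        \<le> (\<Sum>m=1..N. \<bar>letter_val \<tau> x m * W \<tau> u (m - 1)\<bar>)"
      by (simp only: W.simps nest_def sum_abs)
    also have "\<dots> \<le> (\<Sum>m=1..N. (1 / real m) * (C * (1 + harm N) ^ k))"
    proof (intro sum_mono)
      fix m assume m: "m \<in> {1..N}"
      have "\<bar>letter_val \<tau> x m\<bar>
          \<le> 1 / real m" using letter_val_bound[of m a 1 r] m a by (simp add: x)
      moreover have "\<bar>W \<tau> u (m - 1)\<bar> \<le> C * (1 + harm N) ^ k"
        using m by (intro log_bounded_upto[OF C(1) C(2)]) auto
      ultimately show "\<bar>letter_val \<tau> x m * W \<tau> u (m - 1)\<bar>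
          \<le> (1 / real m) * (C * (1 + harm N) ^ k)"
        unfolding abs_mult by (intro mult_mono) auto
    qed
    also have "\<dots> = harm N * (C * (1 + harm N) ^ k)"
      by (simp only: harm_real sum_distrib_right)
    also have "\<dots> \<le> (1 + harm N) * (C * (1 + harm N) ^ k)"
      using C(1) one_plus_harm_ge_1[of N] by (intro mult_right_mono) auto
    finally show ?thesis by (simp add: mult_ac)
  qed
  then show ?case unfolding log_bounded_def by blast
qed

lemma log_bounded_W_pred: "admissible u \<Longrightarrow> log_bounded (\<lambda>n. W \<tau> u (n - 1))"
proof -
  assume "admissible u"
  then obtain C k where C: "C \<ge> 0" "\<And>n. \<bar>W \<tau> u n\<bar> \<le> C * (1 + harm n) ^ k"
    by (metis log_bounded_W log_boundedE)
  have "\<bar>W \<tau> u (n - 1)\<bar> \<le> C * (1 + harm n) ^ k" for n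
    by (rule log_bounded_upto[OF C(1) C(2)]) simp
  then show ?thesis unfolding log_bounded_def by blast
qed

lemma log_small_dW_square:
  assumes "admissible ((a, r) # u)" "r > 1"
  shows "log_small (\<lambda>i. real i * dW \<tau> ((a, r) # u) i)"
proof -
  have *: "admissible u" "a \<le> 4" using assms by (auto simp: admissible_def)
  have "log_small (\<lambda>i. 1 / real i * W \<tau> u (i - 1))"
    by (intro log_small_mult' log_small_inverse log_bounded_W_pred *)
  moreover have "\<bar>real i * dW \<tau> ((a, r) # u) i\<bar>
      \<le> \<bar>1 / real i * W \<tau> u (i - 1)\<bar>" if "i > 0" for i
  proof -
    have "real i * \<bar>letter_val \<tau> (a, r) i\<bar> \<le> real i * (1 / real i ^ 2)"
      using letter_val_bound[OF that *(2), of 2 r] assms(2) by (intro mult_left_mono) auto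
    then have "real i * \<bar>letter_val \<tau> (a, r) i\<bar> \<le> 1 / real i"
      using that by (simp add: power2_eq_square)
    then have "(real i * \<bar>letter_val \<tau> (a, r) i\<bar>) * \<bar>W \<tau> u (i - 1)\<bar>
        \<le> 1 / real i * \<bar>W \<tau> u (i - 1)\<bar>"
      by (rule mult_right_mono) simp
    then show ?thesis using that by (simp add: abs_mult)
  qed
  ultimately show ?thesis by (rule log_small_bound[rotated])
qed

lemma log_small_dW:
  assumes "admissible (x # u)"
  shows "log_small (dW \<tau> (x # u))"
proof -
  obtain a r where x: "x = (a, r)" by force
  have *: "admissible u" "a \<le> 4" "r \<ge> 1" using assms by (auto simp: admissible_def x)
  have "log_small (\<lambda>i. 1 / real i * W \<tau> u (i - 1))"
    by (intro log_small_mult' log_small_inverse log_bounded_W_pred *)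
  moreover have "\<bar>dW \<tau> (x # u) i\<bar>
      \<le> \<bar>1 / real i * W \<tau> u (i - 1)\<bar>" if "i > 0" for i
    using mult_right_mono[OF letter_val_bound[OF that *(2), of 1 r], of "\<bar>W \<tau> u
        (i - 1)\<bar>"] *(3) that
    by (simp add: x abs_mult)
  ultimately show ?thesis by (rule log_small_bound[rotated])
qed

text \<open>n / (\<open>\<tau>\<close> n - a) is \<open>1 / \<tau>\<close> plus a multiple of the
  letter itself, and \<open>W\<close> at n and at n - 1 differ by a single small summand. The
  leading letter a thus disappears from the main term.\<close>

lemma dW_asymp:
  assumes "admissible ((a, 1) # u)"
  shows "log_small (\<lambda>i. real i * dW \<tau> ((a, 1) # u) i - W \<tau> u i / \<tau>)"
proof -
  have *: "admissible u" "a \<le> 4" using assms by (auto simp: admissible_def)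
  have 1: "log_small (\<lambda>i. W \<tau> u i - W \<tau> u (i - 1))"
  proof (cases u)
    case Nil
    then show ?thesis using log_small_0 by simp
  next
    case (Cons x v)
    have "(\<lambda>i. W \<tau> u i - W \<tau> u (i - 1)) = dW \<tau> (x # v)"
    proof
      fix i show "W \<tau> u i - W \<tau> u (i - 1) = dW \<tau> (x # v) i"
        by (cases i) (simp_all add: Cons W.simps nest_Suc)
    qed
    then show ?thesis using log_small_dW[of x v] *(1) Cons by simp
  qed
  have "log_small (\<lambda>i. (real a / \<tau>) * (letter_val \<tau> (a, 1) i * W \<tau> u (i - 1)))"
  proof (rule log_small_cmult, rule log_small_bound[of _ "dW \<tau> ((a, 1) # u)"])
    show "log_small (dW \<tau> ((a, 1) # u))" using assms by (rule log_small_dW)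
  qed simp
  from log_small_diff[OF this log_small_cmult[OF 1, of "1 / \<tau>"]]
  have "log_small (\<lambda>i. (real a / \<tau>) * (letter_val \<tau> (a, 1) i * W \<tau> u (i - 1))
      - 1 / \<tau> * (W \<tau> u i - W \<tau> u (i - 1)))" .
  moreover have "real i * dW \<tau> ((a, 1) # u) i - W \<tau> u i / \<tau>
     = (real a / \<tau>) * (letter_val \<tau> (a, 1) i * W \<tau> u (i - 1))
         - 1 / \<tau> * (W \<tau> u i - W \<tau> u (i - 1))" if "i > 0" for i
    using letter_val_denom_nz[OF that *(2)] tau that by (simp add: letter_val_def field_simps)
  ultimately show ?thesis by (rule log_small_cong)
qed

lemma log_bounded_dW: "admissible u \<Longrightarrow> log_bounded (\<lambda>i. real i * dW \<tau> u i)"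
proof (cases u)
  case Nil
  then have "(\<lambda>i. real i * dW \<tau> u i) = (\<lambda>i. 0)" by auto
  then show ?thesis using log_bounded_const[of 0] by simp
next
  case (Cons x v)
  assume "admissible u"
  then show ?thesis using log_small_dW[of x v] Cons by (simp only: log_small_iff_log_bounded)
qed

text \<open>A leading letter of power at least 2 makes \<open>real i * dW\<close> itself small, so
  the whole corner vanishes in the limit.\<close>

lemma defect_log_small:
  assumes "admissible ((a, r) # u)" "admissible v" "r > 1"
  shows "log_small (defect \<tau> ((a, r) # u) v)" "log_small (defect \<tau> v ((a, r) # u))"
proof -
  show "log_small (defect \<tau> v ((a, r) # u))"
    unfolding defect_corner_sum[abs_def] by (intro log_small_corner_sum log_bounded_dW log_small_dW_square assms)
  then show "log_small (defect \<tau> ((a, r) # u) v)"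
    by (simp only: defect_commute[of \<tau> v])
qed

text \<open>The two factors are replaced by their main terms one after the other; a and b enter only
  the error.\<close>

lemma defect_asymp:
  assumes "admissible ((a, 1) # u)" "admissible ((b, 1) # v)"
  shows "log_small (\<lambda>N. defect \<tau> ((a, 1) # u) ((b, 1) # v) N
      - scaled_corner_sum \<tau> (W \<tau> u) (W \<tau> v) N)"
proof -
  let ?f = "\<lambda>i. real i * dW \<tau> ((a, 1) # u) i" and ?g = "\<lambda>i. real i * dW \<tau>
      ((b, 1) # v) i"
  have 1: "log_small (corner_sum ?f (\<lambda>i. ?g i - W \<tau> v i / \<tau>))"
    by (intro log_small_corner_sum log_bounded_dW dW_asymp assms)
  have v: "admissible v" using assms by (auto simp: admissible_def)
  have "log_bounded (\<lambda>i. W \<tau> v i / \<tau>)"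
    using log_bounded_mult[OF log_bounded_W[OF v] log_bounded_const[of "1 / \<tau>"]] by simp
  then have 2: "log_small (corner_sum (\<lambda>i. W \<tau> v i / \<tau>)
      (\<lambda>i. ?f i - W \<tau> u i / \<tau>))"
    by (intro log_small_corner_sum dW_asymp assms)
  have "corner_sum (\<lambda>i. W \<tau> u i / \<tau>) (\<lambda>i. W \<tau> v i / \<tau>) N
      = scaled_corner_sum \<tau> (W \<tau> u) (W \<tau> v) N" for N
    by (simp add: scaled_corner_sum_def corner_sum_def sum_divide_distrib power2_eq_square mult_ac)
  then have "defect \<tau> ((a, 1) # u) ((b, 1) # v) N
      - scaled_corner_sum \<tau> (W \<tau> u) (W \<tau> v) N =
     corner_sum ?f (\<lambda>i. ?g i - W \<tau> v i / \<tau>) N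
         + corner_sum (\<lambda>i. W \<tau> v i / \<tau>) (\<lambda>i. ?f i - W \<tau> u i / \<tau>)
         N" for N
    unfolding corner_sum_diff defect_corner_sum
    by (simp add: corner_sum_commute[of "\<lambda>i. W \<tau> v i / \<tau>"])
  then show ?thesis using log_small_add[OF 1 2] by simp
qed

lemma admissible_Nil [simp]: "admissible []"
  and admissible_Cons [simp]: "admissible ((a, r) # u)
      \<longleftrightarrow> a \<le> 4 \<and> r > 0 \<and> admissible u"
  by (auto simp: admissible_def)

lemma fast_convergent_W2: "a \<le> 4 \<Longrightarrow> r \<ge> 2
    \<Longrightarrow> fast_convergent (W \<tau> [(a, r)])"
  unfolding W.simps by (rule nest_fast_convergent[of _ 1]) (use letter_val_bound[of _ a 2 r] in simp)

text \<open>By partial fractions the difference of the letters 1 and 0 is their product, which is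
  O(1 / m^2).\<close>

lemma fast_convergent_diff: "fast_convergent (\<lambda>n. W \<tau> [(1, 1)] n - W \<tau> [(0, 1)] n)"
proof -
  have "fast_convergent (nest (letter_val \<tau> (0, 1) * letter_val \<tau> (1, 1)) 1)"
  proof (rule nest_fast_convergent[of _ 1])
    fix m :: nat assume "m > 0"
    then have "\<bar>letter_val \<tau> (0, 1) m\<bar> * \<bar>letter_val \<tau> (1, 1) m\<bar>
        \<le> (1 / real m) * (1 / real m)"
      using letter_val_bound[of m 0 1 1] letter_val_bound[of m 1 1 1] by (intro mult_mono) simp_all
    then show "\<bar>(letter_val \<tau> (0, 1) * letter_val \<tau> (1, 1)) m\<bar>
        \<le> 1 / (real m)\<^sup>2"
      by (simp add: abs_mult power2_eq_square)
  qed
  moreover have "nest (letter_val \<tau> (0, 1) * letter_val \<tau> (1, 1)) 1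
      = (\<lambda>n. W \<tau> [(1, 1)] n - W \<tau> [(0, 1)] n)"
    by (auto simp: nest_letter_val_letter_val scale_def W.simps fun_eq_iff)
  ultimately show ?thesis by simp
qed

lemma scaled_corner_sum_add: "scaled_corner_sum \<tau> X (\<lambda>j. Y j + Z j) N
    = scaled_corner_sum \<tau> X Y N + scaled_corner_sum \<tau> X Z N"
  and scaled_corner_sum_diff: "scaled_corner_sum \<tau> X (\<lambda>j. Y j - Z j) N
      = scaled_corner_sum \<tau> X Y N - scaled_corner_sum \<tau> X Z N"
  and scaled_corner_sum_cmult: "scaled_corner_sum \<tau> X (\<lambda>j. c * Y j) N
      = c * scaled_corner_sum \<tau> X Y N"
  and scaled_corner_sum_commute: "scaled_corner_sum \<tau> X Y N = scaled_corner_sum \<tau> Y X N"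
  unfolding scaled_corner_sum_def corner_sum_add corner_sum_diff corner_sum_cmult
  by (simp_all add: add_divide_distrib diff_divide_distrib corner_sum_commute)

lemma log_small_scaled_corner_sum: "log_bounded X \<Longrightarrow> log_small Y
    \<Longrightarrow> log_small (scaled_corner_sum \<tau> X Y)"
  unfolding scaled_corner_sum_def[abs_def] divide_inverse by (intro log_small_mult' log_small_corner_sum log_bounded_const)

lemma scaled_corner_sum_pull:
  assumes "fast_convergent C" "log_bounded X" "log_bounded Y"
  shows "log_small (\<lambda>N. scaled_corner_sum \<tau> X (\<lambda>j. C j * Y j) N
      - C N * scaled_corner_sum \<tau> X Y N)"
proof -
  have "log_small (\<lambda>N. (corner_sum X (\<lambda>j. C j * Y j) N - C N * corner_sum X Y N) *
      inverse (\<tau>\<^sup>2))"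
    by (intro log_small_mult' corner_sum_pull log_bounded_const assms)
  then show ?thesis by (simp add: scaled_corner_sum_def divide_inverse left_diff_distrib mult.assoc)
qed

abbreviation "L \<equiv> W \<tau> [(0, 1)]"
abbreviation "P \<equiv> W \<tau> [(1, 1)]"
abbreviation "\<Delta> \<equiv> \<lambda>n. P n - L n"
abbreviation "Z \<equiv> W \<tau> [(0, 2)]"
abbreviation "Q \<equiv> W \<tau> [(1, 2)]"

text \<open>As 0 + 0 = 0, stuffle and shuffle give the same word, and the defect is exactly the
  merged term of the stuffle. This evaluates the basic corner sum of 1 / (i j).\<close>

lemma defect_0_0: "defect \<tau> [(0, 1)] [(0, 1)] = Z"
proof
  fix N
  have "L N * L N = 2 * W \<tau> [(0, 1), (0, 1)] N + Z N"
    by (simp add: W_mult_at stuffle scale_distrib scale_def del: times_fun_apply One_nat_def)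
  moreover have "L N * L N - defect \<tau> [(0, 1)] [(0, 1)] N = 2 * W \<tau> [(0, 1), (0, 1)] N"
    by (simp add: product_defect shuffle del: One_nat_def dW.simps times_fun_apply)
  ultimately show "defect \<tau> [(0, 1)] [(0, 1)] N = Z N" by linarith
qed

lemma scaled_corner_sum_1_1: "log_small (\<lambda>N. scaled_corner_sum \<tau> 1 1 N - Z N)"
proof -
  have "log_small (\<lambda>N. - (defect \<tau> [(0, 1)] [(0, 1)] N
      - scaled_corner_sum \<tau> (W \<tau> []) (W \<tau> []) N))"
    by (intro log_small_uminus defect_asymp) simp_all
  then show ?thesis by (simp add: defect_0_0 del: One_nat_def)
qed

lemma scaled_corner_sum_1_fast_convergent: "fast_convergent C
    \<Longrightarrow> log_small (\<lambda>N. scaled_corner_sum \<tau> 1 C N - C N * Z N)"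
proof -
  assume C: "fast_convergent C"
  have 1: "log_bounded 1" using log_bounded_const[of 1] by (simp add: one_fun_def)
  have "log_small (\<lambda>N. scaled_corner_sum \<tau> 1 (\<lambda>j. C j * 1 j) N
      - C N * scaled_corner_sum \<tau> 1 1 N)"
    by (rule scaled_corner_sum_pull[OF C 1 1])
  moreover have "log_small (\<lambda>N. C N * (scaled_corner_sum \<tau> 1 1 N - Z N))"
    by (intro log_small_mult fast_convergent_log_bounded C scaled_corner_sum_1_1)
  ultimately have "log_small (\<lambda>N. scaled_corner_sum \<tau> 1 (\<lambda>j. C j * 1 j) N
      - C N * scaled_corner_sum \<tau> 1 1 N + C N * (scaled_corner_sum \<tau> 1 1 N - Z N))"
    by (rule log_small_add)
  then show ?thesis by (simp add: algebra_simps)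
qed

lemma defect_1_1:
  assumes "a \<le> 4" "b \<le> 4"
  shows "log_small (\<lambda>N. defect \<tau> [(a, 1)] [(b, 1)] N - Z N)"
  using log_small_add[OF defect_asymp[of a "[]" b "[]"] scaled_corner_sum_1_1] assms by (simp del: One_nat_def)

text \<open>The leading letters do not affect the main term, so they may be taken to be 0; the
  defect is then homogeneous in t.\<close>

lemma defect_1_10:
  assumes "a \<le> 4" "b \<le> 4"
  shows "log_small (\<lambda>N. defect \<tau> [(a, 1)] [(b, 1), (0, 1)] N
      - defect \<tau> [(0, 1)] [(0, 1), (0, 1)] N)"
  using log_small_diff[OF defect_asymp[of a "[]" b "[(0, 1)]"] defect_asymp[of 0 "[]" 0 "[(0, 1)]"]] assms
  by (simp del: One_nat_def)

text \<open>Splits \<open>P = L + \<Delta>\<close>: the part with L is the defect with letters 0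
  only, and \<open>\<Delta>\<close> is pulled out of the corner sum.\<close>

lemma defect_1_11:
  assumes "a \<le> 4" "b \<le> 4"
  shows "log_small (\<lambda>N. defect \<tau> [(a, 1)] [(b, 1), (1, 1)] N
     - (- L N * Z N + Z N * P N + defect \<tau> [(0, 1)] [(0, 1), (0, 1)] N))"
proof -
  have 1: "log_small (\<lambda>N. defect \<tau> [(a, 1)] [(b, 1), (1, 1)] N
      - scaled_corner_sum \<tau> 1 P N)"
    using defect_asymp[of a "[]" b "[(1, 1)]"] assms by (simp del: One_nat_def)
  have 2: "log_small (\<lambda>N. defect \<tau> [(0, 1)] [(0, 1), (0, 1)] N
      - scaled_corner_sum \<tau> 1 L N)"
    using defect_asymp[of 0 "[]" 0 "[(0, 1)]"] by (simp del: One_nat_def)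
  have 3: "log_small (\<lambda>N. scaled_corner_sum \<tau> 1 \<Delta> N - \<Delta> N * Z N)"
    by (rule scaled_corner_sum_1_fast_convergent[OF fast_convergent_diff])
  show ?thesis
    by (rule log_small_cong[OF log_small_add[OF log_small_diff[OF 1 2] 3]]) (simp add: scaled_corner_sum_diff algebra_simps)
qed

lemma defect_1_1sq:
  assumes "a \<le> 4" "b \<le> 4"
  shows "log_small (\<lambda>N. defect \<tau> [(a, 1)] [(b, 1), (1, 2)] N - Z N * Q N)"
proof -
  have 1: "log_small (\<lambda>N. defect \<tau> [(a, 1)] [(b, 1), (1, 2)] N
      - scaled_corner_sum \<tau> 1 Q N)"
    using defect_asymp[of a "[]" b "[(1, 2)]"] assms by (simp del: One_nat_def)
  have 3: "log_small (\<lambda>N. scaled_corner_sum \<tau> 1 Q N - Q N * Z N)"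
    by (rule scaled_corner_sum_1_fast_convergent[OF fast_convergent_W2]) simp_all
  show ?thesis
    by (rule log_small_cong[OF log_small_add[OF 1 3]]) (simp add: algebra_simps)
qed

text \<open>The corner sums of (\<open>L\<close>, \<open>\<Delta>\<close>) and of (1,
  \<open>\<Delta> * L\<close>) both agree, up to small terms, with \<open>\<Delta> N\<close> times
  the corner sum of (1, \<open>L\<close>), which diverges and is not polynomial in t. They occur 12
  times each with opposite signs and cancel, as do the two contributions quadratic in
  \<open>\<Delta>\<close>. The corner sums with \<open>L\<close> alone stay unevaluated.\<close>

lemma quadruple_defects_asymp:
  "log_small (\<lambda>N. - 2 * defect \<tau> [(2, 1), (1, 1)] [(2, 1), (1, 1)] N
   + 4 * defect \<tau> [(0, 1), (1, 1)] [(2, 1), (1, 1)] N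
   - 8 * defect \<tau> [(0, 1)] [(2, 1), (1, 1), (1, 1)] N
   - 4 * defect \<tau> [(1, 1)] [(1, 1), (0, 1), (1, 1)] N
   + 8 * defect \<tau> [(1, 1), (0, 1)] [(1, 1), (1, 1)] N
   - 8 * defect \<tau> [(1, 1)] [(1, 1), (1, 1), (0, 1)] N
   - (10 * scaled_corner_sum \<tau> L L N - 10 * scaled_corner_sum \<tau> 1 (\<lambda>n. L n * L n) N
      + (2 * Q N + 4 * \<Delta> N + 4 * Z N) * Z N))"
proof -
  let ?R = "defect \<tau> [(0, 1)] [(1, 1)]"
  have s: "log_bounded 1" "log_bounded L" "log_bounded P" "log_bounded \<Delta>" "log_bounded
      (\<lambda>n. 1)"
    using log_bounded_const[of 1] log_bounded_W[of "[(0, 1)]"] log_bounded_W[of "[(1,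
        1)]"] fast_convergent_log_bounded[OF fast_convergent_diff]
    by (simp_all add: one_fun_def)
  have r: "log_small (\<lambda>N. defect \<tau> [(2, 1), (1, 1)] [(2, 1), (1, 1)] N
      - scaled_corner_sum \<tau> P P N)"
     "log_small (\<lambda>N. defect \<tau> [(0, 1), (1, 1)] [(2, 1), (1, 1)] N
         - scaled_corner_sum \<tau> P P N)"
     "log_small (\<lambda>N. defect \<tau> [(0, 1)] [(2, 1), (1, 1), (1, 1)] N
         - scaled_corner_sum \<tau> 1 (W \<tau> [(1, 1), (1, 1)]) N)"
     "log_small (\<lambda>N. defect \<tau> [(1, 1)] [(1, 1), (0, 1), (1, 1)] N
         - scaled_corner_sum \<tau> 1 (W \<tau> [(0, 1), (1, 1)]) N)"
     "log_small (\<lambda>N. defect \<tau> [(1, 1), (0, 1)] [(1, 1), (1, 1)] N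
         - scaled_corner_sum \<tau> L P N)"
     "log_small (\<lambda>N. defect \<tau> [(1, 1)] [(1, 1), (1, 1), (0, 1)] N
         - scaled_corner_sum \<tau> 1 (W \<tau> [(1, 1), (0, 1)]) N)"
    using defect_asymp[of 2 "[(1, 1)]" 2 "[(1, 1)]"] defect_asymp[of 0 "[(1, 1)]" 2 "[(1, 1)]"]
      defect_asymp[of 0 "[]" 2 "[(1, 1), (1, 1)]"] defect_asymp[of 1 "[]" 1 "[(0, 1), (1, 1)]"]
      defect_asymp[of 1 "[(0, 1)]" 1 "[(1, 1)]"] defect_asymp[of 1 "[]" 1 "[(1, 1), (0, 1)]"]
    by (simp_all del: One_nat_def)
  have e1: "log_small (\<lambda>N. scaled_corner_sum \<tau> L \<Delta> N
      - \<Delta> N * scaled_corner_sum \<tau> 1 L N)"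
    using scaled_corner_sum_pull[OF fast_convergent_diff s(2) s(1)] by (simp add: scaled_corner_sum_commute[of L 1] del: One_nat_def)
  have e2: "log_small (\<lambda>N. scaled_corner_sum \<tau> 1 (\<lambda>n. \<Delta> n * L n) N
      - \<Delta> N * scaled_corner_sum \<tau> 1 L N)"
    by (rule scaled_corner_sum_pull[OF fast_convergent_diff s(1) s(2)])
  have e3: "log_small (\<lambda>N. scaled_corner_sum \<tau> 1 \<Delta> N - \<Delta> N * Z N)"
    by (rule scaled_corner_sum_1_fast_convergent[OF fast_convergent_diff])
  have e3': "log_small (\<lambda>N. \<Delta> N *
      (scaled_corner_sum \<tau> 1 \<Delta> N - \<Delta> N * Z N))"
    by (rule log_small_mult[OF s(4) e3])
  have "log_small (\<lambda>N. scaled_corner_sum \<tau> \<Delta> \<Delta> N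
      - \<Delta> N * scaled_corner_sum \<tau> 1 \<Delta> N)"
    using scaled_corner_sum_pull[OF fast_convergent_diff s(4) s(1)] by (simp add: scaled_corner_sum_commute[of \<Delta> 1] del: One_nat_def)
  from log_small_add[OF this e3'] have e4: "log_small
      (\<lambda>N. scaled_corner_sum \<tau> \<Delta> \<Delta> N - \<Delta> N * \<Delta> N * Z N)"
    by (simp add: algebra_simps)
  from log_small_add[OF scaled_corner_sum_pull[OF fast_convergent_diff s(1) s(4)] e3']
  have e5: "log_small (\<lambda>N. scaled_corner_sum \<tau> 1 (\<lambda>n. \<Delta> n * \<Delta> n)
      N - \<Delta> N * \<Delta> N * Z N)"
    by (simp add: algebra_simps)
  have e6: "log_small (\<lambda>N. scaled_corner_sum \<tau> 1 Q N - Q N * Z N)"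
    by (rule scaled_corner_sum_1_fast_convergent[OF fast_convergent_W2]) simp_all
  have "log_small (scaled_corner_sum \<tau> 1 (\<lambda>n. ?R n - Z n))"
    by (intro log_small_scaled_corner_sum s defect_1_1) simp_all
  moreover have "log_small (\<lambda>N. scaled_corner_sum \<tau> 1 Z N - Z N * Z N)"
    by (rule scaled_corner_sum_1_fast_convergent[OF fast_convergent_W2]) simp_all
  ultimately have "log_small (\<lambda>N. scaled_corner_sum \<tau> 1 (\<lambda>n. ?R n - Z n) N
      + (scaled_corner_sum \<tau> 1 Z N - Z N * Z N))"
    by (rule log_small_add)
  then have e7: "log_small (\<lambda>N. scaled_corner_sum \<tau> 1 ?R N - Z N * Z N)"
    by (simp add: scaled_corner_sum_diff del: One_nat_def)
  \<comment> \<open>The weights 8, 4, 8 arise as 4 times the stuffle of \<open>L * P\<close>, plus 4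
    times its shuffle, plus 2 times the stuffle of \<open>P * P\<close>.\<close>
  have q: "8 * W \<tau> [(1, 1), (1, 1)] j + 4 * W \<tau> [(0, 1), (1, 1)] j
      + 8 * W \<tau> [(1, 1), (0, 1)] j
     = 10 * (L j * L j) + 12 * (\<Delta> j * L j) + 2 * (\<Delta> j * \<Delta> j) - 2 * Q j
         - 4 * \<Delta> j - 4 * ?R j" for j
  proof -
    have "P j * P j = 2 * W \<tau> [(1, 1), (1, 1)] j + Q j"
      "L j * P j = W \<tau> [(0, 1), (1, 1)] j + W \<tau> [(1, 1), (0, 1)] j + P j - L j"
      by (simp_all add: W_mult_at stuffle scale_distrib scale_def del: times_fun_apply One_nat_def)
    moreover have "L j * P j - ?R j = W \<tau> [(1, 1), (1, 1)] j + W \<tau> [(1, 1), (0, 1)] j"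
      by (simp add: product_defect shuffle del: One_nat_def dW.simps times_fun_apply)
    ultimately show ?thesis by (simp add: algebra_simps)
  qed
  have "8 * scaled_corner_sum \<tau> 1 (W \<tau> [(1, 1), (1, 1)]) N
      + 4 * scaled_corner_sum \<tau> 1 (W \<tau> [(0, 1), (1, 1)]) N
      + 8 * scaled_corner_sum \<tau> 1 (W \<tau> [(1, 1), (0, 1)]) N
     = scaled_corner_sum \<tau> 1 (\<lambda>j. 8 * W \<tau> [(1, 1), (1, 1)] j
         + 4 * W \<tau> [(0, 1), (1, 1)] j + 8 * W \<tau> [(1, 1), (0, 1)] j) N" for N
    by (simp only: scaled_corner_sum_add scaled_corner_sum_cmult)
  also have "\<dots> N = 10 * scaled_corner_sum \<tau> 1 (\<lambda>j. L j * L j) N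
      + 12 * scaled_corner_sum \<tau> 1 (\<lambda>j. \<Delta> j * L j) N
      + 2 * scaled_corner_sum \<tau> 1 (\<lambda>j. \<Delta> j * \<Delta> j) N
          - 2 * scaled_corner_sum \<tau> 1 Q N - 4 * scaled_corner_sum \<tau> 1 \<Delta> N
          - 4 * scaled_corner_sum \<tau> 1 ?R N" for N
    unfolding q by (simp only: scaled_corner_sum_add scaled_corner_sum_diff scaled_corner_sum_cmult)
  finally have Q: "8 * scaled_corner_sum \<tau> 1 (W \<tau> [(1, 1), (1, 1)]) N
      + 4 * scaled_corner_sum \<tau> 1 (W \<tau> [(0, 1), (1, 1)]) N
      + 8 * scaled_corner_sum \<tau> 1 (W \<tau> [(1, 1), (0, 1)]) N
     = 10 * scaled_corner_sum \<tau> 1 (\<lambda>j. L j * L j) N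
         + 12 * scaled_corner_sum \<tau> 1 (\<lambda>j. \<Delta> j * L j) N
      + 2 * scaled_corner_sum \<tau> 1 (\<lambda>j. \<Delta> j * \<Delta> j) N
          - 2 * scaled_corner_sum \<tau> 1 Q N - 4 * scaled_corner_sum \<tau> 1 \<Delta> N
          - 4 * scaled_corner_sum \<tau> 1 ?R N" for N .
  have PPsum: "P = (\<lambda>n. L n + \<Delta> n)" by auto
  have P1: "scaled_corner_sum \<tau> L P N
      = scaled_corner_sum \<tau> L L N + scaled_corner_sum \<tau> L \<Delta> N" for N
    by (subst PPsum) (simp only: scaled_corner_sum_add)
  have "scaled_corner_sum \<tau> P P N
      = scaled_corner_sum \<tau> P L N + scaled_corner_sum \<tau> P \<Delta> N" for N
    by (subst (2) PPsum) (simp only: scaled_corner_sum_add)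
  moreover have "scaled_corner_sum \<tau> P \<Delta> N
      = scaled_corner_sum \<tau> \<Delta> L N + scaled_corner_sum \<tau> \<Delta> \<Delta> N" for N
    by (subst scaled_corner_sum_commute, subst (2) PPsum) (simp only: scaled_corner_sum_add)
  ultimately have P2: "scaled_corner_sum \<tau> P P N
      = scaled_corner_sum \<tau> L L N + 2 * scaled_corner_sum \<tau> L \<Delta> N
      + scaled_corner_sum \<tau> \<Delta> \<Delta> N" for N
    using P1[of N] by (simp add: scaled_corner_sum_commute[of P L] scaled_corner_sum_commute[of \<Delta> L] del: One_nat_def)
  have "log_small (\<lambda>N. - 2 *
      (defect \<tau> [(2, 1), (1, 1)] [(2, 1), (1, 1)] N - scaled_corner_sum \<tau> P P N)
   + 4 * (defect \<tau> [(0, 1), (1, 1)] [(2, 1), (1, 1)] N - scaled_corner_sum \<tau> P P N)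
   - 8 * (defect \<tau> [(0, 1)] [(2, 1), (1, 1), (1, 1)] N
       - scaled_corner_sum \<tau> 1 (W \<tau> [(1, 1), (1, 1)]) N)
   - 4 * (defect \<tau> [(1, 1)] [(1, 1), (0, 1), (1, 1)] N
       - scaled_corner_sum \<tau> 1 (W \<tau> [(0, 1), (1, 1)]) N)
   + 8 * (defect \<tau> [(1, 1), (0, 1)] [(1, 1), (1, 1)] N - scaled_corner_sum \<tau> L P N)
   - 8 * (defect \<tau> [(1, 1)] [(1, 1), (1, 1), (0, 1)] N
       - scaled_corner_sum \<tau> 1 (W \<tau> [(1, 1), (0, 1)]) N)
   + (12 * (scaled_corner_sum \<tau> L \<Delta> N - \<Delta> N * scaled_corner_sum \<tau> 1 L N)
       + 2 * (scaled_corner_sum \<tau> \<Delta> \<Delta> N - \<Delta> N * \<Delta> N * Z N)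
      - 12 * (scaled_corner_sum \<tau> 1 (\<lambda>n. \<Delta> n * L n) N
          - \<Delta> N * scaled_corner_sum \<tau> 1 L N)
      - 2 * (scaled_corner_sum \<tau> 1 (\<lambda>n. \<Delta> n * \<Delta> n) N
          - \<Delta> N * \<Delta> N * Z N)
      + 2 * (scaled_corner_sum \<tau> 1 Q N - Q N * Z N)
          + 4 * (scaled_corner_sum \<tau> 1 \<Delta> N - \<Delta> N * Z N)
      + 4 * (scaled_corner_sum \<tau> 1 ?R N - Z N * Z N)))"
    by (intro log_small_add log_small_diff log_small_cmult r e1 e2 e3 e4 e5 e6 e7)
  then show ?thesis
  proof (rule log_small_cong)
    fix N :: nat
    show "- 2 * defect \<tau> [(2, 1), (1, 1)] [(2, 1), (1, 1)] N
   + 4 * defect \<tau> [(0, 1), (1, 1)] [(2, 1), (1, 1)] N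
   - 8 * defect \<tau> [(0, 1)] [(2, 1), (1, 1), (1, 1)] N
   - 4 * defect \<tau> [(1, 1)] [(1, 1), (0, 1), (1, 1)] N
   + 8 * defect \<tau> [(1, 1), (0, 1)] [(1, 1), (1, 1)] N
   - 8 * defect \<tau> [(1, 1)] [(1, 1), (1, 1), (0, 1)] N
   - (10 * scaled_corner_sum \<tau> L L N - 10 * scaled_corner_sum \<tau> 1 (\<lambda>n. L n * L n) N
      + (2 * Q N + 4 * \<Delta> N + 4 * Z N) * Z N)
          = - 2 * (defect \<tau> [(2, 1), (1, 1)] [(2, 1), (1, 1)] N - scaled_corner_sum \<tau> P P N)
   + 4 * (defect \<tau> [(0, 1), (1, 1)] [(2, 1), (1, 1)] N - scaled_corner_sum \<tau> P P N)
   - 8 * (defect \<tau> [(0, 1)] [(2, 1), (1, 1), (1, 1)] N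
       - scaled_corner_sum \<tau> 1 (W \<tau> [(1, 1), (1, 1)]) N)
   - 4 * (defect \<tau> [(1, 1)] [(1, 1), (0, 1), (1, 1)] N
       - scaled_corner_sum \<tau> 1 (W \<tau> [(0, 1), (1, 1)]) N)
   + 8 * (defect \<tau> [(1, 1), (0, 1)] [(1, 1), (1, 1)] N - scaled_corner_sum \<tau> L P N)
   - 8 * (defect \<tau> [(1, 1)] [(1, 1), (1, 1), (0, 1)] N
       - scaled_corner_sum \<tau> 1 (W \<tau> [(1, 1), (0, 1)]) N)
   + (12 * (scaled_corner_sum \<tau> L \<Delta> N - \<Delta> N * scaled_corner_sum \<tau> 1 L N)
       + 2 * (scaled_corner_sum \<tau> \<Delta> \<Delta> N - \<Delta> N * \<Delta> N * Z N)
      - 12 * (scaled_corner_sum \<tau> 1 (\<lambda>n. \<Delta> n * L n) N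
          - \<Delta> N * scaled_corner_sum \<tau> 1 L N)
      - 2 * (scaled_corner_sum \<tau> 1 (\<lambda>n. \<Delta> n * \<Delta> n) N
          - \<Delta> N * \<Delta> N * Z N)
      + 2 * (scaled_corner_sum \<tau> 1 Q N - Q N * Z N)
          + 4 * (scaled_corner_sum \<tau> 1 \<Delta> N - \<Delta> N * Z N)
      + 4 * (scaled_corner_sum \<tau> 1 ?R N - Z N * Z N))"
      using Q[of N] P1[of N] P2[of N] by (simp add: algebra_simps)
  qed
qed

end

section \<open>The asymptotic relation between three parts\<close>

definition quadruple_part :: "real \<Rightarrow> nat \<Rightarrow> real" where
  "quadruple_part \<tau> N = 12 * (W \<tau> [(4, 1), (3, 1), (2, 1), (1, 1)] N
      - W \<tau> [(2, 1), (3, 1), (2, 1), (1, 1)] N)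
   - 4 * (W \<tau> [(2, 1), (1, 1), (2, 1), (1, 1)] N - W \<tau> [(0, 1), (1, 1), (2, 1), (1, 1)] N)"

definition zeta_part :: "real \<Rightarrow> nat \<Rightarrow> real" where
  "zeta_part \<tau> N = W \<tau> [(1, 4)] N / 2 + 2 * W \<tau> [(1, 3)] N + W \<tau> [(1, 2)] N
      - 2 * (W \<tau> [(1, 1)] N - W \<tau> [(0, 1)] N)"

text \<open>Collects what is not evaluated. All letters in it are 0, hence for fixed N it is a
  polynomial in \<open>1 / \<tau>\<close>.\<close>

definition polynomial_part :: "real \<Rightarrow> nat \<Rightarrow> real" where
  "polynomial_part \<tau> N = 10 * scaled_corner_sum \<tau> (W \<tau> [(0, 1)]) (W \<tau> [(0, 1)])
      N - 10 * scaled_corner_sum \<tau> 1 (\<lambda>n. W \<tau> [(0, 1)] n * W \<tau> [(0, 1)] n) N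
      + 4 * (W \<tau> [(0, 2)] N * W \<tau> [(0, 2)] N)
      - 2 * (W \<tau> [(0, 1)] N * W \<tau> [(0, 2)] N) + W \<tau> [(0, 2)] N
     + 2 * defect \<tau> [(0, 1)] [(0, 1), (0, 1)] N"

context large_parameter
begin

text \<open>\<open>key_identity\<close> places each remaining defect next to its main term, so every
  bracket is small even when its coefficient grows like log N. Its products of \<open>Z\<close> with
  \<open>Q\<close> and \<open>\<Delta>\<close> cancel those from
  \<open>quadruple_defects_asymp\<close>.\<close>

lemma quadruple_part_asymp: "log_small
    (\<lambda>N. quadruple_part \<tau> N - zeta_part \<tau> N - polynomial_part \<tau> N)"
proof -
  \<comment> \<open>Explicit coefficients, even 1, give every summand the shape that
    \<open>log_small_mult\<close> expects.\<close>
  have E: "log_small (\<lambda>N. (- 4) *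
      (defect \<tau> [(0, 1)] [(2, 1), (1, 2)] N - (W \<tau> [(0, 2)] N * W \<tau> [(1, 2)] N))
   + (- 4) * defect \<tau> [(1, 1)] [(1, 2), (0, 1)] N
   + 4 * defect \<tau> [(1, 2)] [(1, 1), (0, 1)] N
   + (3 / 2) * (defect \<tau> [(1, 1)] [(0, 1), (1, 2)] N - (W \<tau> [(0, 2)] N * W \<tau> [(1, 2)] N))
   + (- 1 / 2) * defect \<tau> [(1, 2)] [(0, 1), (1, 1)] N
   + 1 * (defect \<tau> [(0, 1)] [(1, 1), (1, 2)] N - (W \<tau> [(0, 2)] N * W \<tau> [(1, 2)] N))
   + 1 * defect \<tau> [(0, 1)] [(1, 2), (1, 1)] N
   + (- 2) * (defect \<tau> [(1, 1)] [(1, 1), (1, 1)] N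
       - (- W \<tau> [(0, 1)] N * W \<tau> [(0, 2)] N + W \<tau> [(0, 2)] N * W \<tau> [(1, 1)] N
       + defect \<tau> [(0, 1)] [(0, 1), (0, 1)] N))
   + 2 * (defect \<tau> [(1, 1)] [(1, 1), (0, 1)] N - (defect \<tau> [(0, 1)] [(0, 1), (0, 1)] N))
   + 2 * (defect \<tau> [(1, 1)] [(0, 1), (1, 1)] N
       - (- W \<tau> [(0, 1)] N * W \<tau> [(0, 2)] N + W \<tau> [(0, 2)] N * W \<tau> [(1, 1)] N
       + defect \<tau> [(0, 1)] [(0, 1), (0, 1)] N))
   + (1 / 2 * W \<tau> [(1, 2)] N - 2 * W \<tau> [(1, 1)] N + 2 * W \<tau> [(0, 1)] N - 1 / 2) *
       (defect \<tau> [(1, 1)] [(1, 1)] N - (W \<tau> [(0, 2)] N))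
   + (- W \<tau> [(1, 2)] N - 2 * W \<tau> [(1, 1)] N + 3 / 2) *
       (defect \<tau> [(0, 1)] [(1, 1)] N - (W \<tau> [(0, 2)] N))
   + (- W \<tau> [(1, 1)] N + 1) * defect \<tau> [(1, 1)] [(1, 2)] N
   + (- W \<tau> [(1, 1)] N - 3 / 2) * defect \<tau> [(0, 1)] [(1, 2)] N
   + 1 * defect \<tau> [(0, 1)] [(1, 3)] N)"
    by (intro log_small_add; rule log_small_mult,
        (intro log_bounded_add log_bounded_diff log_bounded_mult log_bounded_uminus log_bounded_const log_bounded_W; simp del: One_nat_def)[1],
        (rule defect_log_small defect_1_1 defect_1_10 defect_1_11 defect_1_1sq; simp del: One_nat_def)[1])
  show ?thesis
  proof (rule log_small_cong[OF log_small_add[OF quadruple_defects_asymp E]])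
    fix N :: nat
    show "quadruple_part \<tau> N - zeta_part \<tau> N - polynomial_part \<tau> N
        =  - 2 * defect \<tau> [(2, 1), (1, 1)] [(2, 1), (1, 1)] N
   + 4 * defect \<tau> [(0, 1), (1, 1)] [(2, 1), (1, 1)] N
   - 8 * defect \<tau> [(0, 1)] [(2, 1), (1, 1), (1, 1)] N
   - 4 * defect \<tau> [(1, 1)] [(1, 1), (0, 1), (1, 1)] N
   + 8 * defect \<tau> [(1, 1), (0, 1)] [(1, 1), (1, 1)] N
   - 8 * defect \<tau> [(1, 1)] [(1, 1), (1, 1), (0, 1)] N
   - (10 * scaled_corner_sum \<tau> L L N - 10 * scaled_corner_sum \<tau> 1 (\<lambda>n. L n * L n) N
      + (2 * Q N + 4 * \<Delta> N + 4 * Z N) * Z N)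
   + ((- 4) * (defect \<tau> [(0, 1)] [(2, 1), (1, 2)] N - (W \<tau> [(0, 2)] N * W \<tau> [(1, 2)] N))
   + (- 4) * defect \<tau> [(1, 1)] [(1, 2), (0, 1)] N
   + 4 * defect \<tau> [(1, 2)] [(1, 1), (0, 1)] N
   + (3 / 2) * (defect \<tau> [(1, 1)] [(0, 1), (1, 2)] N - (W \<tau> [(0, 2)] N * W \<tau> [(1, 2)] N))
   + (- 1 / 2) * defect \<tau> [(1, 2)] [(0, 1), (1, 1)] N
   + 1 * (defect \<tau> [(0, 1)] [(1, 1), (1, 2)] N - (W \<tau> [(0, 2)] N * W \<tau> [(1, 2)] N))
   + 1 * defect \<tau> [(0, 1)] [(1, 2), (1, 1)] N
   + (- 2) * (defect \<tau> [(1, 1)] [(1, 1), (1, 1)] N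
       - (- W \<tau> [(0, 1)] N * W \<tau> [(0, 2)] N + W \<tau> [(0, 2)] N * W \<tau> [(1, 1)] N
       + defect \<tau> [(0, 1)] [(0, 1), (0, 1)] N))
   + 2 * (defect \<tau> [(1, 1)] [(1, 1), (0, 1)] N - (defect \<tau> [(0, 1)] [(0, 1), (0, 1)] N))
   + 2 * (defect \<tau> [(1, 1)] [(0, 1), (1, 1)] N
       - (- W \<tau> [(0, 1)] N * W \<tau> [(0, 2)] N + W \<tau> [(0, 2)] N * W \<tau> [(1, 1)] N
       + defect \<tau> [(0, 1)] [(0, 1), (0, 1)] N))
   + (1 / 2 * W \<tau> [(1, 2)] N - 2 * W \<tau> [(1, 1)] N + 2 * W \<tau> [(0, 1)] N - 1 / 2) *
       (defect \<tau> [(1, 1)] [(1, 1)] N - (W \<tau> [(0, 2)] N))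
   + (- W \<tau> [(1, 2)] N - 2 * W \<tau> [(1, 1)] N + 3 / 2) *
       (defect \<tau> [(0, 1)] [(1, 1)] N - (W \<tau> [(0, 2)] N))
   + (- W \<tau> [(1, 1)] N + 1) * defect \<tau> [(1, 1)] [(1, 2)] N
   + (- W \<tau> [(1, 1)] N - 3 / 2) * defect \<tau> [(0, 1)] [(1, 2)] N
   + 1 * defect \<tau> [(0, 1)] [(1, 3)] N)"
      unfolding quadruple_part_def zeta_part_def polynomial_part_def key_identity by (simp add: algebra_simps)
  qed
qed

end

section \<open>Multiple zeta values as coefficients\<close>

definition decreasing_lists :: "nat \<Rightarrow> nat list set" where
  "decreasing_lists k = {ms. length ms = k \<and> sorted_wrt (>) ms \<and> (\<forall>m\<in>set ms. 0 < m)}"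

definition decreasing_lists_upto :: "nat \<Rightarrow> nat \<Rightarrow> nat list set" where
  "decreasing_lists_upto k N = {ms \<in> decreasing_lists k. \<forall>m\<in>set ms. m \<le> N}"

fun nests :: "(nat \<Rightarrow> real) list \<Rightarrow> nat \<Rightarrow> real" where
  "nests [] = 1"
| "nests (x # xs) = nest x (nests xs)"

lemma finite_decreasing_lists_upto: "finite (decreasing_lists_upto k N)"
  by (rule finite_subset[OF _ finite_lists_length_eq[of "{..N}" k]])
    (auto simp: decreasing_lists_upto_def decreasing_lists_def)

lemma decreasing_lists_upto_Suc: "decreasing_lists_upto (Suc k) N
    = (\<lambda>(m, ms). m # ms) ` (SIGMA m:{1..N}. decreasing_lists_upto k (m - 1))"
proof (intro equalityI subsetI)
  fix ms assume "ms \<in> decreasing_lists_upto (Suc k) N"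
  then obtain m ms' where "ms = m # ms'" "length ms' = k" and *: "sorted_wrt (>) (m # ms')"
    "\<forall>x\<in>set (m # ms'). 0 < x \<and> x \<le> N"
    by (auto simp: decreasing_lists_upto_def decreasing_lists_def length_Suc_conv)
  moreover from * have "\<forall>x\<in>set ms'. x \<le> m - 1" by auto
  ultimately have "(m, ms') \<in> (SIGMA m:{1..N}. decreasing_lists_upto k (m - 1))"
    by (auto simp: decreasing_lists_upto_def decreasing_lists_def)
  then show "ms \<in> (\<lambda>(m, ms). m # ms) ` (SIGMA m:{1..N}. decreasing_lists_upto k (m - 1))"
    using \<open>ms = m # ms'\<close> by (auto intro!: image_eqI[of _ _ "(m, ms')"])
qed (force simp: decreasing_lists_upto_def decreasing_lists_def)

lemma nests_sum: "nests xs N = (\<Sum>ms\<in>decreasing_lists_upto (length xs) N. \<Prod>i<length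
    xs. (xs ! i) (ms ! i))"
proof (induction xs arbitrary: N)
  case Nil
  have "decreasing_lists_upto 0 N = {[]}" by (auto simp: decreasing_lists_upto_def decreasing_lists_def)
  then show ?case by simp
next
  case (Cons x xs)
  let ?D = "SIGMA m:{1..N}. decreasing_lists_upto (length xs) (m - 1)"
  have "(\<Sum>ms\<in>decreasing_lists_upto (length (x # xs)) N. \<Prod>i<length (x # xs).
      ((x # xs) ! i) (ms ! i))
      = (\<Sum>(m, ms)\<in>?D. \<Prod>i<Suc (length xs). ((x # xs) ! i) ((m # ms) ! i))"
    unfolding list.size decreasing_lists_upto_Suc add_Suc_right add_0_right
    by (subst sum.reindex) (auto simp: inj_on_def case_prod_unfold)
  also have "\<dots> = (\<Sum>(m, ms)\<in>?D. x m * (\<Prod>i<length xs. (xs ! i) (ms ! i)))"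
    by (simp add: prod.lessThan_Suc_shift del: prod.lessThan_Suc)
  also have "\<dots> = (\<Sum>m=1..N. x m * nests xs (m - 1))"
    by (simp add: sum.Sigma[symmetric] finite_decreasing_lists_upto Cons.IH sum_distrib_left)
  finally show ?case by (simp add: nest_def)
qed

text \<open>Every finite set of lists lies in some truncation, so for nonnegative terms the limit of
  the truncations is the supremum of the finite sums.\<close>

lemma has_sum_decreasing_lists:
  assumes pos: "\<And>x m. x \<in> set xs \<Longrightarrow> m > 0 \<Longrightarrow> x m \<ge> 0"
    and lim: "nests xs \<longlonglongrightarrow> S"
  shows "((\<lambda>ms. \<Prod>i<length xs. (xs ! i) (ms ! i)) has_sum S) (decreasing_lists (length xs))"
proof -
  let ?f = "\<lambda>ms. \<Prod>i<length xs. (xs ! i) (ms ! i)" and ?k = "length xs"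
  have f: "?f ms \<ge> 0" if "ms \<in> decreasing_lists ?k" for ms
    using that pos by (intro prod_nonneg) (auto simp: decreasing_lists_def)
  have mono: "nests xs N \<le> nests xs M" if "N \<le> M" for N M
    unfolding nests_sum using that f
    by (intro sum_mono2 finite_decreasing_lists_upto) (force simp: decreasing_lists_upto_def)+
  have le: "nests xs N \<le> S" for N
    by (rule incseq_le[OF _ lim]) (auto simp: incseq_def mono)
  have fin: "sum ?f F \<le> S" if "finite F" "F \<subseteq> decreasing_lists ?k" for F
  proof -
    have "finite (\<Union> (set ` F))" using that by auto
    then obtain N where "\<forall>m\<in>\<Union> (set ` F). m
        \<le> N" using finite_nat_set_iff_bounded_le by blast
    then have "F \<subseteq> decreasing_lists_upto ?k
        N" using that by (auto simp: decreasing_lists_upto_def)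
    then have "sum ?f F \<le> nests xs N"
      unfolding nests_sum using f by (intro sum_mono2 finite_decreasing_lists_upto) (auto simp: decreasing_lists_upto_def)
    with le[of N] show ?thesis by simp
  qed
  have summ: "?f summable_on decreasing_lists ?k"
    using f fin by (intro nonneg_bdd_above_summable_on) (auto intro!: bdd_aboveI2[of _ _ S])
  moreover have "infsum ?f (decreasing_lists ?k) = S"
  proof (rule antisym)
    show "infsum ?f (decreasing_lists ?k) \<le> S"
      by (rule infsum_le_finite_sums[OF summ]) (rule fin)
    have "nests xs N \<le> infsum ?f (decreasing_lists ?k)" for N
      unfolding nests_sum using f
      by (intro finite_sum_le_infsum summ finite_decreasing_lists_upto) (auto simp: decreasing_lists_upto_def)
    then show "S \<le> infsum ?f (decreasing_lists ?k)"
      by (intro LIMSEQ_le_const2[OF lim]) auto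
  qed
  ultimately show ?thesis using has_sum_infsum by metis
qed

section \<open>Generating functions of multiple zeta values\<close>

lemma has_sum_prod:
  fixes f :: "'a \<Rightarrow> real" and g :: "'b \<Rightarrow> real"
  assumes f: "(f has_sum a) A" and g: "(g has_sum b) B"
    and pos: "\<And>x. x \<in> A \<Longrightarrow> f x \<ge> 0" "\<And>y. y \<in> B
        \<Longrightarrow> g y \<ge> 0"
  shows "((\<lambda>(x, y). f x * g y) has_sum (a * b)) (A \<times> B)"
proof (rule has_sum_SigmaI)
  show 1: "((\<lambda>y. (case (x, y) of (x, y) \<Rightarrow> f x * g y)) has_sum (f x * b)) B" for x
    using has_sum_cmult_right[OF g, of "f x"] by simp
  show 2: "((\<lambda>x. f x * b) has_sum (a * b)) A"
    using has_sum_cmult_left[OF f, of b] .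
  show "(\<lambda>(x, y). f x * g y) summable_on A \<times> B"
    by (rule summable_on_SigmaI[OF 1]) (use 2 pos in \<open>auto simp: summable_on_def\<close>)
qed

text \<open>The nonnegative family indexed by index lists and exponents is summed in both orders;
  its summability is derived from \<open>lim\<close>.\<close>

lemma mzv_generating_has_sum:
  fixes p1 p2 p3 p4 :: "nat \<Rightarrow> real" and t :: real
  assumes t: "t > 0"
    and pos: "\<And>l. l \<in> A1 \<Longrightarrow> p1 l \<ge> 0" "\<And>l. l \<in> A2
        \<Longrightarrow> p2 l \<ge> 0"
       "\<And>l. l \<in> A3 \<Longrightarrow> p3 l \<ge> 0" "\<And>l. l \<in> A4
           \<Longrightarrow> p4 l \<ge> 0"
    and x: "\<And>m. m > 0 \<Longrightarrow>
        ((\<lambda>l. p1 l * t ^ l * (1 / real m ^ l)) has_sum x1 m) A1"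
       "\<And>m. m > 0 \<Longrightarrow> ((\<lambda>l. p2 l * t ^ l * (1 / real m ^ l)) has_sum x2 m) A2"
       "\<And>m. m > 0 \<Longrightarrow> ((\<lambda>l. p3 l * t ^ l * (1 / real m ^ l)) has_sum x3 m) A3"
       "\<And>m. m > 0 \<Longrightarrow> ((\<lambda>l. p4 l * t ^ l * (1 / real m ^ l)) has_sum x4 m) A4"
    and lim: "nest x1 (nest x2 (nest x3 (nest x4 1))) \<longlonglongrightarrow> S"
  shows "((\<lambda>(l1, l2, l3, l4). p1 l1 * p2 l2 * p3 l3 * p4 l4 * t ^ (l1 + l2 + l3 + l4) * mzv
      [l1, l2, l3, l4])
     has_sum S) (A1 \<times> A2 \<times> A3 \<times> A4)"
proof -
  let ?K = "A1 \<times> A2 \<times> A3 \<times> A4"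
  define q where "q p l m = p l * t ^ l * (1 / real m ^ l)" for p :: "nat \<Rightarrow> real" and l m
  define f where "f = (\<lambda>(ms :: nat list, l1, l2, l3, l4).
    q p1 l1 (ms ! 0) * (q p2 l2 (ms ! 1) * (q p3 l3 (ms ! 2) * q p4 l4 (ms ! 3))))"
  define g where "g ms = x1 (ms ! 0) * (x2 (ms ! 1) * (x3 (ms ! 2) * x4 (ms ! 3)))" for ms :: "nat list"
  have q: "q p1 l m \<ge> 0" if "l \<in> A1" for l m using pos that t by (simp add: q_def)
  have q2: "q p2 l m \<ge> 0" if "l \<in> A2" for l m using pos that t by (simp add: q_def)
  have q3: "q p3 l m \<ge> 0" if "l \<in> A3" for l m using pos that t by (simp add: q_def)
  have q4: "q p4 l m \<ge> 0" if "l \<in> A4" for l m using pos that t by (simp add: q_def)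
  have x': "m > 0 \<Longrightarrow> ((\<lambda>l. q p1 l m) has_sum x1 m) A1" "m > 0
      \<Longrightarrow> ((\<lambda>l. q p2 l m) has_sum x2 m) A2"
    "m > 0 \<Longrightarrow> ((\<lambda>l. q p3 l m) has_sum x3 m) A3" "m > 0
        \<Longrightarrow> ((\<lambda>l. q p4 l m) has_sum x4 m) A4" for m
    using x[of m] by (auto simp: q_def)
  have xpos: "x1 m \<ge> 0" "x2 m \<ge> 0" "x3 m \<ge> 0" "x4 m \<ge> 0" if "m > 0" for m
    using has_sum_nonneg[OF x'(1)[OF that]] has_sum_nonneg[OF x'(2)[OF that]]
      has_sum_nonneg[OF x'(3)[OF that]] has_sum_nonneg[OF x'(4)[OF that]] q q2 q3 q4 by auto
  have inner: "((\<lambda>k. f (ms, k)) has_sum g ms) ?K" if "ms \<in> decreasing_lists 4" for ms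
  proof -
    have m: "ms ! 0 > 0" "ms ! 1 > 0" "ms ! 2 > 0" "ms ! 3 > 0"
      using that by (auto simp: decreasing_lists_def)
    have "((\<lambda>(l1, y). q p1 l1 (ms ! 0) * (case y of (l2, y) \<Rightarrow> q p2 l2 (ms ! 1) *
        (case y of (l3, l4) \<Rightarrow> q p3 l3 (ms ! 2) * q p4 l4 (ms ! 3)))) has_sum g ms) ?K"
      unfolding g_def using q q2 q3 q4
      by (intro has_sum_prod x' m) auto
    then show ?thesis by (simp add: f_def case_prod_unfold)
  qed
  have outer: "(g has_sum S) (decreasing_lists 4)"
  proof -
    have "((\<lambda>ms. \<Prod>i<length [x1, x2, x3, x4]. ([x1, x2, x3, x4] ! i) (ms ! i)) has_sum S)
        (decreasing_lists (length [x1, x2, x3, x4]))"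
      by (rule has_sum_decreasing_lists) (use xpos lim in auto)
    moreover have "(\<Prod>i<length [x1, x2, x3, x4]. ([x1, x2, x3, x4] ! i) (ms ! i)) = g ms" for ms
      by (simp add: g_def numeral_eq_Suc lessThan_Suc mult_ac)
    ultimately show ?thesis by (simp add: numeral_eq_Suc)
  qed
  have fpos: "f (ms, k) \<ge> 0" if "k \<in> ?K" for ms k
    using that q q2 q3 q4 by (auto simp: f_def)
  have summ: "f summable_on decreasing_lists 4 \<times> ?K"
    by (rule summable_on_SigmaI[OF inner]) (use outer fpos in \<open>auto simp: summable_on_def\<close>)
  have "(f has_sum S) (decreasing_lists 4 \<times> ?K)"
    by (rule has_sum_SigmaI[OF inner outer summ])
  then have sw: "((\<lambda>(k, ms). f (ms, k)) has_sum S) (?K \<times> decreasing_lists 4)"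
    by (subst (asm) has_sum_swap)
  have mz: "((\<lambda>ms. f (ms, k)) has_sum (case k of (l1, l2, l3, l4) \<Rightarrow>
      p1 l1 * p2 l2 * p3 l3 * p4 l4 * t ^ (l1 + l2 + l3 + l4) * mzv [l1, l2, l3, l4])) (decreasing_lists 4)"
    if k: "k \<in> ?K" for k
  proof -
    obtain l1 l2 l3 l4 where kk: "k = (l1, l2, l3, l4)" by (cases k) auto
    have s: "(\<lambda>ms. f (ms, k)) summable_on decreasing_lists 4"
      by (rule summable_on_SigmaD1[OF has_sum_imp_summable[OF sw] k])
    have "infsum (\<lambda>ms. f (ms, k)) (decreasing_lists 4) =
      infsum (\<lambda>ms. (p1 l1 * p2 l2 * p3 l3 * p4 l4 * t ^ (l1 + l2 + l3 + l4)) *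
        (\<Prod>i<length [l1, l2, l3, l4]. 1 / real (ms ! i) ^ ([l1, l2, l3, l4] ! i)))
            (decreasing_lists 4)"
      by (intro infsum_cong) (simp add: f_def kk q_def numeral_eq_Suc lessThan_Suc power_add mult_ac)
    also have "\<dots> = (p1 l1 * p2 l2 * p3 l3 * p4 l4 * t ^ (l1 + l2 + l3 + l4)) * mzv [l1, l2, l3, l4]"
      unfolding infsum_cmult_right' by (simp add: mzv_def decreasing_lists_def numeral_eq_Suc)
    finally show ?thesis using has_sum_infsum[OF s] by (simp add: kk)
  qed
  have "((\<lambda>k. (case k of (l1, l2, l3, l4) \<Rightarrow>
      p1 l1 * p2 l2 * p3 l3 * p4 l4 * t ^ (l1 + l2 + l3 + l4) * mzv [l1, l2, l3, l4])) has_sum S) ?K"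
    by (rule has_sum_SigmaD[OF sw]) (use mz in simp)
  then show ?thesis .
qed

lemma has_sum_shift_Suc:
  "((\<lambda>n. f (Suc n)) has_sum S) UNIV \<longleftrightarrow> (f has_sum S) {1 :: nat..}"
proof -
  have "{1 :: nat..} = range Suc" by (auto simp: image_def) (metis Suc_le_D)
  then show ?thesis using has_sum_reindex[of Suc UNIV f S] by (simp add: o_def)
qed

lemma has_sum_diff_real:
  fixes f g :: "'b \<Rightarrow> real"
  assumes "(f has_sum a) A" "(g has_sum b) A"
  shows "((\<lambda>x. f x - g x) has_sum (a - b)) A"
  using has_sum_add[OF assms(1) has_sum_cmult_right[OF assms(2), of "-1"]] by simp

text \<open>A geometric series in a t / m. For a = 0 the convention 0 ^ 0 = 1 leaves the term l = 1
  alone.\<close>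

lemma letter_has_sum:
  assumes "0 < t" "t < 1 / 8" "a \<le> 4" "m > 0"
  shows "((\<lambda>l. real a ^ (l - 1) * t ^ l * (1 / real m ^ l)) has_sum letter_val (1 / t)
      (a, 1) m) {1..}"
proof -
  define u where "u = real a * t / real m"
  have u: "0 \<le> u" "u < 1"
  proof -
    have "real a * t \<le> 4 * t" using assms by (intro mult_right_mono) auto
    moreover have "real m \<ge> 1" using assms by simp
    ultimately have "real a * t < real m" using assms by linarith
    then show "u < 1" "0 \<le> u" using assms by (auto simp: u_def)
  qed
  have "(\<lambda>n. t / real m * u ^ n) sums (t / real m * (1 / (1 - u)))"
    by (intro sums_mult geometric_sums) (use u in auto)
  then have "((\<lambda>n. t / real m * u ^ n) has_sum (t / real m * (1 / (1 - u)))) UNIV"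
    by (rule sums_nonneg_imp_has_sum) (use u assms in auto)
  moreover have "t / real m * u ^ n = real a ^ (Suc n - 1) * t ^ Suc n * (1 / real m ^ Suc n)" for n
    by (simp add: u_def power_mult_distrib power_divide)
  moreover have "t / real m * (1 / (1 - u)) = letter_val (1 / t) (a, 1) m"
  proof -
    have "real m - real a * t \<noteq> 0" using u assms by (simp add: u_def field_simps)
    then show ?thesis using assms u by (simp add: u_def letter_val_def field_simps)
  qed
  ultimately show ?thesis
    unfolding has_sum_shift_Suc[symmetric] by simp
qed

text \<open>At l = 1 both powers are 1 and cancel; this produces the condition l_1 >= 2.\<close>

lemma letter_diff_has_sum:
  assumes "0 < t" "t < 1 / 8" "a \<le> 4" "b \<le> 4" "m > 0"
  shows "((\<lambda>l. (real a ^ (l - 1) - real b ^ (l - 1)) * t ^ l * (1 / real m ^ l))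
    has_sum (letter_val (1 / t) (a, 1) m - letter_val (1 / t) (b, 1) m)) {2..}"
proof -
  have "((\<lambda>l. real a ^ (l - 1) * t ^ l * (1 / real m ^ l)
      - real b ^ (l - 1) * t ^ l * (1 / real m ^ l))
    has_sum (letter_val (1 / t) (a, 1) m - letter_val (1 / t) (b, 1) m)) {1..}"
    by (intro has_sum_diff_real letter_has_sum assms)
  then have "((\<lambda>l. (real a ^ (l - 1) - real b ^ (l - 1)) * t ^ l * (1 / real m ^ l))
    has_sum (letter_val (1 / t) (a, 1) m - letter_val (1 / t) (b, 1) m)) {1..}"
    by (simp add: left_diff_distrib diff_divide_distrib)
  then show ?thesis
  proof (subst (asm) has_sum_cong_neutral[where T = "{2..}"])
    fix x :: nat assume "x \<in> {1..} - {2..}"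
    then have "x = 1" by auto
    then show "(real a ^ (x - 1) - real b ^ (x - 1)) * t ^ x * (1 / real m ^ x) = 0" by simp
  qed auto
qed

text \<open>Powers of the logarithm are O(sqrt m), so the summands are O(m^(-3/2)). The exponent
  \<open>2 * k\<close> below prepares for the square root.\<close>

lemma convergent_nest:
  assumes x: "\<And>m. m > 0 \<Longrightarrow> \<bar>x m\<bar>
      \<le> C / (real m)\<^sup>2" and f: "log_bounded f"
  shows "convergent (nest x f)"
proof -
  have C: "C \<ge> 0" using x[of 1] by simp
  obtain D k where D: "D \<ge> 0" "\<And>n. \<bar>f n\<bar>
      \<le> D * (1 + harm n) ^ k" using f by (metis log_boundedE)
  have "log_bounded (\<lambda>n. (1 + harm n) ^ (2 * k))"
    unfolding log_bounded_def by (rule exI[of _ 1], rule exI[of _ "2 *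
        k"]) (use one_plus_harm_ge_1 in \<open>simp add: power_mult\<close>)
  then have "log_small (\<lambda>n. (1 + harm n) ^ (2 * k) / real n)"
    using log_small_mult[OF _ log_small_inverse[of 1]] by fastforce
  from log_small_tendsto[OF this] have "Bseq (\<lambda>n. (1 + harm n :: real) ^ (2 * k) / real n)"
    by (intro convergent_imp_Bseq convergentI)
  then obtain B where B: "B > 0" "\<And>n. norm ((1 + harm n :: real) ^ (2 * k) / real n) \<le> B"
    by (elim BseqE) auto
  have h: "(1 + harm n :: real) ^ k \<le> sqrt B * sqrt (real n)" if "n > 0" for n
  proof -
    have "((1 + harm n :: real) ^ k)\<^sup>2 \<le> B * real n"
      using B(2)[of n] that one_plus_harm_ge_1[of n] by (simp add: power_mult[symmetric] mult.commute field_simps)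
    then show ?thesis
      by (simp add: real_sqrt_mult[symmetric] real_le_rsqrt)
  qed
  define E where "E = C * D * sqrt B"
  have sE: "summable (\<lambda>m. E * real m powr (- (3 / 2)))"
    by (rule summable_mult, rule summable_real_powr_iff[THEN iffD2]) simp
  define y where "y m = (if m = 0 then 0 else x m * f (m - 1))" for m
  have "norm (y m) \<le> E * real m powr (- (3 / 2))" for m
  proof (cases "m = 0")
    case False
    then have m: "m > 0" "real m > 0" by auto
    have "\<bar>f (m - 1)\<bar> \<le> D * (1 + harm m) ^ k" by (rule log_bounded_upto[OF D(1) D(2)]) simp
    also have "\<dots> \<le> D * (sqrt B * sqrt (real m))" using D(1) h[OF m(1)] by (intro mult_left_mono)
    finally have "\<bar>x m\<bar> * \<bar>f (m - 1)\<bar>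
        \<le> (C / (real m)\<^sup>2) * (D * (sqrt B * sqrt (real m)))"
      using x[OF m(1)] C D(1) by (intro mult_mono) auto
    also have "\<dots> = E * (sqrt (real m) / (real m)\<^sup>2)" by (simp add: E_def)
    also have "sqrt (real m) / (real m)\<^sup>2 = real m powr (- (3 / 2))"
    proof -
      have "real m powr (- (3 / 2)) = real m powr (1 / 2 - 2)" by simp
      also have "\<dots> = sqrt (real m) / (real m)\<^sup>2"
        using m unfolding powr_diff by (simp add: powr_half_sqrt)
      finally show ?thesis ..
    qed
    finally show ?thesis using False by (simp add: y_def abs_mult)
  qed (simp add: y_def)
  then have "summable y"
    by (intro summable_comparison_test[OF _ sE]) auto
  then have "(\<lambda>n. \<Sum>m<n. y m) \<longlonglongrightarrow> suminf y" by (rule summable_LIMSEQ)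
  then have "(\<lambda>n. \<Sum>m<Suc n. y m) \<longlonglongrightarrow> suminf y" by (rule LIMSEQ_Suc)
  moreover have "nest x f = (\<lambda>n. \<Sum>m<Suc n. y m)"
  proof
    fix n show "nest x f n = (\<Sum>m<Suc n. y m)"
      by (induction n) (auto simp: nest_Suc y_def)
  qed
  ultimately have "nest x f \<longlonglongrightarrow> suminf y" by (simp only:)
  then show ?thesis by (rule convergentI)
qed

definition weighted_mzv_sum :: "nat \<Rightarrow> real" where
  "weighted_mzv_sum l = (\<Sum>(l1, l2, l3, l4) \<in> {(l1, l2, l3, l4). l1 \<ge> 2 \<and> l2 \<ge>
      1 \<and> l3 \<ge> 1 \<and> l4 \<ge> 1 \<and> l1 + l2 + l3 + l4 = l}.
            (3 ^ l2 * 2 ^ (l1 - 1) - 3 ^ l2 - 1) * 2 ^ (l1 + l3) * mzv [l1, l2, l3, l4])"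

text \<open>The two leading-letter differences are treated as single letters with nonnegative
  coefficients: the four sums taken separately diverge.\<close>

lemma quadruple_part_limit:
  assumes t: "0 < t" "t < 1 / 8"
  obtains S where "quadruple_part (1 / t)
      \<longlonglongrightarrow> S" "(\<lambda>l. weighted_mzv_sum l * t ^ l) sums S"
proof -
  interpret large_parameter "1 / t" using t by unfold_locales (simp add: field_simps)
  let ?y = "\<lambda>a. letter_val (1 / t) (a, 1)"
  have sq: "\<bar>(?y a - ?y b) m\<bar> \<le> 4 / (real m)\<^sup>2" if "m > 0" "a \<le> 4" "b
      \<le> 4" for a b m
  proof -
    have nz: "1 / t * real m - real a \<noteq> 0" "1 / t * real m - real b \<noteq> 0"
      using letter_val_denom_nz that by auto
    have "(?y a - ?y b) m = (real a - real b) * (?y a m * ?y b m)"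
      using nz by (simp add: letter_val_def diff_frac_eq)
    moreover have "\<bar>?y a m\<bar> * \<bar>?y b m\<bar> \<le> (1 / real m) * (1 / real m)"
      using letter_val_bound[of m a 1 1] letter_val_bound[of m b 1 1] that by (intro mult_mono) auto
    moreover have "\<bar>real a - real b\<bar> \<le> 4" using that by linarith
    ultimately have "\<bar>(?y a - ?y b) m\<bar> \<le> 4 * ((1 / real m) * (1 / real m))"
      by (simp only: abs_mult) (rule mult_mono, simp_all only: zero_le_numeral abs_ge_zero mult_nonneg_nonneg)
    then show ?thesis by (simp add: power2_eq_square)
  qed
  have "convergent (nest (?y 4 - ?y 2) (W (1 / t) [(3, 1), (2, 1), (1, 1)]))"
    "convergent (nest (?y 2 - ?y 0) (W (1 / t) [(1, 1), (2, 1), (1, 1)]))"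
    by (rule convergent_nest[OF sq log_bounded_W]; simp)+
  then obtain S1 S2 where S: "nest (?y 4 - ?y 2) (W (1 / t) [(3, 1), (2, 1), (1, 1)])
      \<longlonglongrightarrow> S1"
    "nest (?y 2 - ?y 0) (W (1 / t) [(1, 1), (2, 1), (1, 1)]) \<longlonglongrightarrow> S2"
    by (auto simp: convergent_def)
  have quadruple_part: "quadruple_part (1 / t)
      = (\<lambda>N. 12 * nest (?y 4 - ?y 2) (W (1 / t) [(3, 1), (2, 1), (1, 1)]) N
     - 4 * nest (?y 2 - ?y 0) (W (1 / t) [(1, 1), (2, 1), (1, 1)]) N)"
    by (auto simp: quadruple_part_def[abs_def] W.simps(2)[of _ _ "_ #
        _"] nest_def sum_subtractf left_diff_distrib)
  have lim: "quadruple_part (1 / t) \<longlonglongrightarrow> 12 * S1 - 4 * S2"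
    unfolding quadruple_part by (intro tendsto_intros S)
  let ?K = "{2 :: nat..} \<times> {1 :: nat..} \<times> {1 :: nat..} \<times> {1 :: nat..}"
  have y: "((\<lambda>l. real a ^ (l - 1) * t ^ l * (1 / real m ^ l)) has_sum ?y a m) {1..}"
    if "m > 0" "a \<le> 4" for a m by (rule letter_has_sum[OF t that(2,1)])
  have yd: "((\<lambda>l. (real a ^ (l - 1) - real b ^ (l - 1)) * t ^ l * (1 / real m ^ l)) has_sum
      (?y a - ?y b) m) {2..}"
    if "m > 0" "a \<le> 4" "b \<le> 4" for a b m
    using letter_diff_has_sum[OF t that(2,3,1)] by (simp only: minus_apply)
  have pd: "real a ^ (l - 1) - real b ^ (l - 1) \<ge> 0" if "b \<le> a" for a b l
    using that by (simp add: power_mono)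
  have nst: "W (1 / t) [(a, 1), (b, 1), (c, 1)] = nest (?y a) (nest (?y b) (nest (?y c) 1))" for a b c
    by (simp add: W.simps)
  have h1: "((\<lambda>(l1, l2, l3, l4). (real 4 ^ (l1 - 1) - real 2 ^ (l1 - 1)) * real 3 ^ (l2 - 1)
      * real 2 ^ (l3 - 1)
      * real 1 ^ (l4 - 1) * t ^ (l1 + l2 + l3 + l4) * mzv [l1, l2, l3, l4]) has_sum S1) ?K"
  proof (rule mzv_generating_has_sum[OF t(1)])
    show "nest (?y 4 - ?y 2) (nest (?y 3) (nest (?y 2) (nest (?y 1) 1))) \<longlonglongrightarrow> S1"
      using S(1) unfolding nst .
  qed (rule y yd pd zero_le_power of_nat_0_le_iff; simp)+
  have h2: "((\<lambda>(l1, l2, l3, l4). (real 2 ^ (l1 - 1) - real 0 ^ (l1 - 1)) * real 1 ^ (l2 - 1)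
      * real 2 ^ (l3 - 1)
      * real 1 ^ (l4 - 1) * t ^ (l1 + l2 + l3 + l4) * mzv [l1, l2, l3, l4]) has_sum S2) ?K"
  proof (rule mzv_generating_has_sum[OF t(1)])
    show "nest (?y 2 - ?y 0) (nest (?y 1) (nest (?y 2) (nest (?y 1) 1))) \<longlonglongrightarrow> S2"
      using S(2) unfolding nst .
  qed (rule y yd pd zero_le_power of_nat_0_le_iff; simp)+
  let ?c = "\<lambda>(l1, l2, l3, l4). (3 ^ l2 * 2 ^ (l1 - 1) - 3 ^ l2 - 1) * 2 ^ (l1 + l3) * mzv
      [l1, l2, l3, l4]"
  let ?s = "\<lambda>(l1 :: nat, l2, l3, l4). l1 + l2 + l3 + l4"
  have h: "((\<lambda>k. ?c k * t ^ ?s k) has_sum (12 * S1 - 4 * S2)) ?K"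
  proof (rule has_sum_cong[THEN iffD1, OF _ has_sum_diff_real[OF has_sum_cmult_right[OF h1, of 12] has_sum_cmult_right[OF h2, of 4]]])
    fix k assume k: "k \<in> ?K"
    obtain l1 l2 l3 l4 where kk: "k = (l1, l2, l3, l4)" by (cases k) auto
    have ge: "l1 \<ge> 2" "l2 \<ge> 1" "l3 \<ge> 1" using k by (auto simp: kk)
    \<comment> \<open>Removes natural subtraction and makes \<open>0 ^ (l1 - 1)\<close> vanish. The
      factors 12 and 4 then absorb the exponent shifts of the bases 2 and 3.\<close>
    define n1 n2 n3 where "n1 = l1 - 2" "n2 = l2 - 1" "n3 = l3 - 1"
    with ge have n: "l1 = n1 + 2" "l2 = Suc n2" "l3 = Suc n3" by auto
    have "(4 :: real) ^ n1 = 2 ^ n1 * 2 ^ n1" by (simp flip: power_mult_distrib)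
    then show "12 * (case k of (l1, l2, l3, l4) \<Rightarrow>
        (real 4 ^ (l1 - 1) - real 2 ^ (l1 - 1)) * real 3 ^ (l2 - 1) * real 2 ^ (l3 - 1)
      * real 1 ^ (l4 - 1) * t ^ (l1 + l2 + l3 + l4) * mzv [l1, l2, l3, l4])
      - 4 * (case k of (l1, l2, l3, l4) \<Rightarrow> (real 2 ^ (l1 - 1) - real 0 ^ (l1 - 1)) * real
          1 ^ (l2 - 1) * real 2 ^ (l3 - 1)
      * real 1 ^ (l4 - 1) * t ^ (l1 + l2 + l3 + l4) * mzv [l1, l2, l3, l4]) = ?c k * t ^ ?s k"
      unfolding kk n by (simp add: power_add algebra_simps)
  qed
  let ?B = "\<lambda>l. {(l1, l2, l3, l4). l1 \<ge> 2 \<and> l2 \<ge> 1 \<and> l3 \<ge> 1 \<and> l4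
      \<ge> 1 \<and> l1 + l2 + l3 + l4 = l}"
  have "((\<lambda>(l, k). ?c k * t ^ l) has_sum (12 * S1 - 4 * S2)) (Sigma UNIV ?B)"
    using h
  proof (subst has_sum_reindex_bij_witness[where T = ?K and i = "\<lambda>k. (?s k, k)" and j = snd])
  qed auto
  then have "((\<lambda>l. weighted_mzv_sum l * t ^ l) has_sum (12 * S1 - 4 * S2)) UNIV"
  proof (rule has_sum_SigmaD)
    fix l :: nat
    have "finite (?B l)"
      by (rule finite_subset[of _ "{..l} \<times> {..l} \<times> {..l} \<times> {..l}"]) auto
    then show "((\<lambda>y. (case (l, y) of (l, k) \<Rightarrow> ?c k * t ^ l)) has_sum
        (weighted_mzv_sum l * t ^ l)) (?B l)"
      by (simp add: has_sum_finite_iff weighted_mzv_sum_def sum_distrib_right)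
  qed
  then have "(\<lambda>l. weighted_mzv_sum l * t ^ l) sums (12 * S1 - 4 * S2)" by (rule has_sum_imp_sums)
  with lim show ?thesis using that by blast
qed

section \<open>The power series identity\<close>

text \<open>A further factor u / (1 - u) turns the coefficients into shifted prefix sums, and the
  hockey-stick identity raises k by one.\<close>

lemma choose_series:
  fixes u :: real
  assumes u: "0 \<le> u" "u < 1"
  shows "(\<lambda>n. real (n choose k) * u ^ Suc n) sums (u / (1 - u)) ^ Suc k"
proof (induction k)
  case 0
  show ?case
    using sums_mult[OF geometric_sums[of u], of u] u by simp
next
  case (Suc k)
  let ?a = "\<lambda>n. real (n choose k) * u ^ Suc n" and ?b = "\<lambda>n. u ^ n"
  have "(\<lambda>n. \<Sum>i\<le>n. ?a i * ?b (n - i)) sums ((\<Sum>n. ?a n) * (\<Sum>n. ?b n))"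
    by (rule Cauchy_product_sums) (use Suc u in \<open>auto simp: sums_iff\<close>)
  moreover have "(\<Sum>i\<le>n. ?a i * ?b (n - i)) = real (Suc n choose Suc k) * u ^ Suc n" for n
  proof -
    have "(\<Sum>i\<le>n. ?a i * ?b (n - i)) = (\<Sum>i\<le>n. real (i choose k) * u ^ Suc n)"
      by (intro sum.cong refl) (simp add: power_add[symmetric])
    also have "\<dots> = real (\<Sum>i\<le>n. i choose k) * u ^ Suc n"
      by (simp only: of_nat_sum sum_distrib_right)
    finally show ?thesis by (simp only: sum_choose_upper)
  qed
  ultimately have "(\<lambda>n. real (Suc n choose Suc k) * u ^ Suc n) sums
      ((u / (1 - u)) ^ Suc k * (1 / (1 - u)))"
    using Suc geometric_sums[of u] u by (simp add: sums_iff)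
  from sums_mult[OF this, of u]
  have "(\<lambda>n. real (Suc n choose Suc k) * u ^ Suc (Suc n)) sums ((u / (1 - u)) ^ Suc (Suc k))"
    by (simp add: mult_ac)
  then show ?case by (subst (asm) sums_Suc_iff) simp
qed

text \<open>The condition \<open>q 0 = 0\<close> removes the exponent 1, where the series of
  \<open>riemann_zeta\<close> diverges.\<close>

lemma zeta_generating_sums:
  fixes q :: "nat \<Rightarrow> real"
  assumes t: "t > 0" and q: "\<And>n. q n \<ge> 0" "q 0 = 0"
    and x: "\<And>m. m > 0 \<Longrightarrow> (\<lambda>n. q n * (t / real m) ^ Suc n) sums x m"
    and lim: "nest x 1 \<longlonglongrightarrow> S"
  shows "(\<lambda>n. q n * riemann_zeta (Suc n) * t ^ Suc n) sums S"
proof -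
  define f where "f = (\<lambda>(m, n). q n * (t / real (Suc m)) ^ Suc n)"
  have fpos: "f y \<ge> 0" for y using q t by (auto simp: f_def split: prod.split)
  have inner: "((\<lambda>n. f (m, n)) has_sum x (Suc m)) UNIV" for m
    using x[of "Suc m"] fpos[of "(m, _)"] by (intro sums_nonneg_imp_has_sum) (auto simp: f_def)
  have "nest x 1 = (\<lambda>N. \<Sum>m<N. x (Suc m))"
  proof
    fix N show "nest x 1 N = (\<Sum>m<N. x (Suc m))" by (induction N) (auto simp: nest_Suc)
  qed
  then have "(\<lambda>m. x (Suc m)) sums S" using lim by (simp add: sums_def)
  then have outer: "((\<lambda>m. x (Suc m)) has_sum S) UNIV"
    using has_sum_nonneg[OF inner] fpos by (intro sums_nonneg_imp_has_sum) auto
  have "f summable_on UNIV \<times> UNIV"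
    by (rule summable_on_SigmaI[OF inner]) (use outer fpos in \<open>auto simp: summable_on_def\<close>)
  from has_sum_SigmaI[OF inner outer this]
  have sw: "((\<lambda>(n, m). f (m, n)) has_sum S) (UNIV \<times> UNIV)"
    by (subst (asm) has_sum_swap)
  have "((\<lambda>n. q n * riemann_zeta (Suc n) * t ^ Suc n) has_sum S) UNIV"
  proof (rule has_sum_SigmaD[OF sw])
    fix n :: nat
    show "((\<lambda>m. (case (n, m) of (n, m) \<Rightarrow> f (m, n))) has_sum
        (q n * riemann_zeta (Suc n) * t ^ Suc n)) UNIV"
    proof (cases "n = 0")
      case True
      then show ?thesis using q by (simp add: f_def)
    next
      case False
      have "summable (\<lambda>m. inverse (real m ^ Suc n))"
        by (rule inverse_power_summable) (use False in simp)
      then have "summable (\<lambda>m. inverse (real (Suc m) ^ Suc n))" by (subst summable_Suc_iff)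
      then have "(\<lambda>m. 1 / real (Suc m) ^ Suc n) sums riemann_zeta (Suc n)"
        unfolding riemann_zeta_def inverse_eq_divide by (rule summable_sums)
      then have "((\<lambda>m. 1 / real (Suc m) ^ Suc n) has_sum riemann_zeta (Suc n)) UNIV"
        by (rule sums_nonneg_imp_has_sum) simp
      from has_sum_cmult_right[OF this, of "q n * t ^ Suc n"]
      show ?thesis by (simp add: f_def power_divide mult_ac)
    qed
  qed
  then show ?thesis by (rule has_sum_imp_sums)
qed

lemma fast_convergent_limit: "fast_convergent X \<Longrightarrow> \<exists>c. X \<longlonglongrightarrow> c"
proof -
  assume "fast_convergent X"
  then obtain c where "log_small (\<lambda>n. X n - c)" by (auto simp: fast_convergent_def)
  from log_small_tendsto[OF this] have "X \<longlonglongrightarrow> c" by (simp add: LIM_zero_iff)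
  then show ?thesis ..
qed

text \<open>\<open>zeta_coeff n\<close> belongs to the power \<open>t ^ Suc n\<close>.\<close>

definition zeta_coeff :: "nat \<Rightarrow> real" where
  "zeta_coeff n = (real (n choose 3) / 2 + 2 * real (n choose 2) + real (n choose 1)
      - 2 * (if n = 0 then 0 else 1))
     * riemann_zeta (Suc n)"

lemma zeta_part_limit:
  assumes t: "0 < t" "t < 1 / 8"
  obtains S where "zeta_part (1 / t)
      \<longlonglongrightarrow> S" "(\<lambda>n. zeta_coeff n * t ^ Suc n) sums S"
proof -
  interpret large_parameter "1 / t" using t by unfold_locales (simp add: field_simps)
  have u: "0 \<le> t / real m" "t / real m < 1" if "m > 0" for m
  proof -
    have "real m \<ge> 1" using that by simp
    then have "t < real m" using t by linarith
    then show "0 \<le> t / real m" "t / real m < 1" using t that by simp_all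
  qed
  have lt1: "letter_val (1 / t) (1, r) m = (t / real m / (1 - t / real m)) ^ r" if "m > 0" for m r
  proof -
    have "real m - t > 0" using u[OF that] that by (simp add: field_simps)
    then have "1 / (1 / t * real m - real 1) = t / real m / (1 - t / real m)"
      using t that by (simp add: field_simps)
    then show ?thesis unfolding letter_val_def fst_conv snd_conv power_one_over[symmetric] by simp
  qed
  have W: "\<exists>c. W (1 / t) [(1, Suc r)] \<longlonglongrightarrow> c \<and>
      (\<lambda>n. real (n choose r) * riemann_zeta (Suc n) * t ^ Suc n) sums c" if "r > 0" for r
  proof -
    have "fast_convergent (W (1 / t) [(1, Suc r)])" by (rule fast_convergent_W2) (use that in auto)
    then obtain c where c: "W (1 / t) [(1, Suc r)] \<longlonglongrightarrow> c"
      using fast_convergent_limit by blast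
    have "(\<lambda>n. real (n choose r) * riemann_zeta (Suc n) * t ^ Suc n) sums c"
    proof (rule zeta_generating_sums[OF t(1)])
      show "(\<lambda>n. real (n choose r) * (t / real m) ^ Suc n) sums letter_val (1 / t)
          (1, Suc r) m" if "m > 0" for m
        unfolding lt1[OF that] by (rule choose_series[OF u[OF that]])
      show "nest (letter_val (1 / t) (1, Suc r)) 1
          \<longlonglongrightarrow> c" using c by (simp add: W.simps)
    qed (use that in auto)
    with c show ?thesis by blast
  qed
  from W[of 1] W[of 2] W[of 3] obtain c2 c3 c4 where
    c: "W (1 / t) [(1, 2)] \<longlonglongrightarrow> c2" "W (1 / t) [(1, 3)]
        \<longlonglongrightarrow> c3" "W (1 / t) [(1, 4)] \<longlonglongrightarrow> c4"
    and s: "(\<lambda>n. real (n choose 1) * riemann_zeta (Suc n) * t ^ Suc n) sums c2"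
      "(\<lambda>n. real (n choose 2) * riemann_zeta (Suc n) * t ^ Suc n) sums c3"
      "(\<lambda>n. real (n choose 3) * riemann_zeta (Suc n) * t ^ Suc n) sums c4"
    by (auto simp: numeral_eq_Suc)
  obtain c1 where c1: "(\<lambda>N. W (1 / t) [(1, 1)] N - W (1 / t) [(0, 1)] N)
      \<longlonglongrightarrow> c1"
    using fast_convergent_limit[OF fast_convergent_diff] by blast
  have s1: "(\<lambda>n. (if n = 0 then 0 else 1) * riemann_zeta (Suc n) * t ^ Suc n) sums c1"
  proof (rule zeta_generating_sums[OF t(1)])
    show "nest (letter_val (1 / t) (1, 1) - letter_val (1 / t) (0, 1)) 1 \<longlonglongrightarrow> c1"
    proof -
      have "nest (letter_val (1 / t) (1, 1) - letter_val (1 / t) (0, 1)) 1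
          = (\<lambda>N. W (1 / t) [(1, 1)] N - W (1 / t) [(0, 1)] N)"
        by (auto simp: W.simps nest_def sum_subtractf)
      then show ?thesis using c1 by simp
    qed
    fix m :: nat assume m: "m > 0"
    have "(\<lambda>n. (t / real m) ^ Suc n - (if n = 0 then t / real m else 0)) sums
        (t / real m / (1 - t / real m) - t / real m)"
      using sums_diff[OF choose_series[OF u[OF m], of 0] sums_single[of 0 "\<lambda>_. t / real m"]] by simp
    moreover have "(t / real m) ^ Suc n - (if n = 0 then t / real m else 0)
        = (if n = 0 then 0 else 1) * (t / real m) ^ Suc n" for n
      by simp
    moreover have "t / real m / (1 - t / real m) - t / real m
        = (letter_val (1 / t) (1, 1) - letter_val (1 / t) (0, 1)) m"
    proof -
      have "letter_val (1 / t) (0, 1) m = t / real m" by (simp add: letter_val_def)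
      then show ?thesis unfolding minus_apply lt1[OF m] by simp
    qed
    ultimately show "(\<lambda>n. (if n = 0 then 0 else 1) * (t / real m) ^ Suc n) sums
        (letter_val (1 / t) (1, 1) - letter_val (1 / t) (0, 1)) m"
      by (simp only:)
  qed auto
  have "zeta_part (1 / t) \<longlonglongrightarrow> c4 / 2 + 2 * c3 + c2 - 2 * c1"
    unfolding zeta_part_def[abs_def] by (intro tendsto_intros c c1) auto
  moreover have "(\<lambda>n. zeta_coeff n * t ^ Suc n) sums (c4 / 2 + 2 * c3 + c2 - 2 * c1)"
  proof -
    have "(\<lambda>n. real (n choose 3) * riemann_zeta (Suc n) * t ^ Suc n / 2
      + 2 * (real (n choose 2) * riemann_zeta (Suc n) * t ^ Suc n)
      + real (n choose 1) * riemann_zeta (Suc n) * t ^ Suc n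
      - 2 * ((if n = 0 then 0 else 1) * riemann_zeta (Suc n) * t ^ Suc n)) sums
          (c4 / 2 + 2 * c3 + c2 - 2 * c1)"
      by (intro sums_diff sums_add sums_mult sums_divide s s1)
    then show ?thesis by (rule sums_cong[THEN iffD1, rotated]) (simp add: zeta_coeff_def algebra_simps)
  qed
  ultimately show ?thesis using that by blast
qed

section \<open>Comparison of coefficients\<close>

text \<open>Since t = \<open>1 / \<tau>\<close>, identities are available for small positive t only.
  Once the lower coefficients vanish, division by \<open>t ^ n\<close> and a limit from the right
  isolate \<open>a n\<close>.\<close>

lemma powser_coeff_zero_at_right:
  fixes a :: "nat \<Rightarrow> real"
  assumes r: "r > 0" and s: "\<And>t. 0 < t \<Longrightarrow> t < r
      \<Longrightarrow> (\<lambda>n. a n * t ^ n) sums 0"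
  shows "a n = 0"
proof (induction n rule: less_induct)
  case (less n)
  have sh: "(\<lambda>m. a (m + n) * t ^ m) sums 0" if t: "0 < t" "t < r" for t
  proof -
    have "(\<lambda>m. a (m + n) * t ^ (m + n)) sums 0"
      using s[OF t] less by (subst sums_zero_iff_shift) auto
    then have "(\<lambda>m. (a (m + n) * t ^ m) * t ^ n) sums (0 * t ^ n)"
      by (simp add: power_add mult_ac)
    then show ?thesis using t by (subst (asm) sums_mult2_iff) auto
  qed
  \<comment> \<open>Convergence at r / 2 extends to a two-sided neighbourhood of 0, as the limit
    theorem for power series demands.\<close>
  have sm: "summable (\<lambda>m. a (m + n) * x ^ m)" if "norm x < r / 2" for x
    by (rule powser_inside[OF sums_summable[OF sh[of "r / 2"]]]) (use r that in auto)
  define f where "f x = (\<Sum>m. a (m + n) * x ^ m)" for x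
  have "(f \<longlongrightarrow> a (0 + n)) (at 0)"
    by (rule powser_limit_0[of "r / 2"]) (use r sm in \<open>auto simp: f_def intro!: summable_sums\<close>)
  then have "(f \<longlongrightarrow> a n) (at_right 0)"
    by (simp add: filterlim_at_split)
  moreover have "\<forall>\<^sub>F x in at_right 0. f x = 0"
    using eventually_at_right_less[of 0] eventually_at_right_field[THEN iffD2, of 0 "\<lambda>x. x < r"] r
    unfolding eventually_at_right_field
    by (intro exI[of _ r]) (auto simp: f_def intro!: sums_unique[symmetric] sh)
  ultimately have "((\<lambda>_. 0) \<longlongrightarrow> a n) (at_right (0 :: real))"
    by (rule Lim_transform_eventually)
  then show ?case by (simp add: tendsto_const_iff)
qed

lemma zero_letters:
  "W \<tau> [(0, 1)] N = W 1 [(0, 1)] N / \<tau>"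
  "W \<tau> [(0, 2)] N = W 1 [(0, 2)] N / \<tau>\<^sup>2"
  "W \<tau> [(0, 1), (0, 1)] N = W 1 [(0, 1), (0, 1)] N / \<tau>\<^sup>2"
  "dW \<tau> [(0, 1)] N = dW 1 [(0, 1)] N / \<tau>"
  "dW \<tau> [(0, 1), (0, 1)] N = dW 1 [(0, 1), (0, 1)] N / \<tau>\<^sup>2"
  by (simp_all add: W.simps nest_def letter_val_def sum_divide_distrib sum_distrib_left power_mult_distrib
      power2_eq_square mult_ac)

text \<open>Letters 0 scale by powers of \<open>\<tau>\<close>, and each term has total power 2, 3
  or 4. The value 1 for \<open>\<tau>\<close>, outside \<open>large_parameter\<close>, merely
  normalises.\<close>

lemma polynomial_part_homogeneous:
  "polynomial_part \<tau> N = W 1 [(0, 2)] N / \<tau> ^ 2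
    + (2 * defect 1 [(0, 1)] [(0, 1), (0, 1)] N - 2 * (W 1 [(0, 1)] N * W 1 [(0, 2)] N)) / \<tau> ^ 3
    + (10 * scaled_corner_sum 1 (W 1 [(0, 1)]) (W 1 [(0, 1)]) N
        - 10 * scaled_corner_sum 1 1 (\<lambda>n. W 1 [(0, 1)] n * W 1 [(0, 1)] n) N
        + 4 * (W 1 [(0, 2)] N * W 1 [(0, 2)] N)) / \<tau> ^ 4"
proof -
  have "partial_sum (cauchy_prod (dW \<tau> [(0, 1)]) (dW \<tau> [(0, 1), (0, 1)])) N
      = partial_sum (cauchy_prod (dW 1 [(0, 1)]) (dW 1 [(0, 1), (0, 1)])) N / \<tau> ^ 3"
    unfolding partial_sum_def cauchy_prod_def zero_letters(4,5)[of \<tau>] by (simp add: sum_divide_distrib power_numeral_reduce mult_ac)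
  then have 1: "defect \<tau> [(0, 1)] [(0, 1), (0, 1)] N
      = defect 1 [(0, 1)] [(0, 1), (0, 1)] N / \<tau> ^ 3"
    unfolding defect_def zero_letters(1,3)[of \<tau>] by (simp add: diff_divide_distrib power_numeral_reduce mult_ac)
  have 2: "scaled_corner_sum \<tau> (W \<tau> [(0, 1)]) (W \<tau> [(0, 1)]) N
      = scaled_corner_sum 1 (W 1 [(0, 1)]) (W 1 [(0, 1)]) N / \<tau> ^ 4"
    and 3: "scaled_corner_sum \<tau> 1 (\<lambda>n. W \<tau> [(0, 1)] n * W \<tau> [(0, 1)] n) N
      = scaled_corner_sum 1 1 (\<lambda>n. W 1 [(0, 1)] n * W 1 [(0, 1)] n) N / \<tau> ^ 4"
    unfolding scaled_corner_sum_def corner_sum_def zero_letters(1)[of \<tau>]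
    by (simp_all add: sum_divide_distrib power_numeral_reduce mult_ac)
  show ?thesis
    unfolding polynomial_part_def 1 2 3 unfolding zero_letters(1,2)[of \<tau>]
    by (simp add: add_divide_distrib diff_divide_distrib power_numeral_reduce mult_ac)
qed

lemma zeta_coeff_polynomial:
  assumes "l \<ge> 2"
  shows "zeta_coeff (l - 1) = (real l + 1) * (real l ^ 2 + 5 * real l - 18) / 12 * riemann_zeta l"
proof -
  obtain n where l: "l = Suc n" "n > 0" using assms by (cases l) auto
  have c: "real (n choose 2) = real n * (real n - 1) / 2"
    "real (n choose 3) = real n * (real n - 1) * (real n - 2) / 6"
    by (simp_all add: binomial_gbinomial gbinomial_prod_rev numeral_eq_Suc lessThan_Suc fact_numeral field_simps)
  show ?thesis
    using l(2) unfolding l(1) zeta_coeff_def diff_Suc_1 c by (simp add: field_simps power2_eq_square)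
qed

theorem theorem1p2:
  fixes l :: nat
  assumes "l \<ge> 5"
  shows "(\<Sum>(l1, l2, l3, l4) \<in> {(l1, l2, l3, l4). l1 \<ge> 2 \<and> l2 \<ge> 1 \<and> l3 \<ge> 1 \<and> l4 \<ge> 1 \<and> l1 + l2 + l3 + l4 = l}.
            (3 ^ l2 * 2 ^ (l1 - 1) - 3 ^ l2 - 1) * 2 ^ (l1 + l3) * mzv [l1, l2, l3, l4])
         = (real l + 1) * (real l ^ 2 + 5 * real l - 18) / 12 * riemann_zeta l"
proof -
  define a where "a l = weighted_mzv_sum l - (if l = 0 then 0 else zeta_coeff (l - 1))" for l
  \<comment> \<open>Convergence of \<open>polynomial_part\<close> for each t is inherited from the
    other two parts; nothing is claimed about its separate coefficients.\<close>
  have D: "\<exists>d. polynomial_part (1 / t)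
      \<longlonglongrightarrow> d \<and> (\<lambda>l. a l * t ^ l) sums d" if t: "0 < t" "t < 1 / 8" for t
  proof -
    interpret large_parameter "1 / t" using t by unfold_locales (simp add: field_simps)
    obtain S where S: "quadruple_part (1 / t)
        \<longlonglongrightarrow> S" "(\<lambda>l. weighted_mzv_sum l * t ^ l) sums
        S" by (rule quadruple_part_limit[OF t])
    obtain R where R: "zeta_part (1 / t)
        \<longlonglongrightarrow> R" "(\<lambda>n. zeta_coeff n * t ^ Suc n) sums
        R" by (rule zeta_part_limit[OF t])
    have "(\<lambda>N. quadruple_part (1 / t) N - zeta_part (1 / t) N
        - (quadruple_part (1 / t) N - zeta_part (1 / t) N - polynomial_part (1 / t) N))
        \<longlonglongrightarrow> S - R - 0"
      by (intro tendsto_diff S R log_small_tendsto[OF quadruple_part_asymp])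
    moreover have "(\<lambda>l. (if l = 0 then 0 else zeta_coeff (l - 1)) * t ^ l) sums R"
      using sums_Suc_iff[of "\<lambda>l. (if l = 0 then 0 else zeta_coeff (l - 1)) * t ^ l" R] R(2) by simp
    then have "(\<lambda>l. a l * t ^ l) sums (S - R)"
      using sums_diff[OF S(2)] by (simp add: a_def left_diff_distrib)
    ultimately show ?thesis by auto
  qed
  \<comment> \<open>The zeros of \<open>X\<^sup>3 - 28 X\<^sup>2 + 224 X - 512\<close> are \<open>2\<^sup>2\<close>, \<open>2\<^sup>3\<close>, \<open>2\<^sup>4\<close>; hence this
    combination of dilations annihilates the powers \<open>t\<^sup>2\<close>, \<open>t\<^sup>3\<close>, \<open>t\<^sup>4\<close> of \<open>polynomial_part\<close>.\<close>
  have "a l * (8 ^ l - 28 * 4 ^ l + 224 * 2 ^ l - 512) = 0"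
  proof (rule powser_coeff_zero_at_right[of "1 / 64" "\<lambda>l. a l *
      (8 ^ l - 28 * 4 ^ l + 224 * 2 ^ l - 512)"])
    \<comment> \<open>The bound 1 / 64 gives 8 t < 1 / 8, so all four dilations are in the range of
      \<open>D\<close>.\<close>
    fix t :: real assume t: "0 < t" "t < 1 / 64"
    obtain d1 d2 d4 d8 where F: "polynomial_part (1 / t)
        \<longlonglongrightarrow> d1" "polynomial_part (1 / (2 * t)) \<longlonglongrightarrow> d2"
        "polynomial_part (1 / (4 * t)) \<longlonglongrightarrow> d4" "polynomial_part (1 / (8 * t))
            \<longlonglongrightarrow> d8"
      and s: "(\<lambda>l. a l * t ^ l) sums d1" "(\<lambda>l. a l * (2 * t) ^ l) sums d2"
        "(\<lambda>l. a l * (4 * t) ^ l) sums d4" "(\<lambda>l. a l * (8 * t) ^ l) sums d8"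
      using D[of t] D[of "2 * t"] D[of "4 * t"] D[of "8 * t"] t by auto
    have "(\<lambda>N. polynomial_part (1 / (8 * t)) N - 28 * polynomial_part (1 / (4 * t)) N
        + 224 * polynomial_part (1 / (2 * t)) N - 512 * polynomial_part (1 / t) N)
        \<longlonglongrightarrow> d8 - 28 * d4 + 224 * d2 - 512 * d1"
      by (intro tendsto_intros F)
    \<comment> \<open>The combination vanishes for every N, before any limit.\<close>
    moreover have "polynomial_part (1 / (8 * t)) N - 28 * polynomial_part (1 / (4 * t)) N
        + 224 * polynomial_part (1 / (2 * t)) N - 512 * polynomial_part (1 / t) N = 0" for N
      unfolding polynomial_part_homogeneous[of "1 /
          _"] using t(1) by (simp add: field_simps power_mult_distrib)
    ultimately have "d8 - 28 * d4 + 224 * d2 - 512 * d1 = 0"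
      by (simp add: LIMSEQ_const_iff)
    moreover have "(\<lambda>l. a l * (8 * t) ^ l - 28 * (a l * (4 * t) ^ l)
        + 224 * (a l * (2 * t) ^ l) - 512 * (a l * t ^ l))
        sums (d8 - 28 * d4 + 224 * d2 - 512 * d1)"
      by (intro sums_add sums_diff sums_mult s)
    ultimately show "(\<lambda>l. a l * (8 ^ l - 28 * 4 ^ l + 224 * 2 ^ l - 512) * t ^ l) sums 0"
      by (simp add: power_mult_distrib algebra_simps)
  qed simp
  moreover have "8 ^ l - 28 * 4 ^ l + 224 * 2 ^ l - 512 = (2 ^ l - 4) * (2 ^ l - 8) * (2 ^ l - 16 :: real)"
  proof -
    have "(8 :: real) ^ l = 2 ^ l * 2 ^ l * 2 ^ l" "(4 :: real) ^ l = 2 ^ l * 2 ^ l"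
      by (simp_all flip: power_mult_distrib)
    then show ?thesis by (simp add: algebra_simps)
  qed
  \<comment> \<open>Here l >= 5 enters: \<open>2 ^ l\<close> is at least 32 and avoids the zeros 4,
    8, 16.\<close>
  moreover have "(2 :: real) ^ l \<ge> 2 ^ 5" using assms by (intro power_increasing) auto
  ultimately have "a l = 0" by auto
  then have "weighted_mzv_sum l = zeta_coeff (l - 1)" using assms by (simp add: a_def)
  then show ?thesis using zeta_coeff_polynomial[of l] assms by (simp add: weighted_mzv_sum_def)
qed

end
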